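(* Let $\mathfrak{h}$ be a finite dimensional commutative Lie superalgebra over $\mathbb{C}$ and let $V$ be a finite dimensional semisimple $\mathfrak{h}$-module whose weights make up a basis for $\mathfrak{h}^*$. Then every super dynamical $r$-matrix $r : \mathfrak{h}^* \rightarrow \operatorname{End}(V \otimes V)$ with zero weight and zero coupling constant, holomorphic on an open polydisc $U \subset \mathfrak{h}^*$, can be quantized to a super dynamical $R$-matrix $R$ on $U$. That is, there is a power series in $\gamma$ $$R_{\gamma}(\lambda) = 1 - \gamma\, r(\lambda) + \sum_{n=2}^{\infty} \gamma^n r_n(\lambda), \qquad \lambda \in U,$$ with coefficients $r_n : U \to \operatorname{End}(V\otimes V)$, which satisfies the quantum dynamical Yang-Baxter equation with step $\gamma$ and the zero weight condition.
   Context: **Setting.** $V = V_{\overline 0}\oplus V_{\overline 1}$ is a super vector space. Its weights $\omega_1,\dots,\omega_N$ form a basis of $\mathfrak{h}^*$, with $N=\dim V=\dim\mathfrak{h}$. Let $x_1,\dots,x_N$ be the dual basis of $\mathfrak{h}$; these elements are all even. Let $v_1,\dots,v_N$ be a homogeneous $\mathfrak{h}$-eigenbasis of $V$ with $x_iv_j=\delta_{ij}v_j$. Elements of $\mathfrak{h}$ are regarded as elements of $\operatorname{End}(V)$ through their action on $V$. $\operatorname{End}(V\otimes V)$ is identified with $\operatorname{End}(V)\otimes\operatorname{End}(V)$, with the usual sign rule for tensor products of superspaces. For a homogeneous element $a$, $|a|\in\{0,1\}$ denotes its parity. $V[\omega]$ denotes the $\omega$-weight space of $V$. **Super twist and super symmetrizing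 maps.** On homogeneous elements, $$T_s(a\otimes b)=(-1)^{|a||b|}b\otimes a,$$ $$\operatorname{Alt}_s(a\otimes b\otimes c)=a\otimes b\otimes c+(-1)^{|a|(|b|+|c|)}b\otimes c\otimes a+(-1)^{|c|(|a|+|b|)}c\otimes a\otimes b.$$ **Super dynamical $r$-matrix with zero weight and zero coupling constant.** A meromorphic function $r:\mathfrak{h}^*\to\operatorname{End}(V)\otimes\operatorname{End}(V)$ such that: - (classical dynamical Yang-Baxter equation) $\operatorname{Alt}_s(dr)+[r^{12},r^{13}]+[r^{12},r^{23}]+[r^{13},r^{23}]=0$, where $dr(\lambda)=\sum_i x_i\otimes\frac{\partial r}{\partial x_i}(\lambda)$ and $r^{ij}$ means that $r$ is placed in the $i$th and $j$th tensor factors; - (generalized unitarity with zero coupling constant) $r(\lambda)+T_s(r)(\lambda)=0$; - (zero weight) $[h\otimes1+1\otimes h,\,r(\lambda)]=0$ for all $h\in\mathfrak{h}$ and $\lambda\in\mathfrak{h}^*$. **Quantum dynamical Yang-Baxter equation with step $\gamma$.** For a function $R$ on $\mathfrak{h}^*$ (or on $U$) with values in $\operatorname{End}(V\otimes V)$, this is $$R^{12}(\lambda-\gamma h^{(3)})R^{13}(\lambda)R^{23}(\lambda-\gamma h^{(1)})=R^{23}(\lambda)R^{13}(\lambda-\gamma h^{(2)})R^{12}(\lambda).$$ Here $R^{ij}$ acts nontrivially on the $i$th and $j$th components of $V^{\otimes3}$, and $h^{(k)}$ is replaced by the weight of the $k$th component. For example, $R^{12}(\lambda-\gamma h^{(3)})(v\otimes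 v'\otimes v'')=(R(\lambda-\gamma\omega)(v\otimes v'))\otimes v''$ if $v''\in V[\omega]$. For a power series in $\gamma$ with coefficients holomorphic on $U$, the shifted arguments are expanded by Taylor's formula in $\gamma$, and the equation is an identity of power series in $\gamma$. **Super dynamical $R$-matrix.** An invertible function $R$ with values in $\operatorname{End}(V\otimes V)$ which satisfies the quantum dynamical Yang-Baxter equation and the zero weight condition $[h\otimes1+1\otimes h,R(\lambda)]=0$ for all $h\in\mathfrak{h}$ and all $\lambda$. *)

theory Defs
  imports "HOL-Complex_Analysis.Complex_Analysis" "HOL-Library.Z2"
begin

no_notation fps_nth (infixl "$" 75)

section \<open>Lie superalgebras and their modules\<close>

text \<open>Parities live in the field \<^typ>\<open>bit\<close> with two elements;
  \<open>koszul q\<close> is the sign $(-1)^q$.\<close>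

definition koszul :: "bit \<Rightarrow> 'a::ring_1" where
  "koszul q = (if q = 1 then - 1 else 1)"

locale super_vector_space = vector_space scale
  for scale :: "complex \<Rightarrow> 'a::ab_group_add \<Rightarrow> 'a" +
  fixes grade :: "bit \<Rightarrow> 'a set"
  assumes subspace_grade: "subspace (grade q)"
    and grade_Int: "grade 0 \<inter> grade 1 = {0}"
    and grade_sum: "\<exists>a\<in>grade 0. \<exists>b\<in>grade 1. x = a + b"

locale lie_superalgebra = super_vector_space scale grade
  for scale :: "complex \<Rightarrow> 'a::ab_group_add \<Rightarrow> 'a" and grade :: "bit \<Rightarrow> 'a set" +
  fixes bracket :: "'a \<Rightarrow> 'a \<Rightarrow> 'a"
  assumes bracket_linear_right: "Vector_Spaces.linear scale scale (bracket x)"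
    and bracket_linear_left: "Vector_Spaces.linear scale scale (\<lambda>x. bracket x y)"
    and bracket_grade: "x \<in> grade q \<Longrightarrow> y \<in> grade s \<Longrightarrow> bracket x y \<in> grade (q + s)"
    and super_skew: "x \<in> grade q \<Longrightarrow> y \<in> grade s \<Longrightarrow>
      bracket x y = - scale (koszul (q * s)) (bracket y x)"
    and super_jacobi: "x \<in> grade q \<Longrightarrow> y \<in> grade s \<Longrightarrow>
      bracket x (bracket y z) =
        bracket (bracket x y) z + scale (koszul (q * s)) (bracket y (bracket x z))"

locale commutative_lie_superalgebra = lie_superalgebra +
  assumes bracket_zero: "bracket x y = 0"

locale lie_supermodule =
  L: lie_superalgebra sL gL br + V: super_vector_space sV gV
  for sL :: "complex \<Rightarrow> 'h::ab_group_add \<Rightarrow> 'h" and gL and br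
    and sV :: "complex \<Rightarrow> 'v::ab_group_add \<Rightarrow> 'v" and gV +
  fixes act :: "'h \<Rightarrow> 'v \<Rightarrow> 'v"
  assumes act_linear: "Vector_Spaces.linear sV sV (act h)"
    and act_linear_left: "Vector_Spaces.linear sL sV (\<lambda>h. act h w)"
    and act_grade: "h \<in> gL q \<Longrightarrow> w \<in> gV s \<Longrightarrow> act h w \<in> gV (q + s)"
    and act_bracket: "x \<in> gL q \<Longrightarrow> y \<in> gL s \<Longrightarrow>
      act (br x y) w = act x (act y w) - sV (koszul (q * s)) (act y (act x w))"
begin

definition graded_submodule :: "'v set \<Rightarrow> bool" where
  "graded_submodule W \<longleftrightarrow> V.subspace W \<and> (\<forall>h. \<forall>w\<in>W. act h w \<in> W) \<and>
     (\<forall>w\<in>W. \<exists>a\<in>W \<inter> gV 0. \<exists>b\<in>W \<inter> gV 1. w = a + b)"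

definition semisimple :: bool where
  "semisimple \<longleftrightarrow> (\<forall>W. graded_submodule W \<longrightarrow>
     (\<exists>W'. graded_submodule W' \<and> W \<inter> W' = {0} \<and> (\<forall>u. \<exists>a\<in>W. \<exists>b\<in>W'. u = a + b)))"

definition weight_space :: "('h \<Rightarrow> complex) \<Rightarrow> 'v set" where
  "weight_space \<omega> = {w. \<forall>h. act h w = sV (\<omega> h) w}"

end

text \<open>The linear functional on the Lie superalgebra with coordinates \<open>z\<close>
  with respect to \<open>\<omega>\<close>; if \<open>x\<close> is dual to \<open>\<omega>\<close>, then \<open>z $ i\<close> is its value at \<open>x i\<close>.\<close>

definition dual_point :: "('n::finite \<Rightarrow> 'h \<Rightarrow> complex) \<Rightarrow> complex^'n \<Rightarrow> 'h \<Rightarrow> complex" where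
  "dual_point \<omega> z = (\<lambda>h. \<Sum>i\<in>UNIV. z $ i * \<omega> i h)"

text \<open>A commutative Lie superalgebra together with a semisimple module whose weights
  \<open>\<omega>\<close> form a basis of the dual; \<open>x\<close> is the dual basis, and \<open>v\<close> is a homogeneous
  eigenbasis of the module with parities \<open>p\<close>. Weights are counted with multiplicity,
  so the module, the algebra and \<^typ>\<open>'n\<close> have the same dimension.\<close>

locale weight_basis_module =
  L: commutative_lie_superalgebra sL gL br + lie_supermodule sL gL br sV gV act
  for sL :: "complex \<Rightarrow> 'h::ab_group_add \<Rightarrow> 'h" and gL and br
    and sV :: "complex \<Rightarrow> 'v::ab_group_add \<Rightarrow> 'v" and gV and act +
  fixes \<omega> :: "'n::finite \<Rightarrow> 'h \<Rightarrow> complex"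
    and x :: "'n \<Rightarrow> 'h"
    and v :: "'n \<Rightarrow> 'v"
    and p :: "'n \<Rightarrow> bit"
  assumes finite_dim_L: "\<exists>B. finite B \<and> L.span B = UNIV"
    and finite_dim_V: "\<exists>B. finite B \<and> V.span B = UNIV"
    and semisimple: semisimple
    and eigenbasis: "inj v" "V.independent (range v)" "V.span (range v) = UNIV"
    and homogeneous: "v i \<in> gV (p i)"
    and weight: "v i \<in> weight_space (\<omega> i)"
    and weights_basis: "bij_betw (dual_point \<omega>) UNIV {f. Vector_Spaces.linear sL (*) f}"
    and dual_basis: "inj x" "L.independent (range x)" "L.span (range x) = UNIV"
      "\<omega> i (x j) = (if i = j then 1 else 0)"

text \<open>The matrix of an endomorphism with respect to the basis \<open>v\<close>.\<close>

definition matrix_wrt ::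
    "(complex \<Rightarrow> 'v::ab_group_add \<Rightarrow> 'v) \<Rightarrow> ('n::finite \<Rightarrow> 'v) \<Rightarrow> ('v \<Rightarrow> 'v) \<Rightarrow> complex^'n^'n" where
  "matrix_wrt sV v f = (\<chi> i j. module.representation sV (range v) (f (v j)) (v i))"


section \<open>Tensor products of endomorphisms with the sign rule\<close>

text \<open>Operators on the tensor square (cube) of the module are written as matrices with respect
  to the basis of tensors $v_i \otimes v_j$ (resp. $v_i \otimes v_j \otimes v_k$). The entries range
  over a commutative ring, so that power series coefficients are covered too. By the sign rule,
  $(a \otimes b)(v_k \otimes v_l) = (-1)^{|b||v_k|}\, a v_k \otimes b v_l$, and the component
  $v_l \mapsto v_j$ of \<open>b\<close> has parity \<open>p j + p l\<close>.\<close>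

definition tensor2 :: "('n \<Rightarrow> bit) \<Rightarrow> 'a::comm_ring_1^'n^'n \<Rightarrow> 'a^'n^'n \<Rightarrow> 'a^('n\<times>'n)^('n\<times>'n)" where
  "tensor2 p a b = (\<chi> s t. case s of (i, j) \<Rightarrow> case t of (k, l) \<Rightarrow>
     koszul ((p j + p l) * p k) * a $ i $ k * b $ j $ l)"

definition tensor3 ::
    "('n \<Rightarrow> bit) \<Rightarrow> 'a::comm_ring_1^'n^'n \<Rightarrow> 'a^'n^'n \<Rightarrow> 'a^'n^'n \<Rightarrow> 'a^('n\<times>'n\<times>'n)^('n\<times>'n\<times>'n)" where
  "tensor3 p a b c = (\<chi> s t. case s of (i, j, k) \<Rightarrow> case t of (l, m, n) \<Rightarrow>
     koszul ((p j + p m) * p l + (p k + p n) * (p l + p m)) * a $ i $ l * b $ j $ m * c $ k $ n)"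

definition matrix_unit :: "'n \<Rightarrow> 'n \<Rightarrow> 'a::comm_ring_1^'n^'n" where
  "matrix_unit i k = (\<chi> a b. if a = i \<and> b = k then 1 else 0)"

definition scale_mat :: "'a::comm_ring_1 \<Rightarrow> 'a^'m^'m \<Rightarrow> 'a^'m^'m" (infixr "*\<^sub>M" 75) where
  "c *\<^sub>M A = map_matrix ((*) c) A"

text \<open>The linear map that sends $E_{ik} \otimes E_{jl}$ to \<open>F i k j l\<close>, resp.
  $E_{il} \otimes E_{jm} \otimes E_{kn}$ to \<open>F i l j m k n\<close>. The sign converts a matrix entry into
  the coefficient of the corresponding tensor of matrix units.\<close>

definition linear_ext2 ::
    "('n::finite \<Rightarrow> bit) \<Rightarrow> ('n \<Rightarrow> 'n \<Rightarrow> 'n \<Rightarrow> 'n \<Rightarrow> 'a::comm_ring_1^'m^'m)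
      \<Rightarrow> 'a^('n\<times>'n)^('n\<times>'n) \<Rightarrow> 'a^'m^'m" where
  "linear_ext2 p F A = (\<Sum>i\<in>UNIV. \<Sum>k\<in>UNIV. \<Sum>j\<in>UNIV. \<Sum>l\<in>UNIV.
     (koszul ((p j + p l) * p k) * A $ (i, j) $ (k, l)) *\<^sub>M F i k j l)"

definition linear_ext3 ::
    "('n::finite \<Rightarrow> bit) \<Rightarrow> ('n \<Rightarrow> 'n \<Rightarrow> 'n \<Rightarrow> 'n \<Rightarrow> 'n \<Rightarrow> 'n \<Rightarrow> 'a::comm_ring_1^'m^'m)
      \<Rightarrow> 'a^('n\<times>'n\<times>'n)^('n\<times>'n\<times>'n) \<Rightarrow> 'a^'m^'m" where
  "linear_ext3 p F A =
     (\<Sum>i\<in>UNIV. \<Sum>l\<in>UNIV. \<Sum>j\<in>UNIV. \<Sum>m\<in>UNIV. \<Sum>k\<in>UNIV. \<Sum>n\<in>UNIV.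
       (koszul ((p j + p m) * p l + (p k + p n) * (p l + p m)) * A $ (i, j, k) $ (l, m, n))
         *\<^sub>M F i l j m k n)"

definition super_twist ::
    "('n::finite \<Rightarrow> bit) \<Rightarrow> 'a::comm_ring_1^('n\<times>'n)^('n\<times>'n) \<Rightarrow> 'a^('n\<times>'n)^('n\<times>'n)" where
  "super_twist p = linear_ext2 p (\<lambda>i k j l.
     koszul ((p i + p k) * (p j + p l)) *\<^sub>M tensor2 p (matrix_unit j l) (matrix_unit i k))"

definition super_alt ::
    "('n::finite \<Rightarrow> bit) \<Rightarrow> 'a::comm_ring_1^('n\<times>'n\<times>'n)^('n\<times>'n\<times>'n) \<Rightarrow> 'a^('n\<times>'n\<times>'n)^('n\<times>'n\<times>'n)" where
  "super_alt p = linear_ext3 p (\<lambda>i l j m k n.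
     let a = matrix_unit i l; b = matrix_unit j m; c = matrix_unit k n;
         pa = p i + p l; pb = p j + p m; pc = p k + p n
     in tensor3 p a b c
        + koszul (pa * (pb + pc)) *\<^sub>M tensor3 p b c a
        + koszul (pc * (pa + pb)) *\<^sub>M tensor3 p c a b)"

definition place12 ::
    "('n::finite \<Rightarrow> bit) \<Rightarrow> 'a::comm_ring_1^('n\<times>'n)^('n\<times>'n) \<Rightarrow> 'a^('n\<times>'n\<times>'n)^('n\<times>'n\<times>'n)" where
  "place12 p = linear_ext2 p (\<lambda>i k j l. tensor3 p (matrix_unit i k) (matrix_unit j l) (mat 1))"

definition place13 ::
    "('n::finite \<Rightarrow> bit) \<Rightarrow> 'a::comm_ring_1^('n\<times>'n)^('n\<times>'n) \<Rightarrow> 'a^('n\<times>'n\<times>'n)^('n\<times>'n\<times>'n)" where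
  "place13 p = linear_ext2 p (\<lambda>i k j l. tensor3 p (matrix_unit i k) (mat 1) (matrix_unit j l))"

definition place23 ::
    "('n::finite \<Rightarrow> bit) \<Rightarrow> 'a::comm_ring_1^('n\<times>'n)^('n\<times>'n) \<Rightarrow> 'a^('n\<times>'n\<times>'n)^('n\<times>'n\<times>'n)" where
  "place23 p = linear_ext2 p (\<lambda>i k j l. tensor3 p (mat 1) (matrix_unit i k) (matrix_unit j l))"

text \<open>The tensor product of \<open>a\<close> (first factor) with an operator on the tensor square
  (second and third factor).\<close>

definition tensor12 ::
    "('n::finite \<Rightarrow> bit) \<Rightarrow> 'a::comm_ring_1^'n^'n \<Rightarrow> 'a^('n\<times>'n)^('n\<times>'n) \<Rightarrow> 'a^('n\<times>'n\<times>'n)^('n\<times>'n\<times>'n)" where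
  "tensor12 p a = linear_ext2 p (\<lambda>i k j l. tensor3 p a (matrix_unit i k) (matrix_unit j l))"

definition commutator :: "'a::comm_ring_1^'m^'m \<Rightarrow> 'a^'m^'m \<Rightarrow> 'a^'m^'m" where
  "commutator A B = A ** B - B ** A"

definition zero_weight ::
    "('n \<Rightarrow> bit) \<Rightarrow> ('h \<Rightarrow> complex^'n^'n) \<Rightarrow> complex^('n::finite\<times>'n)^('n\<times>'n) \<Rightarrow> bool" where
  "zero_weight p H A \<longleftrightarrow>
     (\<forall>h. commutator (tensor2 p (H h) (mat 1) + tensor2 p (mat 1) (H h)) A = 0)"


section \<open>Holomorphic and meromorphic functions of several variables\<close>

definition holomorphic_several :: "(complex^'n \<Rightarrow> complex) \<Rightarrow> (complex^'n::finite) set \<Rightarrow> bool" where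
  "holomorphic_several f U \<longleftrightarrow>
     (\<forall>z\<in>U. \<exists>D. (f has_derivative D) (at z) \<and> (\<forall>c w. D (c *s w) = c * D w))"

text \<open>Locally a quotient of holomorphic functions with denominator not identically zero;
  the values on the zero set of the denominator are irrelevant.\<close>

definition meromorphic_several :: "(complex^'n \<Rightarrow> complex) \<Rightarrow> bool" where
  "meromorphic_several f \<longleftrightarrow>
     (\<forall>a::complex^'n::finite. \<exists>W g d. open W \<and> connected W \<and> a \<in> W \<and>
        holomorphic_several g W \<and> holomorphic_several d W \<and> (\<exists>w\<in>W. d w \<noteq> 0) \<and>
        (\<forall>w\<in>W. d w \<noteq> 0 \<longrightarrow> f w = g w / d w))"

text \<open>The same notions for matrix-valued functions on the dual, in the coordinates given by
  \<open>dual_point \<omega>\<close>.\<close>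

definition dual_holomorphic_on ::
    "('n::finite \<Rightarrow> 'h \<Rightarrow> complex) \<Rightarrow> (('h \<Rightarrow> complex) \<Rightarrow> complex^'m^'m) \<Rightarrow> ('h \<Rightarrow> complex) set \<Rightarrow> bool" where
  "dual_holomorphic_on \<omega> f U \<longleftrightarrow>
     (\<forall>s t. holomorphic_several (\<lambda>z. f (dual_point \<omega> z) $ s $ t) {z. dual_point \<omega> z \<in> U})"

definition dual_meromorphic ::
    "('n::finite \<Rightarrow> 'h \<Rightarrow> complex) \<Rightarrow> (('h \<Rightarrow> complex) \<Rightarrow> complex^'m^'m) \<Rightarrow> bool" where
  "dual_meromorphic \<omega> f \<longleftrightarrow> (\<forall>s t. meromorphic_several (\<lambda>z. f (dual_point \<omega> z) $ s $ t))"

definition regular_points ::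
    "('n::finite \<Rightarrow> 'h \<Rightarrow> complex) \<Rightarrow> (('h \<Rightarrow> complex) \<Rightarrow> complex^'m^'m) \<Rightarrow> ('h \<Rightarrow> complex) set" where
  "regular_points \<omega> f =
     {dual_point \<omega> z | z. \<exists>W. open W \<and> z \<in> W \<and> dual_holomorphic_on \<omega> f (dual_point \<omega> ` W)}"

definition open_polydisc :: "('n::finite \<Rightarrow> 'h \<Rightarrow> complex) \<Rightarrow> ('h \<Rightarrow> complex) set \<Rightarrow> bool" where
  "open_polydisc \<omega> U \<longleftrightarrow>
     (\<exists>c \<rho>. (\<forall>i. \<rho> i > 0) \<and> U = dual_point \<omega> ` {z. \<forall>i. z $ i \<in> ball (c i) (\<rho> i)})"


section \<open>Super dynamical r-matrices\<close>

text \<open>Since \<open>\<omega>\<close> is dual to \<open>x\<close>, the partial derivative with respect to the coordinate \<open>x i\<close> is the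
  derivative in the direction \<open>\<omega> i\<close>.\<close>

definition dual_deriv ::
    "('h \<Rightarrow> complex) \<Rightarrow> (('h \<Rightarrow> complex) \<Rightarrow> complex^'m^'m) \<Rightarrow> ('h \<Rightarrow> complex) \<Rightarrow> complex^'m^'m" where
  "dual_deriv \<mu> f \<xi> = (\<chi> s t. deriv (\<lambda>\<tau>. f (\<lambda>h. \<xi> h + \<tau> * \<mu> h) $ s $ t) 0)"

definition dynamical_differential ::
    "('n::finite \<Rightarrow> bit) \<Rightarrow> ('n \<Rightarrow> 'h \<Rightarrow> complex) \<Rightarrow> ('n \<Rightarrow> 'h) \<Rightarrow> ('h \<Rightarrow> complex^'n^'n) \<Rightarrow>
      (('h \<Rightarrow> complex) \<Rightarrow> complex^('n\<times>'n)^('n\<times>'n)) \<Rightarrow> ('h \<Rightarrow> complex) \<Rightarrow>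
      complex^('n\<times>'n\<times>'n)^('n\<times>'n\<times>'n)" where
  "dynamical_differential p \<omega> x H r \<xi> =
     (\<Sum>i\<in>UNIV. tensor12 p (H (x i)) (dual_deriv (\<omega> i) r \<xi>))"

text \<open>Here \<open>H h\<close> is the matrix of \<open>h\<close>. The zero weight condition forces \<open>r\<close> to be even, so no
  signs occur in the commutators. The identities between meromorphic functions are required
  wherever \<open>r\<close> is holomorphic.\<close>

definition super_dynamical_r_matrix ::
    "('n::finite \<Rightarrow> bit) \<Rightarrow> ('n \<Rightarrow> 'h \<Rightarrow> complex) \<Rightarrow> ('n \<Rightarrow> 'h) \<Rightarrow> ('h \<Rightarrow> complex^'n^'n) \<Rightarrow>
      (('h \<Rightarrow> complex) \<Rightarrow> complex^('n\<times>'n)^('n\<times>'n)) \<Rightarrow> bool" where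
  "super_dynamical_r_matrix p \<omega> x H r \<longleftrightarrow>
     dual_meromorphic \<omega> r \<and>
     (\<forall>\<xi>\<in>regular_points \<omega> r.
        super_alt p (dynamical_differential p \<omega> x H r \<xi>)
          + commutator (place12 p (r \<xi>)) (place13 p (r \<xi>))
          + commutator (place12 p (r \<xi>)) (place23 p (r \<xi>))
          + commutator (place13 p (r \<xi>)) (place23 p (r \<xi>)) = 0 \<and>
        r \<xi> + super_twist p (r \<xi>) = 0 \<and>
        zero_weight p H (r \<xi>))"


section \<open>Super dynamical R-matrices as power series in the step\<close>

text \<open>A power series in the step with coefficients \<open>R n\<close> is evaluated to a matrix over
  \<^typ>\<open>complex fps\<close>. In the shifted version, \<open>R n\<close> at the argument \<open>\<xi>\<close> minus the step times
  \<open>\<mu>\<close> is replaced by its Taylor series in the step.\<close>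

definition step_series ::
    "(nat \<Rightarrow> ('h \<Rightarrow> complex) \<Rightarrow> complex^'m^'m) \<Rightarrow> ('h \<Rightarrow> complex) \<Rightarrow> complex fps^'m^'m" where
  "step_series R \<xi> = (\<chi> s t. Abs_fps (\<lambda>n. R n \<xi> $ s $ t))"

definition shifted_step_series ::
    "(nat \<Rightarrow> ('h \<Rightarrow> complex) \<Rightarrow> complex^'m^'m) \<Rightarrow> ('h \<Rightarrow> complex) \<Rightarrow> ('h \<Rightarrow> complex) \<Rightarrow>
      complex fps^'m^'m" where
  "shifted_step_series R \<xi> \<mu> = (\<chi> s t. Abs_fps (\<lambda>k. \<Sum>n\<le>k.
     fps_nth (fps_expansion (\<lambda>\<tau>. R n (\<lambda>h. \<xi> h - \<tau> * \<mu> h) $ s $ t) 0) (k - n)))"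

text \<open>The weights are distinct, so \<open>matrix_unit c c\<close> is the projection onto the weight space
  of \<open>\<omega> c\<close>, and a shift by the weight of the $k$th component is written as a sum over these
  projections in the $k$th component.\<close>

definition QDYBE ::
    "('n::finite \<Rightarrow> bit) \<Rightarrow> ('n \<Rightarrow> 'h \<Rightarrow> complex) \<Rightarrow>
      (nat \<Rightarrow> ('h \<Rightarrow> complex) \<Rightarrow> complex^('n\<times>'n)^('n\<times>'n)) \<Rightarrow> ('h \<Rightarrow> complex) \<Rightarrow> bool" where
  "QDYBE p \<omega> R \<xi> \<longleftrightarrow>
     (let proj = (\<lambda>c. matrix_unit c c);
          R12_shift3 = (\<Sum>c\<in>UNIV. place12 p (shifted_step_series R \<xi> (\<omega> c)) **
                                    tensor3 p (mat 1) (mat 1) (proj c));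
          R23_shift1 = (\<Sum>c\<in>UNIV. place23 p (shifted_step_series R \<xi> (\<omega> c)) **
                                    tensor3 p (proj c) (mat 1) (mat 1));
          R13_shift2 = (\<Sum>c\<in>UNIV. place13 p (shifted_step_series R \<xi> (\<omega> c)) **
                                    tensor3 p (mat 1) (proj c) (mat 1))
      in R12_shift3 ** place13 p (step_series R \<xi>) ** R23_shift1 =
         place23 p (step_series R \<xi>) ** R13_shift2 ** place12 p (step_series R \<xi>))"

definition super_dynamical_R_matrix_on ::
    "('n::finite \<Rightarrow> bit) \<Rightarrow> ('n \<Rightarrow> 'h \<Rightarrow> complex) \<Rightarrow> ('h \<Rightarrow> complex^'n^'n) \<Rightarrow>
      ('h \<Rightarrow> complex) set \<Rightarrow>
      (nat \<Rightarrow> ('h \<Rightarrow> complex) \<Rightarrow> complex^('n\<times>'n)^('n\<times>'n)) \<Rightarrow> bool" where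
  "super_dynamical_R_matrix_on p \<omega> H U R \<longleftrightarrow>
     (\<forall>n. dual_holomorphic_on \<omega> (R n) U) \<and>
     (\<forall>\<xi>\<in>U. invertible (step_series R \<xi>) \<and> QDYBE p \<omega> R \<xi> \<and> (\<forall>n. zero_weight p H (R n \<xi>)))"


section \<open>Consistency of the encodings\<close>

definition homogeneous_mat :: "('n \<Rightarrow> bit) \<Rightarrow> 'a::comm_ring_1^'n^'n \<Rightarrow> bit \<Rightarrow> bool" where
  "homogeneous_mat p a q \<longleftrightarrow> (\<forall>i k. a $ i $ k \<noteq> 0 \<longrightarrow> p i + p k = q)"

lemma linear_ext2_tensor:
  fixes F :: "'n::finite \<Rightarrow> 'n \<Rightarrow> 'n \<Rightarrow> 'n \<Rightarrow> 'a::comm_ring_1^'m^'m"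
  shows "linear_ext2 p F (tensor2 p a b) =
    (\<Sum>i\<in>UNIV. \<Sum>k\<in>UNIV. \<Sum>j\<in>UNIV. \<Sum>l\<in>UNIV. (a $ i $ k * b $ j $ l) *\<^sub>M F i k j l)"
proof -
  have "koszul q * (koszul q * c * d) = c * d" for q and c d :: 'a
    by (simp add: koszul_def)
  then show ?thesis
    by (simp add: linear_ext2_def tensor2_def)
qed

lemma linear_ext3_tensor:
  fixes F :: "'n::finite \<Rightarrow> 'n \<Rightarrow> 'n \<Rightarrow> 'n \<Rightarrow> 'n \<Rightarrow> 'n \<Rightarrow> 'a::comm_ring_1^'m^'m"
  shows "linear_ext3 p F (tensor3 p a b c) =
    (\<Sum>i\<in>UNIV. \<Sum>l\<in>UNIV. \<Sum>j\<in>UNIV. \<Sum>m\<in>UNIV. \<Sum>k\<in>UNIV. \<Sum>n\<in>UNIV.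
      (a $ i $ l * b $ j $ m * c $ k $ n) *\<^sub>M F i l j m k n)"
proof -
  have "koszul q * (koszul q * c * d * e) = c * d * e" for q and c d e :: 'a
    by (simp add: koszul_def)
  then show ?thesis
    by (simp add: linear_ext3_def tensor3_def)
qed

lemma sum_matrix_unit:
  fixes G :: "'n::finite \<Rightarrow> 'n \<Rightarrow> 'a::comm_ring_1"
  shows "(\<Sum>i\<in>UNIV. \<Sum>k\<in>UNIV. G i k * matrix_unit i k $ a $ b) = G a b"
proof -
  have "(\<Sum>k\<in>UNIV. G i k * matrix_unit i k $ a $ b) = (if i = a then G a b else 0)" for i
    by (cases "i = a") (simp_all add: matrix_unit_def if_distrib[of "(*) _"] cong: if_cong)
  then show ?thesis
    by simp
qed

lemma sum_matrix_units:
  fixes a b :: "'a::comm_ring_1^'n::finite^'n"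
  shows "(\<Sum>i\<in>UNIV. \<Sum>k\<in>UNIV. \<Sum>j\<in>UNIV. \<Sum>l\<in>UNIV.
      (a $ i $ k * b $ j $ l) * (e * matrix_unit i k $ y $ z * matrix_unit j l $ u $ w)) =
    a $ y $ z * b $ u $ w * e"
proof -
  have "(\<Sum>i\<in>UNIV. \<Sum>k\<in>UNIV. \<Sum>j\<in>UNIV. \<Sum>l\<in>UNIV.
      (a $ i $ k * b $ j $ l) * (e * matrix_unit i k $ y $ z * matrix_unit j l $ u $ w)) =
    (\<Sum>i\<in>UNIV. \<Sum>k\<in>UNIV. (\<Sum>j\<in>UNIV. \<Sum>l\<in>UNIV.
      (a $ i $ k * b $ j $ l * e) * matrix_unit j l $ u $ w) * matrix_unit i k $ y $ z)"
    by (simp add: sum_distrib_left sum_distrib_right mult_ac)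
  then show ?thesis
    by (simp add: sum_matrix_unit)
qed

lemma tensor3_entry:
  obtains K :: "'a::comm_ring_1" where
    "\<And>a b c. tensor3 p a b c $ (i, j, k) $ (l, m, n) = K * (a $ i $ l * b $ j $ m * c $ k $ n)"
  by (rule that[of "koszul ((p j + p m) * p l + (p k + p n) * (p l + p m))"])
     (simp only: tensor3_def vec_lambda_beta prod.case mult.assoc)

lemma tensor2_entry:
  obtains K :: "'a::comm_ring_1" where
    "\<And>a b. tensor2 p a b $ (i, j) $ (k, l) = K * (a $ i $ k * b $ j $ l)"
  by (rule that[of "koszul ((p j + p l) * p k)"])
     (simp only: tensor2_def vec_lambda_beta prod.case mult.assoc)

lemma super_twist_tensor:
  fixes a b :: "'a::comm_ring_1^'n::finite^'n"
  assumes "homogeneous_mat p a q" "homogeneous_mat p b s"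
  shows "super_twist p (tensor2 p a b) = koszul (q * s) *\<^sub>M tensor2 p b a"
proof -
  define S :: "'n \<Rightarrow> 'n \<Rightarrow> 'n \<Rightarrow> 'n \<Rightarrow> 'a"
    where "S i k j l = koszul ((p i + p k) * (p j + p l))" for i k j l
  define S' :: 'a where "S' = koszul (q * s)"
  have 1: "a $ i $ k * b $ j $ l * (S i k j l * e) = a $ i $ k * b $ j $ l * (S' * e)" for i j k l e
  proof (cases "a $ i $ k = 0 \<or> b $ j $ l = 0")
    case False
    with assms have "p i + p k = q" "p j + p l = s"
      unfolding homogeneous_mat_def by blast+
    then show ?thesis
      by (simp only: S_def S'_def)
  qed auto
  have 2: "super_twist p (tensor2 p a b) =
      (\<Sum>i\<in>UNIV. \<Sum>k\<in>UNIV. \<Sum>j\<in>UNIV. \<Sum>l\<in>UNIV. (a $ i $ k * b $ j $ l) *\<^sub>M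
        (S i k j l *\<^sub>M tensor2 p (matrix_unit j l) (matrix_unit i k)))"
    by (simp only: super_twist_def linear_ext2_tensor S_def)
  have "super_twist p (tensor2 p a b) $ (j', i') $ (l', k') =
      (S' *\<^sub>M tensor2 p b a) $ (j', i') $ (l', k')" for i' j' k' l'
  proof -
    obtain K :: 'a where K: "\<And>a b. tensor2 p a b $ (j', i') $ (l', k') =
        K * (a $ j' $ l' * b $ i' $ k')"
      using tensor2_entry[of p j' i' l' k'] by blast
    have "super_twist p (tensor2 p a b) $ (j', i') $ (l', k') =
      (\<Sum>i\<in>UNIV. \<Sum>k\<in>UNIV. \<Sum>j\<in>UNIV. \<Sum>l\<in>UNIV. (a $ i $ k * b $ j $ l) *
        (S' * K * matrix_unit i k $ i' $ k' * matrix_unit j l $ j' $ l'))"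
      by (simp add: 2 scale_mat_def K 1) (simp add: mult_ac)
    then show ?thesis
      unfolding sum_matrix_units by (simp add: scale_mat_def K mult_ac)
  qed
  then show ?thesis
    by (simp add: vec_eq_iff split_paired_All S'_def)
qed

lemma place12_tensor:
  fixes a b :: "'a::comm_ring_1^'n::finite^'n"
  shows "place12 p (tensor2 p a b) = tensor3 p a b (mat 1)"
proof -
  have "(place12 p (tensor2 p a b)) $ (i', j', k') $ (l', m', n') =
      tensor3 p a b (mat 1) $ (i', j', k') $ (l', m', n')" for i' j' k' l' m' n'
  proof -
    obtain K :: 'a where K: "\<And>a b c. tensor3 p a b c $ (i', j', k') $ (l', m', n') =
        K * (a $ i' $ l' * b $ j' $ m' * c $ k' $ n')"
      using tensor3_entry[of p i' j' k' l' m' n'] by blast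
    have "(place12 p (tensor2 p a b)) $ (i', j', k') $ (l', m', n') =
      (\<Sum>i\<in>UNIV. \<Sum>k\<in>UNIV. \<Sum>j\<in>UNIV. \<Sum>l\<in>UNIV. (a $ i $ k * b $ j $ l) *
        ((K * mat 1 $ k' $ n') * matrix_unit i k $ i' $ l' * matrix_unit j l $ j' $ m'))"
      by (simp add: place12_def linear_ext2_tensor scale_mat_def K mult_ac)
    then show ?thesis
      unfolding sum_matrix_units by (simp add: K mult_ac)
  qed
  then show ?thesis
    by (simp add: vec_eq_iff split_paired_All)
qed

lemma place13_tensor:
  fixes a b :: "'a::comm_ring_1^'n::finite^'n"
  shows "place13 p (tensor2 p a b) = tensor3 p a (mat 1) b"
proof -
  have "(place13 p (tensor2 p a b)) $ (i', j', k') $ (l', m', n') =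
      tensor3 p a (mat 1) b $ (i', j', k') $ (l', m', n')" for i' j' k' l' m' n'
  proof -
    obtain K :: 'a where K: "\<And>a b c. tensor3 p a b c $ (i', j', k') $ (l', m', n') =
        K * (a $ i' $ l' * b $ j' $ m' * c $ k' $ n')"
      using tensor3_entry[of p i' j' k' l' m' n'] by blast
    have "(place13 p (tensor2 p a b)) $ (i', j', k') $ (l', m', n') =
      (\<Sum>i\<in>UNIV. \<Sum>k\<in>UNIV. \<Sum>j\<in>UNIV. \<Sum>l\<in>UNIV. (a $ i $ k * b $ j $ l) *
        ((K * mat 1 $ j' $ m') * matrix_unit i k $ i' $ l' * matrix_unit j l $ k' $ n'))"
      by (simp add: place13_def linear_ext2_tensor scale_mat_def K mult_ac)
    then show ?thesis
      unfolding sum_matrix_units by (simp add: K mult_ac)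
  qed
  then show ?thesis
    by (simp add: vec_eq_iff split_paired_All)
qed

lemma tensor12_tensor:
  fixes a b c :: "'a::comm_ring_1^'n::finite^'n"
  shows "tensor12 p a (tensor2 p b c) = tensor3 p a b c"
proof -
  have "(tensor12 p a (tensor2 p b c)) $ (i', j', k') $ (l', m', n') =
      tensor3 p a b c $ (i', j', k') $ (l', m', n')" for i' j' k' l' m' n'
  proof -
    obtain K :: 'a where K: "\<And>a b c. tensor3 p a b c $ (i', j', k') $ (l', m', n') =
        K * (a $ i' $ l' * b $ j' $ m' * c $ k' $ n')"
      using tensor3_entry[of p i' j' k' l' m' n'] by blast
    have "(tensor12 p a (tensor2 p b c)) $ (i', j', k') $ (l', m', n') =
      (\<Sum>i\<in>UNIV. \<Sum>k\<in>UNIV. \<Sum>j\<in>UNIV. \<Sum>l\<in>UNIV. (b $ i $ k * c $ j $ l) *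
        ((K * a $ i' $ l') * matrix_unit i k $ j' $ m' * matrix_unit j l $ k' $ n'))"
      by (simp add: tensor12_def linear_ext2_tensor scale_mat_def K mult_ac)
    then show ?thesis
      unfolding sum_matrix_units by (simp add: K mult_ac)
  qed
  then show ?thesis
    by (simp add: vec_eq_iff split_paired_All)
qed

lemma place23_tensor: "place23 p (tensor2 p a b) = tensor3 p (mat 1) a b"
  using tensor12_tensor[of p "mat 1" a b] by (simp add: place23_def tensor12_def)

lemma super_alt_matrix_units:
  fixes i l j m k n :: "'n::finite" and p :: "'n \<Rightarrow> bit"
  defines "a \<equiv> matrix_unit i l :: 'a::comm_ring_1^'n^'n"
    and "b \<equiv> matrix_unit j m :: 'a^'n^'n" and "c \<equiv> matrix_unit k n :: 'a^'n^'n"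
    and "pa \<equiv> p i + p l" and "pb \<equiv> p j + p m" and "pc \<equiv> p k + p n"
  shows "super_alt p (tensor3 p a b c) =
    tensor3 p a b c + koszul (pa * (pb + pc)) *\<^sub>M tensor3 p b c a
      + koszul (pc * (pa + pb)) *\<^sub>M tensor3 p c a b"
proof -
  have pull: "(\<Sum>y\<in>UNIV. \<Sum>z\<in>UNIV. (e * matrix_unit u w $ y $ z) *\<^sub>M G y z) = e *\<^sub>M G u w"
    for u w :: 'n and e :: 'a and G :: "'n \<Rightarrow> 'n \<Rightarrow> 'a^('n\<times>'n\<times>'n)^('n\<times>'n\<times>'n)"
  proof -
    have "(\<Sum>z\<in>UNIV. (e * matrix_unit u w $ y $ z) *\<^sub>M G y z) = (if y = u then e *\<^sub>M G u w else 0)" for y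
    proof -
      have "(\<Sum>z\<in>UNIV. (e * matrix_unit u w $ y $ z) *\<^sub>M G y z) =
          (\<Sum>z\<in>UNIV. if z = w then (if y = u then e *\<^sub>M G u w else 0) else 0)"
        by (intro sum.cong) (auto simp: matrix_unit_def scale_mat_def vec_eq_iff)
      then show ?thesis by simp
    qed
    then show ?thesis by simp
  qed
  have one: "1 *\<^sub>M A = A" for A :: "'a^('n\<times>'n\<times>'n)^('n\<times>'n\<times>'n)"
    by (simp add: scale_mat_def vec_eq_iff)
  have swap: "(\<Sum>y\<in>UNIV. \<Sum>z\<in>UNIV. \<Sum>y'\<in>UNIV. \<Sum>z'\<in>UNIV. (d y z * e y' z') *\<^sub>M G y z y' z') =
     (\<Sum>y\<in>UNIV. \<Sum>z\<in>UNIV. d y z *\<^sub>M (\<Sum>y'\<in>UNIV. \<Sum>z'\<in>UNIV. e y' z' *\<^sub>M G y z y' z'))"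
    for d e :: "'n \<Rightarrow> 'n \<Rightarrow> 'a" and G :: "'n \<Rightarrow> 'n \<Rightarrow> 'n \<Rightarrow> 'n \<Rightarrow> 'a^('n\<times>'n\<times>'n)^('n\<times>'n\<times>'n)"
    by (simp add: scale_mat_def vec_eq_iff sum_distrib_left mult_ac)
  have pull1: "(\<Sum>y\<in>UNIV. \<Sum>z\<in>UNIV. matrix_unit u w $ y $ z *\<^sub>M G y z) = G u w"
    for u w :: 'n and G :: "'n \<Rightarrow> 'n \<Rightarrow> 'a^('n\<times>'n\<times>'n)^('n\<times>'n\<times>'n)"
    using pull[of 1 u w G] by (simp add: one)
  show ?thesis
    unfolding super_alt_def linear_ext3_tensor a_def b_def c_def pull
    by (simp only: swap pull1 Let_def pa_def pb_def pc_def)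
qed

end

theory Submission
  imports Defs
begin

text \<open>An operator of weight zero on the tensor square has only diagonal entries, and entries that
  exchange the two indices of a basis tensor, because the weights are linearly independent. An
  r-matrix is therefore given by functions $\alpha_{ij}$ and $b_{ij}$ with $i \neq j$, both
  antisymmetric by unitarity. Put $d_{ij} = (-1)^{|i||j|} b_{ij}$, where $|i|$ is the parity of
  $v_i$. The entries of the classical equation (locale \<open>classical_swap_form\<close>) say that

    \<^item> $d_{ij}$ depends on the coordinates $\lambda_i$ and $\lambda_j$ only, with the Riccati
      equation $\partial_i d_{ij} = - (-1)^{|i|} d_{ij}^2$;

    \<^item> $d_{ij} d_{jk} = d_{ik} (d_{ij} + d_{jk})$ for distinct indices;

    \<^item> the 2-form with coefficients $\alpha_{ij}$ is closed.

  Nothing more is needed to write down a quantization in closed form. Its exchange entries are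
  $- \gamma b_{ij}$, and its diagonal entries are $(1 - \gamma d_{ij})\, \varphi_{ij}$ for
  $i \neq j$ and 1 for $i = j$. By the Riccati equation the shift of $d_{ij}$ by $\gamma \omega_i$
  is a geometric series, and the quantum equation reduces, entry by entry, to polynomial
  identities in the $d_{ij}$ and to three laws for $\varphi$: it is 1 for equal indices,
  $\varphi_{ij} \varphi_{ji} = 1$, and it is a multiplicative 2-cocycle for the shifts (locale
  \<open>dynamical_braid\<close>). The exact multiplicative forms

    $\varphi_{ij}(\lambda) = g_i(\lambda)\, g_j(\lambda - \gamma \omega_i) / (g_j(\lambda)\, g_i(\lambda - \gamma \omega_j))$

  satisfy these laws for all invertible functions $g_i$. The first order term of the diagonal
  entry has to be $- \alpha_{ij}$. With $g_i = e^{\eta_i}$ this means that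
  $\partial_i \eta_j - \partial_j \eta_i = \alpha_{ij} - d_{ij}$. The right-hand side is a closed
  form, and a polydisc is star-shaped, so the lemma of Poincare (\<open>Poincare_two_form\<close>) provides
  such an \<open>\<eta>\<close>.

  All series in \<open>\<gamma>\<close> are handled formally: the shift by a weight is a multiplicative operator
  \<open>shift\<close> on power series with holomorphic coefficients, and two shifts commute because partial
  derivatives do. This requires that partial derivatives of a function of several complex
  variables are again holomorphic and commute, which follows from the Cauchy integral formula
  (\<open>holomorphic_several_partial\<close>, \<open>partial_commute\<close>).\<close>

section \<open>Partial derivatives of holomorphic functions of several variables\<close>

definition partial :: "'n::finite \<Rightarrow> (complex^'n \<Rightarrow> complex) \<Rightarrow> complex^'n \<Rightarrow> complex" where
  "partial a f z = deriv (\<lambda>\<tau>. f (z + \<tau> *s axis a 1)) 0"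

definition cderiv :: "(complex^'n::finite \<Rightarrow> complex) \<Rightarrow> complex^'n \<Rightarrow> complex^'n \<Rightarrow> complex" where
  "cderiv f z = frechet_derivative f (at z)"

lemma norm_vector_smult: "norm (c *s (w::complex^'n::finite)) = norm c * norm w"
  by (simp add: norm_vec_def norm_mult L2_set_right_distrib)

lemma bounded_linear_vector_smult: "bounded_linear (\<lambda>\<tau>::complex. \<tau> *s (w::complex^'n::finite))"
  by (rule bounded_linear_intro[of _ "norm w"])
     (simp_all add: vec.scale_left_distrib norm_vector_smult vec_eq_iff)

lemma norm_axis_one: "norm (axis a 1 :: complex^'n::finite) = 1"
proof -
  have "norm (axis a 1 :: complex^'n) = L2_set (\<lambda>i. if i = a then 1 else 0) UNIV"
    unfolding norm_vec_def axis_def by (intro arg_cong2[of _ _ _ _ L2_set]) auto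
  then show ?thesis
    by (simp add: L2_set_def if_distrib[of "\<lambda>x. x ^ 2"] cong: if_cong)
qed

lemma holomorphic_several_cderiv:
  assumes "holomorphic_several f U" "z \<in> U"
  shows "(f has_derivative cderiv f z) (at z)" "cderiv f z (c *s w) = c * cderiv f z w"
proof -
  obtain D where D: "(f has_derivative D) (at z)" "\<And>c w. D (c *s w) = c * D w"
    using assms unfolding holomorphic_several_def by blast
  then have "D = cderiv f z"
    unfolding cderiv_def by (rule_tac frechet_derivative_at)
  with D show "(f has_derivative cderiv f z) (at z)" "cderiv f z (c *s w) = c * cderiv f z w"
    by auto
qed

lemma holomorphic_several_subset:
  "holomorphic_several f U \<Longrightarrow> V \<subseteq> U \<Longrightarrow> holomorphic_several f V"
  unfolding holomorphic_several_def by blast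

lemma holomorphic_several_continuous_on:
  "holomorphic_several f U \<Longrightarrow> continuous_on U f"
  by (meson continuous_at_imp_continuous_on has_derivative_continuous holomorphic_several_cderiv(1))

lemma holomorphic_several_local_cong:
  assumes "holomorphic_several f U" "open U" "\<And>z. z \<in> U \<Longrightarrow> f z = g z"
  shows "holomorphic_several g U"
  using assms unfolding holomorphic_several_def
  by (meson has_derivative_transform_within_open)

lemma holomorphic_several_line_derivative:
  assumes f: "holomorphic_several f U" and z: "z + s *s w \<in> U"
  shows "((\<lambda>\<tau>. f (z + \<tau> *s w)) has_field_derivative cderiv f (z + s *s w) w) (at s)"
proof -
  have "((\<lambda>\<tau>. z + \<tau> *s w) has_derivative (\<lambda>\<tau>. \<tau> *s w)) (at s)"
    using bounded_linear_imp_has_derivative[OF bounded_linear_vector_smult, of w "at s"]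
    by (auto intro!: derivative_eq_intros)
  from has_derivative_compose[OF this holomorphic_several_cderiv(1)[OF f z]]
  show ?thesis
    by (simp add: has_field_derivative_def holomorphic_several_cderiv(2)[OF f z] mult_commute_abs)
qed

lemma holomorphic_several_line:
  assumes f: "holomorphic_several f U" and S: "\<And>s. s \<in> S \<Longrightarrow> z + s *s w \<in> U"
  shows "(\<lambda>\<tau>. f (z + \<tau> *s w)) holomorphic_on S"
  using holomorphic_several_line_derivative[OF f S]
  by (auto simp: holomorphic_on_def field_differentiable_def intro: field_differentiable_at_within
      DERIV_subset)

lemma partial_eq_cderiv:
  assumes "holomorphic_several f U" "z \<in> U"
  shows "partial a f z = cderiv f z (axis a 1)"
  using holomorphic_several_line_derivative[OF assms(1), of z 0 "axis a 1"] assms(2)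
  by (simp add: partial_def DERIV_imp_deriv)

lemma partial_field_derivative:
  assumes "holomorphic_several f U" "z + s *s axis a 1 \<in> U"
  shows "((\<lambda>\<tau>. f (z + \<tau> *s axis a 1)) has_field_derivative partial a f (z + s *s axis a 1)) (at s)"
  using holomorphic_several_line_derivative[OF assms] partial_eq_cderiv[OF assms] by simp

lemma partial_cong:
  assumes "open U" "z \<in> U" "\<And>y. y \<in> U \<Longrightarrow> f y = g y"
  shows "partial a f z = partial a g z"
proof -
  have "isCont (\<lambda>\<tau>::complex. z + \<tau> *s axis a 1) 0"
    by (intro continuous_intros linear_continuous_at bounded_linear_vector_smult)
  then have "eventually (\<lambda>\<tau>. z + \<tau> *s axis a 1 \<in> U) (nhds (0::complex))"
    using assms(1,2) unfolding continuous_at_open eventually_nhds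
    by (metis add.right_neutral vector_smult_lzero)
  then have "eventually (\<lambda>\<tau>. f (z + \<tau> *s axis a 1) = g (z + \<tau> *s axis a 1)) (nhds (0::complex))"
    by eventually_elim (simp add: assms(3))
  then show ?thesis
    unfolding partial_def by (rule deriv_cong_ev) simp
qed

lemma vector_expansion: "(w::complex^'n::finite) = (\<Sum>a\<in>UNIV. (w $ a) *s axis a 1)"
  by (simp add: vec_eq_iff axis_def if_distrib[of "(*) _"] cong: if_cong)

lemma cderiv_partials:
  assumes f: "holomorphic_several f U" "z \<in> U"
  shows "cderiv f z w = (\<Sum>a\<in>UNIV. w $ a * partial a f z)"
proof -
  have lin: "linear (cderiv f z)"
    using holomorphic_several_cderiv(1)[OF f] has_derivative_linear by blast
  have "cderiv f z w = cderiv f z (\<Sum>a\<in>UNIV. (w $ a) *s axis a 1)"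
    using vector_expansion[of w] by simp
  also have "\<dots> = (\<Sum>a\<in>UNIV. cderiv f z ((w $ a) *s axis a 1))"
    by (simp add: linear_sum[OF lin])
  finally show ?thesis
    by (simp add: holomorphic_several_cderiv(2)[OF f] partial_eq_cderiv[OF f])
qed

lemma holomorphic_several_const [intro]: "holomorphic_several (\<lambda>_. c) U"
  unfolding holomorphic_several_def by (intro ballI exI[of _ "\<lambda>_. 0"]) auto

lemma holomorphic_several_coordinate [intro]: "holomorphic_several (\<lambda>z. z $ a) U"
  unfolding holomorphic_several_def
  by (intro ballI exI[of _ "\<lambda>z. z $ a"] conjI bounded_linear_imp_has_derivative
      bounded_linear_vec_nth) auto

lemma holomorphic_several_add [intro]:
  assumes "holomorphic_several f U" "holomorphic_several g U"
  shows "holomorphic_several (\<lambda>z. f z + g z) U"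
  unfolding holomorphic_several_def
proof (intro ballI exI conjI allI)
  fix z assume z: "z \<in> U"
  show "((\<lambda>z. f z + g z) has_derivative (\<lambda>w. cderiv f z w + cderiv g z w)) (at z)"
    by (intro derivative_intros holomorphic_several_cderiv[OF _ z] assms)
  show "cderiv f z (c *s w) + cderiv g z (c *s w) = c * (cderiv f z w + cderiv g z w)" for c w
    by (simp add: holomorphic_several_cderiv[OF _ z] assms algebra_simps)
qed

lemma holomorphic_several_mult [intro]:
  assumes "holomorphic_several f U" "holomorphic_several g U"
  shows "holomorphic_several (\<lambda>z. f z * g z) U"
  unfolding holomorphic_several_def
proof (intro ballI exI conjI allI)
  fix z assume z: "z \<in> U"
  show "((\<lambda>z. f z * g z) has_derivative (\<lambda>w. f z * cderiv g z w + cderiv f z w * g z)) (at z)"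
    by (intro derivative_intros holomorphic_several_cderiv[OF _ z] assms)
  show "f z * cderiv g z (c *s w) + cderiv f z (c *s w) * g z
      = c * (f z * cderiv g z w + cderiv f z w * g z)" for c w
    by (simp add: holomorphic_several_cderiv[OF _ z] assms algebra_simps)
qed

lemma holomorphic_several_uminus [intro]:
  "holomorphic_several f U \<Longrightarrow> holomorphic_several (\<lambda>z. - f z) U"
  using holomorphic_several_mult[OF holomorphic_several_const[of "-1"], of f U] by simp

lemma holomorphic_several_diff [intro]:
  "holomorphic_several f U \<Longrightarrow> holomorphic_several g U \<Longrightarrow> holomorphic_several (\<lambda>z. f z - g z) U"
  using holomorphic_several_add[of f U "\<lambda>z. - g z"] by auto

lemma holomorphic_several_sum [intro]:
  "(\<And>a. a \<in> S \<Longrightarrow> holomorphic_several (f a) U) \<Longrightarrow> holomorphic_several (\<lambda>z. \<Sum>a\<in>S. f a z) U"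
  by (induction S rule: infinite_finite_induct) auto

lemma holomorphic_several_compose:
  assumes f: "holomorphic_several f U" and h: "\<And>s. (h has_field_derivative h' s) (at s)"
  shows "holomorphic_several (\<lambda>z. h (f z)) U"
  unfolding holomorphic_several_def
proof (intro ballI exI conjI allI)
  fix z assume z: "z \<in> U"
  show "((\<lambda>z. h (f z)) has_derivative (\<lambda>w. h' (f z) * cderiv f z w)) (at z)"
    using has_derivative_compose[OF holomorphic_several_cderiv(1)[OF f z]] h[of "f z"]
    unfolding has_field_derivative_def by blast
  show "h' (f z) * cderiv f z (c *s w) = c * (h' (f z) * cderiv f z w)" for c w
    by (simp add: holomorphic_several_cderiv[OF f z])
qed

lemma holomorphic_several_exp: "holomorphic_several f U \<Longrightarrow> holomorphic_several (\<lambda>z. exp (f z)) U"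
  by (rule holomorphic_several_compose[where h=exp and h'=exp]) (auto intro: DERIV_exp)

text \<open>Cauchy's estimate on circles of radius $1/2$ bounds the second derivative on the closed unit
  disc by $8 M$.\<close>

lemma first_order_Taylor_bound:
  assumes hol: "h holomorphic_on ball 0 2" and bnd: "\<And>u. u \<in> ball 0 2 \<Longrightarrow> norm (h u) \<le> M"
    and s: "norm s \<le> 1"
  shows "norm (h s - h 0 - deriv h 0 * s) \<le> 8 * M * norm s ^ 2"
proof -
  define F where "F = (\<lambda>i. (deriv ^^ i) h)"
  have cb: "cball (0::complex) 1 \<subseteq> ball 0 2" by auto
  have "norm (F 0 s - (\<Sum>i\<le>1. F i 0 * (s - 0) ^ i / fact i))
      \<le> (8 * M) * norm (s - 0) ^ Suc 1 / fact 1"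
  proof (rule complex_Taylor[where S="cball 0 1"])
    fix i :: nat and u :: complex assume u: "u \<in> cball 0 1"
    have "F i holomorphic_on ball 0 2"
      unfolding F_def by (intro holomorphic_higher_deriv hol) auto
    then show "(F i has_field_derivative F (Suc i) u) (at u within cball 0 1)"
      using u cb unfolding F_def
      by (auto intro!: holomorphic_derivI[of _ "ball 0 2"])
  next
    fix u :: complex assume u: "u \<in> cball 0 1"
    have sub: "cball u (1/2) \<subseteq> ball 0 2"
    proof
      fix y assume "y \<in> cball u (1/2)"
      then show "y \<in> ball 0 2"
        using u norm_triangle_ineq[of u "y - u"] by (simp add: dist_norm norm_minus_commute)
    qed
    have "norm ((deriv ^^ 2) h u) \<le> fact 2 * M / (1/2) ^ 2"
    proof (rule Cauchy_inequality)
      show "h holomorphic_on ball u (1/2)"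
        using hol sub by (meson ball_subset_cball holomorphic_on_subset)
      show "continuous_on (cball u (1/2)) h"
        using hol sub by (meson holomorphic_on_imp_continuous_on holomorphic_on_subset)
      show "norm (h y) \<le> M" if "norm (u - y) = 1/2" for y
      proof -
        have "y \<in> cball u (1/2)" using that by (simp add: dist_norm)
        with bnd sub show ?thesis by blast
      qed
    qed simp
    then show "norm (F (Suc 1) u) \<le> 8 * M"
      by (simp add: F_def eval_nat_numeral)
  qed (use s in auto)
  then show ?thesis
    by (simp add: F_def power2_eq_square algebra_simps)
qed

text \<open>Restriction to the complex line spanned by \<open>w\<close> reduces the remainder to one variable. What
  matters is that the bound depends on the function only through its supremum, so that it is
  uniform over families of functions.\<close>

lemma cderiv_remainder_bound:
  assumes f: "holomorphic_several f (ball z (2 * \<rho>))" and \<rho>: "\<rho> > 0"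
    and bnd: "\<And>y. y \<in> ball z (2 * \<rho>) \<Longrightarrow> norm (f y) \<le> M"
    and w: "norm w \<le> \<rho>"
  shows "norm (f (z + w) - f z - cderiv f z w) \<le> 8 * M * (norm w / \<rho>) ^ 2"
proof (cases "w = 0")
  case True
  have "linear (cderiv f z)"
    using holomorphic_several_cderiv(1)[OF f, of z] \<rho> by (auto dest: has_derivative_linear)
  then have "cderiv f z 0 = 0" by (rule linear_0)
  with True show ?thesis by simp
next
  case False
  define s :: complex where "s = of_real (norm w / \<rho>)"
  define u where "u = inverse s *s w"
  have s: "s \<noteq> 0" "norm s = norm w / \<rho>" "norm s \<le> 1"
    using False \<rho> w by (simp_all add: s_def norm_divide)
  have su: "s *s u = w"
    using s by (simp add: u_def vec_eq_iff)
  have nu: "norm u = \<rho>"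
    using False \<rho> by (simp add: u_def norm_vector_smult norm_inverse s)
  define h where "h = (\<lambda>\<tau>. f (z + \<tau> *s u))"
  have in_ball: "z + \<tau> *s u \<in> ball z (2 * \<rho>)" if "\<tau> \<in> ball 0 2" for \<tau>
    using that \<rho> by (simp add: dist_norm norm_vector_smult nu)
  have "h holomorphic_on ball 0 2"
    unfolding h_def by (rule holomorphic_several_line[OF f in_ball])
  then have "norm (h s - h 0 - deriv h 0 * s) \<le> 8 * M * norm s ^ 2"
    by (rule first_order_Taylor_bound) (auto simp: h_def intro!: bnd in_ball s)
  moreover have "deriv h 0 = cderiv f z u"
    using holomorphic_several_line_derivative[OF f, of z 0 u] \<rho> by (simp add: h_def DERIV_imp_deriv)
  moreover have "cderiv f z w = cderiv f z u * s"
    using holomorphic_several_cderiv(2)[OF f, of z s u] \<rho> by (simp add: su)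
  ultimately show ?thesis
    by (simp add: h_def su s)
qed

text \<open>Holomorphy provides a derivative at every point but no continuity of the derivative in the
  point, so the usual theorem on differentiation under the integral does not apply. The uniform
  quadratic bound on the remainder takes the place of this continuity.\<close>

lemma holomorphic_several_integral:
  fixes K :: "real \<Rightarrow> complex^'n::finite \<Rightarrow> complex"
  assumes P: "open P" and cont: "continuous_on ({0..1} \<times> P) (\<lambda>(t, z). K t z)"
    and hol: "\<And>t. t \<in> {0..1} \<Longrightarrow> holomorphic_several (K t) P"
  shows "holomorphic_several (\<lambda>z. integral {0..1} (\<lambda>t. K t z)) P"
    and "z \<in> P \<Longrightarrow> (\<lambda>t. partial a (K t) z) integrable_on {0..1}"
    and "z \<in> P \<Longrightarrow> partial a (\<lambda>z. integral {0..1} (\<lambda>t. K t z)) z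
        = integral {0..1} (\<lambda>t. partial a (K t) z)"
proof -
  define G where "G = (\<lambda>z. integral {0..1} (\<lambda>t. K t z))"
  define L where "L = (\<lambda>z w. integral {0..1} (\<lambda>t. cderiv (K t) z w))"
  have contK: "continuous_on {0..1} (\<lambda>t. K t y)" if "y \<in> P" for y
  proof -
    have "continuous_on {0..1} (\<lambda>t. case (t, y) of (t, z) \<Rightarrow> K t z)"
      by (rule continuous_on_compose2[OF cont]) (use that in \<open>auto intro!: continuous_intros\<close>)
    then show ?thesis by simp
  qed
  have main: "(G has_derivative L z) (at z)" "\<And>c w. L z (c *s w) = c * L z w"
     "\<And>w. (\<lambda>t. cderiv (K t) z w) integrable_on {0..1}" if z: "z \<in> P" for z
  proof -
    obtain \<rho>0 where \<rho>0: "\<rho>0 > 0" "cball z \<rho>0 \<subseteq> P"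
      using P z open_contains_cball by blast
    define \<rho> where "\<rho> = \<rho>0 / 2"
    have \<rho>: "\<rho> > 0" "cball z (2 * \<rho>) \<subseteq> P" using \<rho>0 by (auto simp: \<rho>_def)
    have "compact ((\<lambda>(t, z). K t z) ` ({0..1} \<times> cball z (2 * \<rho>)))"
      using \<rho> by (intro compact_continuous_image continuous_on_subset[OF cont] compact_Times) auto
    then obtain M where M: "\<And>t y. t \<in> {0..1} \<Longrightarrow> y \<in> cball z (2 * \<rho>) \<Longrightarrow> norm (K t y) \<le> M"
      using compact_imp_bounded[THEN iffD1[OF bounded_iff]] by fastforce
    have bound: "norm (K t (z + w) - K t z - cderiv (K t) z w) \<le> 8 * M * (norm w / \<rho>) ^ 2"
      if "t \<in> {0..1}" "norm w \<le> \<rho>" for t w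
      using that \<rho> by (intro cderiv_remainder_bound holomorphic_several_subset[OF hol] M) auto
    have smult: "cderiv (K t) z (c *s w) = c * cderiv (K t) z w" if "t \<in> {0..1}" for t c w
      using holomorphic_several_cderiv(2)[OF hol[OF that] z] .
    have linK: "linear (cderiv (K t) z)" if "t \<in> {0..1}" for t
      using holomorphic_several_cderiv(1)[OF hol[OF that] z] has_derivative_linear by blast
    \<comment> \<open>The derivative is a uniform limit of difference quotients, hence continuous in the
      parameter.\<close>
    have contD0: "continuous_on {0..1} (\<lambda>t. cderiv (K t) z w)" if w: "norm w \<le> \<rho>" for w
    proof (rule uniform_limit_theorem)
      define q where "q = (\<lambda>s::real. \<lambda>t. (K t (z + of_real s *s w) - K t z) / of_real s)"
      have inP: "z + of_real s *s w \<in> P" if "0 < s" "s < 1" for s :: real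
      proof -
        have "norm (of_real s *s w) \<le> 1 * \<rho>"
          unfolding norm_vector_smult using that w \<rho> by (intro mult_mono) auto
        then have "z + of_real s *s w \<in> cball z (2 * \<rho>)" using \<rho> by (simp add: dist_norm)
        with \<rho> show ?thesis by blast
      qed
      have ev: "eventually (\<lambda>s::real. 0 < s \<and> s < 1) (at_right 0)"
        using eventually_at_right_real[of 0 "1::real"] by (auto elim: eventually_mono)
      show "\<forall>\<^sub>F s in at_right 0. continuous_on {0..1} (q s)"
        using ev by eventually_elim (auto simp: q_def intro!: continuous_intros contK inP z)
      have qb: "norm (q s t - cderiv (K t) z w) \<le> 8 * \<bar>M\<bar> * s" if s: "0 < s" "s < 1"
          and t: "t \<in> {0..1}" for s t
      proof -
        define sw where "sw = of_real s *s w"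
        have nsw: "norm sw = s * norm w" using s by (simp add: sw_def norm_vector_smult)
        have "s * norm w \<le> 1 * \<rho>" using s w \<rho> by (intro mult_mono) auto
        then have "norm (K t (z + sw) - K t z - cderiv (K t) z sw) \<le> 8 * M * (norm sw / \<rho>) ^ 2"
          using bound[OF t, of sw] nsw by simp
        also have "\<dots> \<le> 8 * \<bar>M\<bar> * s ^ 2"
        proof -
          have "norm sw / \<rho> \<le> s" using nsw w \<rho> s by (simp add: field_simps)
          then have "(norm sw / \<rho>) ^ 2 \<le> s ^ 2" using \<rho> by (intro power_mono) auto
          then show ?thesis by (rule mult_mono[rotated]) auto
        qed
        finally have 1: "norm (K t (z + sw) - K t z - cderiv (K t) z sw) \<le> 8 * \<bar>M\<bar> * s ^ 2" .
        have "q s t - cderiv (K t) z w = (K t (z + sw) - K t z - cderiv (K t) z sw) / of_real s"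
          using s smult[OF t, of "of_real s" w] by (simp add: q_def sw_def field_simps)
        then have "norm (q s t - cderiv (K t) z w)
            = norm (K t (z + sw) - K t z - cderiv (K t) z sw) / s"
          using s by (simp add: norm_divide)
        also have "\<dots> \<le> 8 * \<bar>M\<bar> * s"
          using 1 s by (simp add: divide_le_eq power2_eq_square mult.assoc)
        finally show ?thesis .
      qed
      show "uniform_limit {0..1} q (\<lambda>t. cderiv (K t) z w) (at_right 0)"
      proof (rule uniform_limitI)
        fix e :: real assume e: "e > 0"
        have "eventually (\<lambda>s::real. 8 * \<bar>M\<bar> * s < e) (at_right 0)"
        proof -
          have "((\<lambda>s::real. 8 * \<bar>M\<bar> * s) \<longlongrightarrow> 8 * \<bar>M\<bar> * 0) (at_right 0)"
            by (intro tendsto_intros)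
          then show ?thesis using e by (auto dest: order_tendstoD)
        qed
        with ev show "\<forall>\<^sub>F s in at_right 0. \<forall>t\<in>{0..1}. dist (q s t) (cderiv (K t) z w) < e"
          by eventually_elim (use qb in \<open>fastforce simp: dist_norm\<close>)
      qed
    qed simp
    have contD: "continuous_on {0..1} (\<lambda>t. cderiv (K t) z w)" for w
    proof (cases "w = 0")
      case True
      then have "cderiv (K t) z w = 0" if "t \<in> {0..1}" for t
        using linear_0[OF linK[OF that]] by simp
      then show ?thesis by (subst continuous_on_cong[OF refl, of _ _ "\<lambda>_. 0"]) auto
    next
      case False
      define c :: complex where "c = of_real (norm w / \<rho>)"
      have c: "c \<noteq> 0" using False \<rho> by (simp add: c_def)
      define u where "u = inverse c *s w"
      have w: "w = c *s u" using c by (simp add: u_def vec_eq_iff)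
      have "norm u \<le> \<rho>" using \<rho> False by (simp add: u_def c_def norm_vector_smult
          norm_inverse norm_divide)
      then have "continuous_on {0..1} (\<lambda>t. c * cderiv (K t) z u)"
        by (intro continuous_intros contD0)
      then show ?thesis
        by (subst continuous_on_cong[OF refl, of _ _ "\<lambda>t. c * cderiv (K t) z u"])
            (auto simp: w smult)
    qed
    show intD: "(\<lambda>t. cderiv (K t) z w) integrable_on {0..1}" for w
      using integrable_continuous_real[OF contD] .
    show Lsmult: "L z (c *s w) = c * L z w" for c w
    proof -
      have "L z (c *s w) = integral {0..1} (\<lambda>t. c * cderiv (K t) z w)"
        unfolding L_def by (intro integral_cong) (simp add: smult)
      then show ?thesis by (simp add: L_def)
    qed
    have Ladd: "L z (w + w') = L z w + L z w'" for w w'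
    proof -
      have "L z (w + w') = integral {0..1} (\<lambda>t. cderiv (K t) z w + cderiv (K t) z w')"
        unfolding L_def by (intro integral_cong) (simp add: linear_add[OF linK])
      then show ?thesis by (simp add: L_def integral_add[OF intD intD])
    qed
    have "linear (L z)"
    proof (rule linearI)
      show "L z (r *\<^sub>R w) = r *\<^sub>R L z w" for r w
      proof -
        have "r *\<^sub>R w = of_real r *s w"

          unfolding vec_eq_iff vector_scaleR_component vector_smult_component
          by (simp add: scaleR_conv_of_real)
        then show ?thesis using Lsmult[of "of_real r" w] by (simp add: scaleR_conv_of_real)
      qed
    qed (rule Ladd)
    then have bl: "bounded_linear (L z)" by (simp add: linear_conv_bounded_linear)
    have rem: "norm (G (z + w) - G z - L z w) \<le> 8 * M * (norm w / \<rho>) ^ 2" if w: "norm w \<le> \<rho>" for w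
    proof -
      have zw: "z + w \<in> P" using w \<rho> by (auto simp: dist_norm subset_iff)
      have "G (z + w) - G z - L z w = integral {0..1} (\<lambda>t. K t (z + w) - K t z - cderiv (K t) z w)"
        unfolding G_def L_def
        using integrable_continuous_real[OF contK[OF zw]] integrable_continuous_real[OF contK[OF z]]
            intD[of w]
        by (simp add: integral_diff integrable_diff)
      moreover have "norm (integral {0..1} (\<lambda>t. K t (z + w) - K t z - cderiv (K t) z w))
          \<le> 8 * M * (norm w / \<rho>) ^ 2 * (1 - 0)"
        by (rule integral_bound) (auto intro!: continuous_intros contK zw z contD bound w)
      ultimately show ?thesis by simp
    qed
    show "(G has_derivative L z) (at z)"
    proof (rule has_derivativeI[OF bl])
      have "((\<lambda>y. 8 * M / \<rho> ^ 2 * norm (y - z)) \<longlongrightarrow> 8 * M / \<rho> ^ 2 * norm (z - z)) (at z)"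
        by (intro tendsto_intros)
      then have lim: "((\<lambda>y. 8 * M / \<rho> ^ 2 * norm (y - z)) \<longlongrightarrow> 0) (at z)" by simp
      have "eventually (\<lambda>y. y \<in> ball z \<rho>) (at z)"
        using \<rho> by (intro eventually_at_in_open') auto
      then have "eventually (\<lambda>y. norm ((G y - G z - L z (y - z)) /\<^sub>R norm (y - z))
          \<le> 8 * M / \<rho> ^ 2 * norm (y - z)) (at z)"
      proof eventually_elim
        case (elim y)
        have "norm (G y - G z - L z (y - z)) \<le> 8 * M / \<rho> ^ 2 * norm (y - z) * norm (y - z)"
          using rem[of "y - z"] elim by (simp add: dist_norm norm_minus_commute power2_eq_square)
        then have "norm (G y - G z - L z (y - z)) / norm (y - z) \<le> 8 * M / \<rho> ^ 2 * norm (y - z)"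
          if "y \<noteq> z"
          using that by (subst pos_divide_le_eq) auto
        then show ?case
          by (cases "y = z") (simp_all add: divide_inverse mult.commute)
      qed
      then show "((\<lambda>y. (G y - G z - L z (y - z)) /\<^sub>R norm (y - z)) \<longlongrightarrow> 0) (at z)"
        by (rule Lim_null_comparison[OF _ lim])
    qed
  qed
  show hG: "holomorphic_several (\<lambda>z. integral {0..1} (\<lambda>t. K t z)) P"
    using main unfolding holomorphic_several_def G_def by blast
  show "(\<lambda>t. partial a (K t) z) integrable_on {0..1}" if z: "z \<in> P"
    by (rule integrable_eq[OF main(3)[OF z, of "axis a 1"]]) (simp add: partial_eq_cderiv[OF hol z])
  show "partial a (\<lambda>z. integral {0..1} (\<lambda>t. K t z)) z = integral {0..1} (\<lambda>t. partial a (K t) z)"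
      if z: "z \<in> P"
  proof -
    have "cderiv G z = L z"
      using main(1)[OF z] frechet_derivative_at unfolding cderiv_def by metis
    then have "partial a G z = L z (axis a 1)"
      using partial_eq_cderiv[OF hG z] by (simp add: G_def)
    also have "\<dots> = integral {0..1} (\<lambda>t. partial a (K t) z)"
      unfolding L_def by (intro integral_cong) (simp add: partial_eq_cderiv[OF hol z])
    finally show ?thesis by (simp add: G_def)
  qed
qed


lemma partial_Cauchy_integral:
  assumes f: "holomorphic_several f (ball z (2 * \<rho>))" and \<rho>: "\<rho> > 0"
  shows "partial a f z = integral {0..1} (\<lambda>t.
    f (z + (of_real \<rho> * exp (2 * of_real pi * \<i> * of_real t)) *s axis a 1)
      * (exp (- (2 * of_real pi * \<i> * of_real t)) / of_real \<rho>))"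
proof -
  define h where "h = (\<lambda>\<tau>. f (z + \<tau> *s axis a 1))"
  have hol: "h holomorphic_on ball 0 (2 * \<rho>)"
    unfolding h_def by (rule holomorphic_several_line[OF f])
        (simp add: dist_norm norm_vector_smult norm_axis_one)
  have sub: "cball 0 \<rho> \<subseteq> ball (0::complex) (2 * \<rho>)" using \<rho> by auto
  have "(h has_field_derivative (1 / (2 * of_real pi * \<i>) * contour_integral (circlepath 0 \<rho>)
      (\<lambda>u. h u / (u - 0)^2))) (at 0)"
    using sub \<rho>
    by (intro Cauchy_derivative_integral_circlepath(2))
       (auto intro: holomorphic_on_imp_continuous_on holomorphic_on_subset[OF hol])
  then have "partial a f z = 1 / (2 * of_real pi * \<i>) * contour_integral
      (circlepath 0 \<rho>) (\<lambda>u. h u / u^2)"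
    by (simp add: partial_def h_def DERIV_imp_deriv)
  also have "contour_integral (circlepath 0 \<rho>) (\<lambda>u. h u / u^2) = integral {0..1} (\<lambda>t.
      (2 * of_real pi * \<i>) * (h (of_real \<rho> * exp (2 * of_real pi * \<i> * of_real t))
        * (exp (- (2 * of_real pi * \<i> * of_real t)) / of_real \<rho>)))"
    unfolding contour_integral_integral
  proof (rule integral_cong)
    fix t :: real
    define e where "e = exp (2 * of_real pi * \<i> * of_real t)"
    have e: "e \<noteq> 0" "exp (- (2 * of_real pi * \<i> * of_real t)) = 1 / e"
      by (simp_all add: e_def exp_minus inverse_eq_divide)
    show "h (circlepath 0 \<rho> t) / (circlepath 0 \<rho> t)\<^sup>2 * vector_derivative (circlepath 0 \<rho>) (at t) =
      (2 * of_real pi * \<i>) * (h (of_real \<rho> * exp (2 * of_real pi * \<i> * of_real t))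
        * (exp (- (2 * of_real pi * \<i> * of_real t)) / of_real \<rho>))"
      unfolding vector_derivative_circlepath
      unfolding circlepath e(2)
      unfolding e_def[symmetric] using e(1) \<rho> by (simp add: field_simps power2_eq_square)
  qed
  finally show ?thesis
    by (simp add: h_def)
qed

text \<open>By the Cauchy integral formula a partial derivative is locally a parametric integral of
  translates of the function; holomorphy and the symmetry of second derivatives are both read off
  by differentiating under this integral.\<close>

lemma
  assumes f: "holomorphic_several f P" and P: "open P"
  shows holomorphic_several_partial: "holomorphic_several (partial a f) P"
    and partial_commute: "z \<in> P \<Longrightarrow> partial b (partial a f) z = partial a (partial b f) z"
proof -
  have local: "\<exists>W. open W \<and> z0 \<in> W \<and> holomorphic_several (partial a f) W \<and>
     partial b (partial a f) z0 = integral {0..1} (\<lambda>t.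
        partial b f (z0 + (of_real \<rho> * exp (2 * of_real pi * \<i> * of_real t)) *s axis a 1)
      * (exp (- (2 * of_real pi * \<i> * of_real t)) / of_real \<rho>))"
    if \<rho>: "\<rho> > 0" "ball z0 (3 * \<rho>) \<subseteq> P" for z0 \<rho> a b
  proof -
    \<comment> \<open>With centres in \<open>W\<close>, the circles of integration stay in the ball of radius $2\rho$, inside
      \<open>P\<close>.\<close>
    define W where "W = ball z0 \<rho>"
    define c where "c = (\<lambda>t. of_real \<rho> * exp (2 * of_real pi * \<i> * of_real t) :: complex)"
    define e where "e = (\<lambda>t. exp (- (2 * of_real pi * \<i> * of_real t)) / of_real \<rho> :: complex)"
    define K where "K = (\<lambda>t z. f (z + c t *s axis a 1) * e t)"
    have W: "open W" "z0 \<in> W" using \<rho> by (auto simp: W_def)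
    have "norm (exp (2 * of_real pi * \<i> * of_real t)) = 1" for t
      using norm_exp_i_times[of "2 * pi * t"] by (simp add: mult_ac)
    then have nc: "norm (c t) = \<rho>" for t
      using \<rho> by (simp add: c_def norm_mult)
    have inP: "z + c t *s axis a 1 \<in> P" if "z \<in> W" for z t
    proof -
      have "dist z0 (z + c t *s axis a 1) \<le> dist z0 z + dist z (z + c t *s axis a 1)"
        by (rule dist_triangle)
      also have "dist z (z + c t *s axis a 1) = \<rho>"
        by (simp add: dist_norm norm_vector_smult norm_axis_one nc)
      finally show ?thesis using that \<rho> by (auto simp: W_def)
    qed
    have cont: "continuous_on ({0..1} \<times> W) (\<lambda>(t, z). K t z)"
      unfolding K_def case_prod_unfold
    proof (intro continuous_on_mult)
      have "continuous_on ({0..1} \<times> W) (\<lambda>x. snd x + c (fst x) *s axis a 1)"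
        unfolding c_def
        by (intro continuous_intros bounded_linear.continuous_on[OF bounded_linear_vector_smult])
      then show "continuous_on ({0..1} \<times> W) (\<lambda>x. f (snd x + c (fst x) *s axis a 1))"
        by (rule continuous_on_compose2[OF holomorphic_several_continuous_on[OF f]])
            (auto simp: inP)
      show "continuous_on ({0..1} \<times> W) (\<lambda>x. e (fst x))"
        unfolding e_def using \<rho> by (intro continuous_intros) auto
    qed
    have shift: "holomorphic_several (\<lambda>z. f (z + w)) W"
      and pshift: "partial b (\<lambda>z. f (z + w)) z0 = partial b f (z0 + w)"
      if w: "\<And>z. z \<in> W \<Longrightarrow> z + w \<in> P" for w
    proof -
      show "holomorphic_several (\<lambda>z. f (z + w)) W"
        unfolding holomorphic_several_def
      proof (intro ballI exI conjI allI)
        fix z assume z: "z \<in> W"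
        have "((\<lambda>z. z + w) has_derivative (\<lambda>u. u)) (at z)"
          by (auto intro!: derivative_eq_intros)
        from has_derivative_compose[OF this holomorphic_several_cderiv(1)[OF f w[OF z]]]
        show "((\<lambda>z. f (z + w)) has_derivative cderiv f (z + w)) (at z)" .
        show "cderiv f (z + w) (k *s u) = k * cderiv f (z + w) u" for k u
          by (rule holomorphic_several_cderiv(2)[OF f w[OF z]])
      qed
      show "partial b (\<lambda>z. f (z + w)) z0 = partial b f (z0 + w)"
        by (simp add: partial_def add_ac)
    qed
    have hol: "holomorphic_several (K t) W" for t
      unfolding K_def by (intro holomorphic_several_mult holomorphic_several_const shift inP)
    note G = holomorphic_several_integral[OF W(1) cont hol]
    have eq: "integral {0..1} (\<lambda>t. K t z) = partial a f z" if z: "z \<in> W" for z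
    proof -
      have "ball z (2 * \<rho>) \<subseteq> P"
      proof
        fix y assume "y \<in> ball z (2 * \<rho>)"
        then have "y \<in> ball z0 (3 * \<rho>)" using z dist_triangle[of z0 y z] by (simp add: W_def)
        with \<rho> show "y \<in> P" by blast
      qed
      from partial_Cauchy_integral[OF holomorphic_several_subset[OF f this] \<rho>(1), of a]
      show ?thesis by (simp add: K_def c_def e_def)
    qed
    have 1: "holomorphic_several (partial a f) W"
      by (rule holomorphic_several_local_cong[OF G(1) W(1) eq])
    have 2: "partial b (partial a f) z0 = integral {0..1} (\<lambda>t. partial b (K t) z0)"
      using partial_cong[OF W eq, where a = b] G(3)[OF W(2), of b] by simp
    have 3: "partial b (K t) z0 = partial b f (z0 + c t *s axis a 1) * e t" for t
    proof -
      have "holomorphic_several (\<lambda>z. f (z + c t *s axis a 1)) W"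
        by (intro shift inP)
      then have "((\<lambda>\<tau>. f (z0 + \<tau> *s axis b 1 + c t *s axis a 1)) has_field_derivative
           partial b (\<lambda>z. f (z + c t *s axis a 1)) z0) (at 0)"
        using partial_field_derivative[of "\<lambda>z. f (z + c t *s axis a 1)" W z0 0 b] W by simp
      from DERIV_cmult_right[OF this, of "e t"]
      have "partial b (K t) z0 = partial b (\<lambda>z. f (z + c t *s axis a 1)) z0 * e t"
        unfolding K_def by (subst partial_def) (rule DERIV_imp_deriv)
      moreover have "partial b (\<lambda>z. f (z + c t *s axis a 1)) z0
          = partial b f (z0 + c t *s axis a 1)"
        by (rule pshift) (rule inP)
      ultimately show ?thesis by (simp only:)
    qed
    show ?thesis
      using 1 2 W unfolding 3 c_def e_def by blast
  qed
  have radius: "\<exists>\<rho>>0. ball z (3 * \<rho>) \<subseteq> P" if z: "z \<in> P" for z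
  proof -
    obtain e where "e > 0" "ball z e \<subseteq> P" using openE[OF P z] by blast
    then show ?thesis by (intro exI[of _ "e / 3"]) auto
  qed
  have hol: "holomorphic_several (partial a f) P" for a
    unfolding holomorphic_several_def
  proof
    fix z assume "z \<in> P"
    then obtain \<rho> where "\<rho> > 0" "ball z (3 * \<rho>) \<subseteq> P" using radius by blast
    from local[OF this, of a undefined] obtain W where "z \<in> W" "holomorphic_several (partial a f) W"
      by (elim exE conjE)
    from holomorphic_several_cderiv[OF this(2,1)]
    show "\<exists>D. (partial a f has_derivative D) (at z) \<and> (\<forall>c w. D (c *s w) = c * D w)"
      by (intro exI[of _ "cderiv (partial a f) z"] conjI allI)
  qed
  show "holomorphic_several (partial a f) P" by (rule hol)
  show "partial b (partial a f) z = partial a (partial b f) z" if z: "z \<in> P"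
  proof -
    obtain \<rho> where \<rho>: "\<rho> > 0" "ball z (3 * \<rho>) \<subseteq> P" using radius[OF z] by blast
    have "ball z (2 * \<rho>) \<subseteq> P" using \<rho> by auto
    note partial_Cauchy_integral[OF holomorphic_several_subset[OF hol this] \<rho>(1), of a b]
    moreover from local[OF \<rho>, of a b] have "partial b (partial a f) z = integral {0..1} (\<lambda>t.
        partial b f (z + (of_real \<rho> * exp (2 * of_real pi * \<i> * of_real t)) *s axis a 1)
      * (exp (- (2 * of_real pi * \<i> * of_real t)) / of_real \<rho>))"
      by (elim exE conjE)
    ultimately show ?thesis by (simp only:)
  qed
qed

section \<open>Taylor expansion and formal shifts\<close>

text \<open>The Taylor series of the function whose argument is moved by the formal variable against the
  \<open>c\<close>-th coordinate vector: in the coordinates on the dual, this is the shift by minus the step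
  times the weight \<open>\<omega> c\<close>.\<close>

definition taylor :: "'n::finite \<Rightarrow> (complex^'n \<Rightarrow> complex) \<Rightarrow> complex^'n \<Rightarrow> complex fps" where
  "taylor c g z = fps_expansion (\<lambda>\<tau>. g (z - \<tau> *s axis c 1)) 0"

lemma open_line_preimage:
  assumes "open P"
  shows "open {\<tau>. z - \<tau> *s axis (c::'n::finite) (1::complex) \<in> P}"
proof -
  have "continuous_on UNIV (\<lambda>\<tau>::complex. z - \<tau> *s axis c 1)"
    by (intro continuous_intros bounded_linear.continuous_on[OF bounded_linear_vector_smult])
  from open_vimage[OF assms this] show ?thesis by (simp add: vimage_def)
qed

lemma taylor_has_fps_expansion:
  assumes g: "holomorphic_several g P" and P: "open P" "z \<in> P"
  shows "(\<lambda>\<tau>. g (z - \<tau> *s axis c 1)) has_fps_expansion taylor c g z"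
  unfolding taylor_def
proof (rule analytic_at_imp_has_fps_expansion_0)
  define S where "S = {\<tau>. z - \<tau> *s axis c 1 \<in> P}"
  have "(\<lambda>\<tau>. g (z + \<tau> *s (- axis c 1))) holomorphic_on S"
    by (rule holomorphic_several_line[OF g]) (simp add: S_def)
  moreover have "open S" "0 \<in> S"
    using P open_line_preimage by (auto simp: S_def)
  ultimately show "(\<lambda>\<tau>. g (z - \<tau> *s axis c 1)) analytic_on {0}"
    by (auto simp: analytic_at)
qed

lemma taylor_eqI:
  assumes "(\<lambda>\<tau>. g (z - \<tau> *s axis c 1)) has_fps_expansion F"
  shows "taylor c g z = F"
  by (rule fps_ext) (simp add: taylor_def fps_expansion_def fps_nth_fps_expansion[OF assms])

lemma taylor_mult:
  assumes "holomorphic_several f P" "holomorphic_several g P" "open P" "z \<in> P"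
  shows "taylor c (\<lambda>y. f y * g y) z = taylor c f z * taylor c g z"
  by (intro taylor_eqI has_fps_expansion_mult taylor_has_fps_expansion) (use assms in auto)

lemma taylor_diff:
  assumes "holomorphic_several f P" "holomorphic_several g P" "open P" "z \<in> P"
  shows "taylor c (\<lambda>y. f y - g y) z = taylor c f z - taylor c g z"
  by (intro taylor_eqI has_fps_expansion_diff taylor_has_fps_expansion) (use assms in auto)

lemma taylor_const: "taylor c (\<lambda>_. k) z = fps_const k"
  by (intro taylor_eqI) simp

lemma taylor_sum:
  assumes "\<And>i. i \<in> I \<Longrightarrow> holomorphic_several (f i) P" "open P" "z \<in> P"
  shows "taylor c (\<lambda>y. \<Sum>i\<in>I. f i y) z = (\<Sum>i\<in>I. taylor c (f i) z)"
  by (intro taylor_eqI has_fps_expansion_sum taylor_has_fps_expansion) (use assms in auto)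

lemma taylor_cong:
  assumes "open P" "z \<in> P" "\<And>y. y \<in> P \<Longrightarrow> f y = g y"
  shows "taylor c f z = taylor c g z"
proof -
  have "eventually (\<lambda>\<tau>. z - \<tau> *s axis c 1 \<in> P) (nhds 0)"
    using eventually_nhds_in_open[OF open_line_preimage[OF assms(1)], of 0 z c] assms(2) by simp
  then have "eventually (\<lambda>\<tau>. f (z - \<tau> *s axis c 1) = g (z - \<tau> *s axis c 1)) (nhds 0)"
    by eventually_elim (simp add: assms(3))
  from higher_deriv_cong_ev[OF this refl] show ?thesis
    by (simp add: taylor_def fps_expansion_def)
qed

lemma holomorphic_several_partial_funpow:
  "holomorphic_several g P \<Longrightarrow> open P \<Longrightarrow> holomorphic_several ((partial c ^^ n) g) P"
  by (induction n) (auto intro: holomorphic_several_partial)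

lemma partial_funpow_cong:
  assumes "open P" "\<And>y. y \<in> P \<Longrightarrow> f y = g y" "z \<in> P"
  shows "(partial c ^^ n) f z = (partial c ^^ n) g z"
  using assms(3)
proof (induction n arbitrary: z)
  case (Suc n)
  from partial_cong[OF assms(1) Suc.prems Suc.IH] show ?case by simp
qed (simp add: assms(2))

lemma partial_cmult:
  assumes "holomorphic_several g P" "z \<in> P"
  shows "partial c (\<lambda>y. k * g y) z = k * partial c g z"
proof -
  have "((\<lambda>\<tau>. g (z + \<tau> *s axis c 1)) has_field_derivative partial c g z) (at 0)"
    using partial_field_derivative[OF assms(1), of z 0 c] assms(2) by simp
  from DERIV_imp_deriv[OF DERIV_cmult[OF this]] show ?thesis
    by (simp only: partial_def[of c "\<lambda>y. k * g y"])
qed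

lemma partial_funpow_cmult:
  assumes "holomorphic_several g P" "open P" "z \<in> P"
  shows "(partial c ^^ n) (\<lambda>y. k * g y) z = k * (partial c ^^ n) g z"
  using assms(3)
proof (induction n arbitrary: z)
  case (Suc n)
  have "partial c ((partial c ^^ n) (\<lambda>y. k * g y)) z = partial c (\<lambda>y. k * (partial c ^^ n) g y) z"
    by (rule partial_cong[OF assms(2) Suc.prems]) (rule Suc.IH)
  then show ?case
    using partial_cmult[OF holomorphic_several_partial_funpow[OF assms(1,2)] Suc.prems] by simp
qed simp

lemma partial_funpow_commute1:
  assumes "holomorphic_several g P" "open P" "z \<in> P"
  shows "(partial a ^^ n) (partial c g) z = partial c ((partial a ^^ n) g) z"
  using assms(3)
proof (induction n arbitrary: z)
  case (Suc n)
  have "(partial a ^^ Suc n) (partial c g) z = partial a (partial c ((partial a ^^ n) g)) z"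
    using partial_cong[OF assms(2) Suc.prems Suc.IH] by simp
  also have "\<dots> = partial c (partial a ((partial a ^^ n) g)) z"
    by (intro partial_commute[OF _ assms(2) Suc.prems] holomorphic_several_partial_funpow assms)
  finally show ?case by simp
qed simp

lemma partial_funpow_commute:
  assumes "holomorphic_several g P" "open P" "z \<in> P"
  shows "(partial c ^^ m) ((partial a ^^ n) g) z = (partial a ^^ n) ((partial c ^^ m) g) z"
  using assms(1,3)
proof (induction m arbitrary: g)
  case (Suc m)
  have "(partial c ^^ Suc m) ((partial a ^^ n) g) z
      = (partial c ^^ m) (partial c ((partial a ^^ n) g)) z"
    by (simp only: funpow_Suc_right comp_def)
  also have "\<dots> = (partial c ^^ m) ((partial a ^^ n) (partial c g)) z"
    by (rule partial_funpow_cong[OF assms(2) _ Suc.prems(2)])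
       (simp add: partial_funpow_commute1[OF Suc.prems(1) assms(2)])
  also have "\<dots> = (partial a ^^ n) ((partial c ^^ m) (partial c g)) z"
    by (intro Suc.IH holomorphic_several_partial Suc.prems assms)
  finally show ?case by (simp only: funpow_Suc_right comp_def)
qed simp

lemma fps_nth_taylor:
  assumes g: "holomorphic_several g P" and P: "open P" "z \<in> P"
  shows "fps_nth (taylor c g z) n = (- 1) ^ n * (partial c ^^ n) g z / fact n"
proof -
  define S where "S = {\<tau>. z - \<tau> *s axis c 1 \<in> P}"
  have S: "open S" "0 \<in> S" using P open_line_preimage by (auto simp: S_def)
  have der: "((\<lambda>\<tau>. G (z - \<tau> *s axis c 1)) has_field_derivative - partial c G (z - \<tau> *s axis c 1))
      (at \<tau>)"
    if "holomorphic_several G P" "\<tau> \<in> S" for G \<tau>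
  proof -
    have "((\<lambda>s. G (z + s *s axis c 1)) has_field_derivative partial c G (z
        + (- \<tau>) *s axis c 1)) (at (- \<tau>))"
      by (rule partial_field_derivative[OF that(1)]) (use that(2) in \<open>simp add: S_def\<close>)
    from DERIV_chain2[OF this DERIV_minus[OF DERIV_ident]] show ?thesis by simp
  qed
  have "\<tau> \<in> S \<Longrightarrow> (deriv ^^ n) (\<lambda>\<tau>. g (z - \<tau> *s axis c 1)) \<tau>
      = (- 1) ^ n * (partial c ^^ n) g (z - \<tau> *s axis c 1)" for \<tau>
  proof (induction n arbitrary: \<tau>)
    case (Suc n)
    have "deriv ((deriv ^^ n) (\<lambda>\<tau>. g (z - \<tau> *s axis c 1))) \<tau>
        = deriv (\<lambda>\<tau>. (- 1) ^ n * (partial c ^^ n) g (z - \<tau> *s axis c 1)) \<tau>"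
      using eventually_nhds_in_open[OF S(1) Suc.prems]
      by (intro deriv_cong_ev) (auto elim: eventually_mono simp: Suc.IH)
    also have "\<dots> = (- 1) ^ n * (- partial c ((partial c ^^ n) g) (z - \<tau> *s axis c 1))"
      by (intro DERIV_imp_deriv DERIV_cmult der Suc.prems holomorphic_several_partial_funpow g P)
    finally show ?case by simp
  qed simp
  from this[OF S(2)] show ?thesis
    by (simp add: taylor_def fps_expansion_def)
qed

lemma taylor_of_constant_direction:
  assumes "holomorphic_several g P" "open P" "z \<in> P" "\<And>y. y \<in> P \<Longrightarrow> partial c g y = 0"
  shows "taylor c g z = fps_const (g z)"
proof (rule fps_ext)
  fix n
  show "fps_nth (taylor c g z) n = fps_nth (fps_const (g z)) n"
  proof (cases n)
    case (Suc m)
    have "(partial c ^^ n) g z = (partial c ^^ m) (partial c g) z"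
      by (simp only: Suc funpow_Suc_right comp_def)
    also have "\<dots> = (partial c ^^ m) (\<lambda>_. 0 * 0) z"
      by (rule partial_funpow_cong[OF assms(2) _ assms(3)]) (simp add: assms(4))
    also have "\<dots> = 0"
      by (subst partial_funpow_cmult[OF holomorphic_several_const assms(2,3)]) simp
    finally show ?thesis by (simp add: fps_nth_taylor[OF assms(1-3)] Suc)
  qed (simp add: fps_nth_taylor[OF assms(1-3)])
qed

text \<open>The equation says that $1/g$ has constant derivative $k$, so that $1/g$ at the shifted point
  is $1/g - k\gamma$ and the Taylor series is geometric. The recursive form also covers the points
  where \<open>g\<close> vanishes.\<close>

lemma taylor_Riccati:
  assumes g: "holomorphic_several g P" and P: "open P" "z \<in> P"
    and ode: "\<And>y. y \<in> P \<Longrightarrow> partial c g y = - k * g y ^ 2"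
  shows "taylor c g z = fps_const (g z) + fps_const (k * g z) * fps_X * taylor c g z"
proof -
  have pow: "(partial c ^^ n) g y = (- k) ^ n * fact n * g y ^ Suc n" if "y \<in> P" for y n
    using that
  proof (induction n arbitrary: y)
    case (Suc n)
    have "partial c ((partial c ^^ n) g) y = partial c (\<lambda>y. (- k) ^ n * fact n * g y ^ Suc n) y"
      by (rule partial_cong[OF P(1) Suc.prems Suc.IH])
    also have "\<dots> = (- k) ^ n * fact n * (of_nat (Suc n) * (partial c g y * g y ^ n))"
      using DERIV_cmult[OF DERIV_power[OF partial_field_derivative[OF g, of y 0 c], of "Suc n"],
          of "(- k) ^ n * fact n"] Suc.prems
      by (simp add: partial_def[of c "\<lambda>y. (- k) ^ n * fact n * (g y * g y ^ n)"] DERIV_imp_deriv)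
    also have "\<dots> = (- k) ^ Suc n * fact (Suc n) * g y ^ Suc (Suc n)"
      by (simp add: ode[OF Suc.prems] power2_eq_square algebra_simps)
    finally show ?case by simp
  qed simp
  have nth: "fps_nth (taylor c g z) n = k ^ n * g z ^ Suc n" for n
    by (simp add: fps_nth_taylor[OF g P] pow[OF P(2)] flip: power_mult_distrib)
  show ?thesis
  proof (rule fps_ext)
    fix n
    show "fps_nth (taylor c g z) n
        = fps_nth (fps_const (g z) + fps_const (k * g z) * fps_X * taylor c g z) n"
      by (cases n) (simp_all add: nth mult.assoc)
  qed
qed

text \<open>A power series in the step whose coefficients depend on the point is shifted by expanding
  every coefficient, with the same formal variable serving as the step and as the displacement.\<close>

definition shift :: "'n::finite \<Rightarrow> (complex^'n \<Rightarrow> complex fps) \<Rightarrow> complex^'n \<Rightarrow> complex fps" where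
  "shift c F z = Abs_fps (\<lambda>k. \<Sum>n\<le>k. fps_nth (taylor c (\<lambda>y. fps_nth (F y) n) z) (k - n))"

definition holomorphic_series :: "(complex^'n::finite \<Rightarrow> complex fps) \<Rightarrow>
    (complex^'n) set \<Rightarrow> bool" where
  "holomorphic_series F P \<longleftrightarrow> (\<forall>n. holomorphic_several (\<lambda>z. fps_nth (F z) n) P)"

lemma holomorphic_series_const: "holomorphic_series (\<lambda>_. C) P"
  by (auto simp: holomorphic_series_def)

lemma holomorphic_series_mult:
  "holomorphic_series F P \<Longrightarrow> holomorphic_series G P \<Longrightarrow> holomorphic_series (\<lambda>z. F z * G z) P"
  unfolding holomorphic_series_def fps_mult_nth
  by (intro allI holomorphic_several_sum holomorphic_several_mult) auto

lemma holomorphic_series_diff: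
  "holomorphic_series F P \<Longrightarrow> holomorphic_series G P \<Longrightarrow> holomorphic_series (\<lambda>z. F z - G z) P"
  by (auto simp: holomorphic_series_def)

lemma holomorphic_series_fps_const:
  assumes "holomorphic_several g P"
  shows "holomorphic_series (\<lambda>z. fps_const (g z)) P"
  unfolding holomorphic_series_def
proof
  fix n
  show "holomorphic_several (\<lambda>z. fps_nth (fps_const (g z)) n) P"
    using assms by (cases "n = 0") auto
qed

lemma holomorphic_series_taylor:
  assumes "holomorphic_several g P" "open P"
  shows "holomorphic_series (taylor c g) P"
  unfolding holomorphic_series_def
proof
  fix n
  have "holomorphic_several (\<lambda>z. ((- 1) ^ n / fact n) * (partial c ^^ n) g z) P"
    by (intro holomorphic_several_mult holomorphic_several_const holomorphic_several_partial_funpow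
        assms)
  then show "holomorphic_several (\<lambda>z. fps_nth (taylor c g z) n) P"
    by (rule holomorphic_several_local_cong[OF _ assms(2)]) (simp add: fps_nth_taylor[OF assms])
qed

lemma shift_cong:
  assumes "open P" "z \<in> P" "\<And>y. y \<in> P \<Longrightarrow> F y = G y"
  shows "shift c F z = shift c G z"
proof -
  have "taylor c (\<lambda>y. fps_nth (F y) n) z = taylor c (\<lambda>y. fps_nth (G y) n) z" for n
    by (rule taylor_cong[OF assms(1,2)]) (simp add: assms(3))
  then show ?thesis by (simp add: shift_def)
qed

lemma shift_diff:
  assumes "holomorphic_series F P" "holomorphic_series G P" "open P" "z \<in> P"
  shows "shift c (\<lambda>y. F y - G y) z = shift c F z - shift c G z"
  using assms unfolding holomorphic_series_def
  by (auto simp: fps_eq_iff shift_def taylor_diff[where P=P] sum_subtractf)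

lemma shift_fps_const: "shift c (\<lambda>y. fps_const (g y)) z = taylor c g z"
proof (rule fps_ext)
  fix k
  have "fps_nth (shift c (\<lambda>y. fps_const (g y)) z) k
      = (\<Sum>n\<le>k. if n = 0 then fps_nth (taylor c g z) k else 0)"
    unfolding shift_def fps_nth_Abs_fps
  proof (intro sum.cong refl)
    fix n
    show "fps_nth (taylor c (\<lambda>y. fps_nth (fps_const (g y)) n) z) (k - n)
        = (if n = 0 then fps_nth (taylor c g z) k else 0)"
      by (cases "n = 0") (simp_all add: taylor_const)
  qed
  then show "fps_nth (shift c (\<lambda>y. fps_const (g y)) z) k = fps_nth (taylor c g z) k"
    by simp
qed

lemma shift_const: "shift c (\<lambda>_. C) z = C"
proof (rule fps_ext)
  fix k
  have "fps_nth (shift c (\<lambda>_. C) z) k = (\<Sum>n\<le>k. if n = k then fps_nth C k else 0)"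
    unfolding shift_def by (auto simp: taylor_const intro!: sum.cong)
  then show "fps_nth (shift c (\<lambda>_. C) z) k = fps_nth C k"
    by simp
qed

text \<open>A double series is turned into a single one by identifying its two variables. Up to degree
  \<open>N\<close> this is a finite sum in the ring of power series, which is why the operation is
  multiplicative.\<close>

lemma fps_nth_diagonal:
  fixes a :: "nat \<Rightarrow> 'a::comm_ring_1 fps"
  assumes "k \<le> N"
  shows "(\<Sum>n\<le>k. fps_nth (a n) (k - n)) = fps_nth (\<Sum>n\<le>N. fps_X ^ n * a n) k"
proof -
  have "fps_nth (\<Sum>n\<le>N. fps_X ^ n * a n) k = (\<Sum>n\<le>N. if k < n then 0 else fps_nth (a n) (k - n))"
    by (simp add: fps_sum_nth fps_X_power_mult_nth)
  also have "\<dots> = (\<Sum>n\<le>k. fps_nth (a n) (k - n))"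
    using assms by (intro sum.mono_neutral_cong_right) auto
  finally show ?thesis by simp
qed

lemma diagonal_mult:
  fixes a b :: "nat \<Rightarrow> 'a::comm_ring_1 fps"
  shows "Abs_fps (\<lambda>k. \<Sum>n\<le>k. fps_nth (\<Sum>i\<le>n. a i * b (n - i)) (k - n)) =
    Abs_fps (\<lambda>k. \<Sum>n\<le>k. fps_nth (a n) (k - n)) * Abs_fps (\<lambda>k. \<Sum>n\<le>k. fps_nth (b n) (k - n))"
    (is "?L = ?A * ?B")
proof (rule fps_ext)
  fix k
  define A where "A = (\<Sum>n\<le>k. fps_X ^ n * a n)"
  define B where "B = (\<Sum>n\<le>k. fps_X ^ n * b n)"
  have AB: "fps_nth ?A i = fps_nth A i" "fps_nth ?B i = fps_nth B i" if "i \<le> k" for i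
    unfolding A_def B_def fps_nth_Abs_fps by (rule fps_nth_diagonal[OF that])+
  have "fps_nth (?A * ?B) k = fps_nth (A * B) k"
    unfolding fps_mult_nth
  proof (intro sum.cong refl)
    fix i assume "i \<in> {0..k}"
    then show "fps_nth ?A i * fps_nth ?B (k - i) = fps_nth A i * fps_nth B (k - i)"
      using AB(1)[of i] AB(2)[of "k - i"] by (simp only: atLeastAtMost_iff diff_le_self)
  qed
  also have "A * B = (\<Sum>i\<le>k. \<Sum>j\<le>k. fps_X ^ (i + j) * (a i * b j))"
    by (simp add: A_def B_def sum_product power_add mult_ac)
  also have "fps_nth \<dots> k = (\<Sum>(i, j)\<in>{..k} \<times> {..k}. fps_nth (fps_X ^ (i + j) * (a i * b j)) k)"
    by (simp add: fps_sum_nth sum.cartesian_product case_prod_unfold)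
  also have "\<dots> = (\<Sum>(i, j) | i + j \<le> k. fps_nth (fps_X ^ (i + j) * (a i * b j)) k)"
    by (rule sum.mono_neutral_right) (auto simp: fps_X_power_mult_nth split: if_splits)
  also have "\<dots> = (\<Sum>n\<le>k. \<Sum>i\<le>n. fps_nth (fps_X ^ n * (a i * b (n - i))) k)"
    by (subst sum.triangle_reindex_eq) simp
  also have "\<dots> = fps_nth (\<Sum>n\<le>k. fps_X ^ n * (\<Sum>i\<le>n. a i * b (n - i))) k"
    by (simp add: fps_sum_nth sum_distrib_left)
  also have "\<dots> = fps_nth ?L k"
    by (simp only: fps_nth_Abs_fps fps_nth_diagonal[OF order_refl])
  finally show "fps_nth ?L k = fps_nth (?A * ?B) k" by simp
qed

lemma shift_mult:
  assumes F: "holomorphic_series F P" and G: "holomorphic_series G P" and P: "open P" "z \<in> P"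
  shows "shift c (\<lambda>y. F y * G y) z = shift c F z * shift c G z"
proof -
  have hol: "holomorphic_several (\<lambda>y. fps_nth (F y) i * fps_nth (G y) j) P" for i j
    using F G by (auto simp: holomorphic_series_def)
  have "taylor c (\<lambda>y. fps_nth (F y * G y) n) z
      = (\<Sum>i\<le>n. taylor c (\<lambda>y. fps_nth (F y) i) z * taylor c (\<lambda>y. fps_nth (G y) (n - i)) z)" for n
    using F G unfolding fps_mult_nth atLeast0AtMost holomorphic_series_def
    by (subst taylor_sum[OF hol P]) (auto intro!: sum.cong taylor_mult P)
  then show ?thesis
    using diagonal_mult[of "\<lambda>i. taylor c (\<lambda>y. fps_nth (F y) i) z" "\<lambda>i. taylor c
        (\<lambda>y. fps_nth (G y) i) z"]
    unfolding shift_def by simp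
qed

text \<open>Two shifts commute because partial derivatives do.\<close>

lemma shift_taylor_commute:
  assumes g: "holomorphic_several g P" and P: "open P" "z \<in> P"
  shows "shift c (taylor a g) z = shift a (taylor c g) z"
proof (rule fps_ext)
  have nth: "fps_nth (shift c (taylor a g) z) k =
     (\<Sum>n\<le>k. (- 1) ^ k / (fact n * fact (k - n)) * (partial c ^^ (k - n)) ((partial a ^^ n) g) z)"
         for k a c
  proof -
    have "fps_nth (taylor c (\<lambda>y. fps_nth (taylor a g y) n) z) m =
        (- 1) ^ (n + m) / (fact n * fact m) * (partial c ^^ m) ((partial a ^^ n) g) z" for n m
    proof -
      have "taylor c (\<lambda>y. fps_nth (taylor a g y) n) z =
         taylor c (\<lambda>y. (- 1) ^ n / fact n * (partial a ^^ n) g y) z"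
        by (rule taylor_cong[OF P]) (simp add: fps_nth_taylor[OF g P(1)])
      moreover have hol: "holomorphic_several ((partial a ^^ n) g) P"
        by (intro holomorphic_several_partial_funpow g P)
      moreover have "fps_nth (taylor c (\<lambda>y. (- 1) ^ n / fact n * (partial a ^^ n) g y) z) m =
          (- 1) ^ m * ((- 1) ^ n / fact n * (partial c ^^ m) ((partial a ^^ n) g) z) / fact m"
        by (simp only: fps_nth_taylor[OF holomorphic_several_mult[OF holomorphic_several_const hol]
            P]
              partial_funpow_cmult[OF hol P])
      ultimately show ?thesis
        by (simp add: power_add)
    qed
    then show ?thesis unfolding shift_def by simp
  qed
  fix k
  show "fps_nth (shift c (taylor a g) z) k = fps_nth (shift a (taylor c g) z) k"
    unfolding nth
    by (rule sum.reindex_bij_witness[of _ "\<lambda>n. k - n" "\<lambda>n. k - n"])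
       (auto simp: mult.commute partial_funpow_commute[OF g P])
qed

section \<open>The lemma of Poincare for holomorphic 2-forms\<close>

text \<open>The homotopy formula $\eta_b(z) = \int_0^1 t \sum_e (z_e - c_e) F_{eb}(c + t (z - c))\, dt$:
  by closedness, the integrand of $\partial_a \eta_b - \partial_b \eta_a$ is the derivative of
  $t^2 F_{ab}(c + t (z - c))$. The domain is star-shaped about \<open>c\<close>.\<close>

lemma Poincare_two_form:
  fixes F :: "'n::finite \<Rightarrow> 'n \<Rightarrow> complex^'n \<Rightarrow> complex"
  assumes P: "open P" and star: "\<And>z t. z \<in> P \<Longrightarrow> t \<in> {0..1::real} \<Longrightarrow> c + of_real t *s (z - c) \<in> P"
    and hol: "\<And>a b. holomorphic_several (F a b) P"
    and skew: "\<And>a b z. z \<in> P \<Longrightarrow> F b a z = - F a b z"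
    and closed: "\<And>a b e z. z \<in> P \<Longrightarrow> partial a (F b e) z + partial b (F e a) z
        + partial e (F a b) z = 0"
  obtains \<eta> where "\<And>a. holomorphic_several (\<eta> a) P"
    and "\<And>a b z. z \<in> P \<Longrightarrow> partial a (\<eta> b) z - partial b (\<eta> a) z = F a b z"
proof -
  define Y where "Y = (\<lambda>t::real. \<lambda>z. c + of_real t *s (z - c))"
  define K where "K = (\<lambda>b t z. of_real t * (\<Sum>e\<in>UNIV. (z $ e - c $ e) * F e b (Y t z)))"
  define \<eta> where "\<eta> = (\<lambda>b z. integral {0..1} (\<lambda>t. K b t z))"
  have Y: "Y t z \<in> P" if "z \<in> P" "t \<in> {0..1}" for t z
    using star[OF that] by (simp add: Y_def)
  have YD: "(Y t has_derivative (\<lambda>w. of_real t *s w)) (at z)" for t z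
  proof -
    have "bounded_linear (\<lambda>w::complex^'n. of_real t *s w)"
      by (rule bounded_linear_intro[of _ "\<bar>t\<bar>"])
         (simp_all add: vector_add_ldistrib norm_vector_smult vec_eq_iff mult_ac)
    from bounded_linear_imp_has_derivative[OF this] show ?thesis
      unfolding Y_def
      by (auto intro!: derivative_eq_intros has_derivative_compose[of "\<lambda>z. z - c" "\<lambda>w.
          w" _ _ "\<lambda>w. of_real t *s w"])
  qed
  have comp: "holomorphic_several (\<lambda>z. f (Y t z)) P"
    "z \<in> P \<Longrightarrow> partial a (\<lambda>z. f (Y t z)) z = of_real t * partial a f (Y t z)"
    if f: "holomorphic_several f P" and t: "t \<in> {0..1}" for f t a z
  proof -
    have D: "((\<lambda>z. f (Y t z)) has_derivative (\<lambda>w. of_real t * cderiv f (Y t z) w))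
        (at z)" if z: "z \<in> P" for z
      using has_derivative_compose[OF YD holomorphic_several_cderiv(1)[OF f Y[OF z t]]]
      by (simp add: holomorphic_several_cderiv(2)[OF f Y[OF z t]])
    show h: "holomorphic_several (\<lambda>z. f (Y t z)) P"
      unfolding holomorphic_several_def
    proof (intro ballI exI conjI allI)
      fix z assume z: "z \<in> P"
      show "((\<lambda>z. f (Y t z)) has_derivative (\<lambda>w. of_real t * cderiv f (Y t z) w)) (at z)"
        by (rule D[OF z])
      show "of_real t * cderiv f (Y t z) (k *s w) = k * (of_real t * cderiv f (Y t z) w)" for k w
        by (simp add: holomorphic_several_cderiv(2)[OF f Y[OF z t]])
    qed
    show "partial a (\<lambda>z. f (Y t z)) z = of_real t * partial a f (Y t z)" if z: "z \<in> P"
      using frechet_derivative_at[OF D[OF z]]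
      by (simp add: partial_eq_cderiv[OF h z] partial_eq_cderiv[OF f Y[OF z t]] cderiv_def
          fun_eq_iff)
  qed
  have Khol: "holomorphic_several (K b t) P" if "t \<in> {0..1}" for b t
    unfolding K_def
    by (intro holomorphic_several_mult holomorphic_several_sum holomorphic_several_diff
        holomorphic_several_const holomorphic_several_coordinate comp hol that)
  have Kcont: "continuous_on ({0..1} \<times> P) (\<lambda>(t, z). K b t z)" for b
  proof -
    have Yc: "continuous_on ({0..1} \<times> P) (\<lambda>x. Y (fst x) (snd x))"
    proof -
      have "continuous_on ({0..1} \<times> P) (\<lambda>x. \<chi> i. c $ i + of_real (fst x) * (snd x $ i - c $ i))"
        by (intro continuous_intros)
      moreover have "(\<lambda>x. \<chi> i. c $ i + of_real (fst x) * (snd x $ i - c $ i))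
          = (\<lambda>x. Y (fst x) (snd x))"
        unfolding Y_def vec_eq_iff fun_eq_iff by (simp add: algebra_simps)
      ultimately show ?thesis by (simp only:)
    qed
    have "continuous_on ({0..1} \<times> P) (\<lambda>x. F e b (Y (fst x) (snd x)))" for e
      by (rule continuous_on_compose2[OF holomorphic_several_continuous_on[OF hol] Yc])
          (auto simp: Y)
    then show ?thesis
      unfolding K_def case_prod_unfold by (intro continuous_intros)
  qed
  have G1: "holomorphic_several (\<eta> b) P" for b
    unfolding \<eta>_def by (rule holomorphic_several_integral(1)[OF P Kcont]) (rule Khol)
  have G2: "((\<lambda>t. partial a (K b t) z) has_integral partial a (\<eta> b) z) {0..1}" if z: "z \<in> P"
      for a b z
    using holomorphic_several_integral(2,3)[OF P Kcont Khol z, of a b]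
    by (auto simp: \<eta>_def dest: integrable_integral)
  have Kpartial: "partial a (K b t) z = of_real t * (F a b (Y t z)
      + of_real t * (\<Sum>e\<in>UNIV. (z $ e - c $ e) * partial a (F e b) (Y t z)))"
    if z: "z \<in> P" and t: "t \<in> {0..1}" for a b t z
  proof -
    have "((\<lambda>\<tau>. K b t (z + \<tau> *s axis a 1)) has_field_derivative
       of_real t * (\<Sum>e\<in>UNIV. (z $ e - c $ e) * (of_real t * partial a (F e b) (Y t z))
          + (if e = a then 1 else 0) * F e b (Y t z))) (at 0)"
      unfolding K_def
    proof (intro DERIV_cmult DERIV_sum)
      fix e
      have "((\<lambda>\<tau>. F e b (Y t (z + \<tau> *s axis a 1))) has_field_derivative of_real t * partial
          a (F e b) (Y t z)) (at 0)"
        using partial_field_derivative[OF comp(1)[OF hol t], of z 0 a] z comp(2)[OF hol t z] by simp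
      then show "((\<lambda>\<tau>. ((z + \<tau> *s axis a 1) $ e - c $ e) * F e b (Y t (z + \<tau> *s axis a 1)))
          has_field_derivative
           (z $ e - c $ e) * (of_real t * partial a (F e b) (Y t z))
          + (if e = a then 1 else 0) * F e b (Y t z)) (at 0)"
        by (auto intro!: derivative_eq_intros simp: axis_def)
    qed
    then have "partial a (K b t) z = of_real t * (\<Sum>e\<in>UNIV. (z $ e - c $ e)
        * (of_real t * partial a (F e b) (Y t z))
          + (if e = a then F e b (Y t z) else 0))"
      by (simp add: partial_def DERIV_imp_deriv if_distrib[of "\<lambda>x. x * _"] cong: if_cong)
    moreover have "(\<Sum>e\<in>UNIV. (z $ e - c $ e) * (of_real t * partial a (F e b) (Y t z))
          + (if e = a then F e b (Y t z) else 0))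
        = F a b (Y t z) + of_real t * (\<Sum>e\<in>UNIV. (z $ e - c $ e) * partial a (F e b) (Y t z))"
      by (simp add: sum.distrib sum_distrib_left mult.left_commute add.commute)
    ultimately show ?thesis by (simp only:)
  qed
  have main: "partial a (\<eta> b) z - partial b (\<eta> a) z = F a b z" if z: "z \<in> P" for a b z
  proof -
    define \<Phi> where "\<Phi> = (\<lambda>s. s ^ 2 * F a b (c + s *s (z - c)))"
    have deriv: "((\<lambda>t. \<Phi> (of_real t)) has_vector_derivative (partial a (K b t) z - partial b (K a t)
        z)) (at t within {0..1})"
      if t: "t \<in> {0..1}" for t
    proof -
      have D\<Phi>: "(\<Phi> has_field_derivative of_real t ^ 2 * cderiv (F a b) (Y t z) (z - c)
          + 2 * of_real t * F a b (Y t z)) (at (of_real t))"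
        using holomorphic_several_line_derivative[OF hol, of c "of_real t" "z - c" a b] Y[OF z t]
        unfolding \<Phi>_def Y_def by (auto intro!: derivative_eq_intros)
      have closed': "partial a (F e b) y - partial b (F e a) y
          = partial e (F a b) y" if y: "y \<in> P" for e y
      proof -
        have pskew: "partial k (F j i) y = - partial k (F i j) y" for i j k
        proof -
          have "partial k (F j i) y = partial k (\<lambda>y. - 1 * F i j y) y"
            by (rule partial_cong[OF P y]) (simp add: skew[of _ j i])
          then show ?thesis by (simp only: partial_cmult[OF hol y]) simp
        qed
        show ?thesis
          using closed[OF y, of a e b] pskew[of b a e] pskew[of e b a] by (simp add: algebra_simps)
      qed
      have "(\<Sum>e\<in>UNIV. (z $ e - c $ e) * partial a (F e b) (Y t z)) - (\<Sum>e\<in>UNIV. (z $ e - c $ e)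
          * partial b (F e a) (Y t z))
         = (\<Sum>e\<in>UNIV. (z - c) $ e * (partial a (F e b) (Y t z) - partial b (F e a) (Y t z)))"
        by (simp add: sum_subtractf right_diff_distrib)
      also have "\<dots> = cderiv (F a b) (Y t z) (z - c)"
        by (simp only: closed'[OF Y[OF z t]] cderiv_partials[OF hol Y[OF z t]])
      finally have S: "(\<Sum>e\<in>UNIV. (z $ e - c $ e) * partial a (F e b) (Y t z))
         = cderiv (F a b) (Y t z) (z - c) + (\<Sum>e\<in>UNIV. (z $ e - c $ e) * partial b (F e a) (Y t z))"
        by (simp only: diff_eq_eq)
      have "partial a (K b t) z - partial b (K a t) z
          = of_real t ^ 2 * cderiv (F a b) (Y t z) (z - c) + 2 * of_real t * F a b (Y t z)"
        unfolding Kpartial[OF z t] skew[OF Y[OF z t], of a b] S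
        by (simp only: power2_eq_square) algebra
      then have "(\<Phi> has_field_derivative partial a (K b t) z - partial b (K a t) z)
          (at (of_real t))"
        using D\<Phi> by (simp only:)
      then show ?thesis
        by (rule has_vector_derivative_real_field)
    qed
    have "((\<lambda>t. partial a (K b t) z - partial b (K a t) z) has_integral (\<Phi> (of_real 1)
        - \<Phi> (of_real 0))) {0..1}"
      by (rule fundamental_theorem_of_calculus) (use deriv in auto)
    moreover have "((\<lambda>t. partial a (K b t) z - partial b (K a t) z) has_integral
         (partial a (\<eta> b) z - partial b (\<eta> a) z)) {0..1}"
      by (intro has_integral_diff G2 z)
    ultimately have "partial a (\<eta> b) z - partial b (\<eta> a) z = \<Phi> 1 - \<Phi> 0"
      by (auto dest: has_integral_unique)
    then show ?thesis by (simp add: \<Phi>_def)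
  qed
  show ?thesis
    using G1 main by (rule that)
qed

section \<open>Entries of operators on tensor powers\<close>

lemma koszul_0: "koszul 0 = 1"
  by (simp add: koszul_def)

lemma koszul_square: "koszul q * koszul q = 1"
  by (simp add: koszul_def)

lemma bit_double: "(q::bit) + q = 0"
  by (cases q) simp_all

text \<open>Sums over matrix units collapse to one term. This turns the linear extensions that define
  the placed operators, the twist and the alternation into explicit matrix entries with explicit
  signs.\<close>

lemma linear_ext2_entry:
  "linear_ext2 p F M $ s $ t = (\<Sum>i\<in>UNIV. \<Sum>k\<in>UNIV. \<Sum>j\<in>UNIV. \<Sum>l\<in>UNIV.
     koszul ((p j + p l) * p k) * M $ (i, j) $ (k, l) * F i k j l $ s $ t)"
  by (simp add: linear_ext2_def scale_mat_def)

lemma collapse_matrix_units2: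
  fixes G :: "'n::finite \<Rightarrow> 'n \<Rightarrow> 'n \<Rightarrow> 'n \<Rightarrow> 'a::comm_ring_1"
  shows "(\<Sum>i\<in>UNIV. \<Sum>k\<in>UNIV. \<Sum>j\<in>UNIV. \<Sum>l\<in>UNIV.
      G i k j l * (e * (matrix_unit i k $ y $ z * matrix_unit j l $ u $ w))) = e * G y z u w"
proof -
  have "(\<Sum>i\<in>UNIV. \<Sum>k\<in>UNIV. \<Sum>j\<in>UNIV. \<Sum>l\<in>UNIV.
      G i k j l * (e * (matrix_unit i k $ y $ z * matrix_unit j l $ u $ w))) =
    (\<Sum>i\<in>UNIV. \<Sum>k\<in>UNIV. (\<Sum>j\<in>UNIV. \<Sum>l\<in>UNIV.
      (G i k j l * e) * matrix_unit j l $ u $ w) * matrix_unit i k $ y $ z)"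
    by (simp add: sum_distrib_left sum_distrib_right mult_ac)
  then show ?thesis
    by (simp add: sum_matrix_unit)
qed

lemma collapse_matrix_units3:
  fixes G :: "'n::finite \<Rightarrow> 'n \<Rightarrow> 'n \<Rightarrow> 'n \<Rightarrow> 'n \<Rightarrow> 'n \<Rightarrow> 'a::comm_ring_1"
  shows "(\<Sum>i\<in>UNIV. \<Sum>l\<in>UNIV. \<Sum>j\<in>UNIV. \<Sum>m\<in>UNIV. \<Sum>k\<in>UNIV. \<Sum>n\<in>UNIV.
      G i l j m k n * (matrix_unit i l $ y $ z * (matrix_unit j m $ u $ w
          * matrix_unit k n $ q $ r)))
      = G y z u w q r"
proof -
  have "(\<Sum>i\<in>UNIV. \<Sum>l\<in>UNIV. \<Sum>j\<in>UNIV. \<Sum>m\<in>UNIV. \<Sum>k\<in>UNIV. \<Sum>n\<in>UNIV.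
      G i l j m k n * (matrix_unit i l $ y $ z * (matrix_unit j m $ u $ w
          * matrix_unit k n $ q $ r))) =
    (\<Sum>i\<in>UNIV. \<Sum>l\<in>UNIV. (\<Sum>j\<in>UNIV. \<Sum>m\<in>UNIV. (\<Sum>k\<in>UNIV. \<Sum>n\<in>UNIV.
      G i l j m k n * matrix_unit k n $ q $ r) * matrix_unit j m $ u $ w)
          * matrix_unit i l $ y $ z)"
    by (simp add: sum_distrib_left sum_distrib_right mult_ac)
  then show ?thesis
    by (simp add: sum_matrix_unit)
qed

lemma tensor3_nth: "tensor3 p a b c $ (i, j, k) $ (l, m, n) =
    koszul ((p j + p m) * p l + (p k + p n) * (p l + p m)) * (a $ i $ l * (b $ j $ m * c $ k $ n))"
  by (simp add: tensor3_def mult_ac)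

lemma tensor2_nth: "tensor2 p a b $ (i, j) $ (k, l) =
    koszul ((p j + p l) * p k) * (a $ i $ k * b $ j $ l)"
  by (simp add: tensor2_def mult_ac)

lemma mat_1_nth: "(mat 1 :: 'a::comm_ring_1^'n^'n) $ i $ j = (if i = j then 1 else 0)"
  by (simp add: mat_def)

lemma place12_nth: "place12 p M $ (i, j, k) $ (l, m, n)
    = (if k = n then M $ (i, j) $ (l, m) else 0)"
proof -
  have "place12 p M $ (i, j, k) $ (l, m, n) = (\<Sum>i'\<in>UNIV. \<Sum>k'\<in>UNIV. \<Sum>j'\<in>UNIV. \<Sum>l'\<in>UNIV.
     (koszul ((p j' + p l') * p k') * M $ (i', j') $ (k', l')) *
      ((koszul ((p j + p m) * p l + (p k + p n) * (p l + p m)) * mat 1 $ k $ n)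
         * (matrix_unit i' k' $ i $ l * matrix_unit j' l' $ j $ m)))"
    unfolding place12_def linear_ext2_entry tensor3_nth by (simp only: mult_ac)
  also have "\<dots> = (koszul ((p j + p m) * p l + (p k + p n) * (p l + p m))
      * koszul ((p j + p m) * p l))
       * mat 1 $ k $ n * M $ (i, j) $ (l, m)"
    unfolding collapse_matrix_units2 by (simp only: mult_ac)
  finally show ?thesis
    by (cases "p j"; cases "p l"; cases "p m"; cases "p n") (auto simp: mat_1_nth koszul_def)
qed

lemma place13_nth: "place13 p M $ (i, j, k) $ (l, m, n) =
  (if j = m then koszul ((p k + p n) * p j) * M $ (i, k) $ (l, n) else 0)"
proof -
  have "place13 p M $ (i, j, k) $ (l, m, n) = (\<Sum>i'\<in>UNIV. \<Sum>k'\<in>UNIV. \<Sum>j'\<in>UNIV. \<Sum>l'\<in>UNIV.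
     (koszul ((p j' + p l') * p k') * M $ (i', j') $ (k', l')) *
      ((koszul ((p j + p m) * p l + (p k + p n) * (p l + p m)) * mat 1 $ j $ m)
         * (matrix_unit i' k' $ i $ l * matrix_unit j' l' $ k $ n)))"
    unfolding place13_def linear_ext2_entry tensor3_nth by (simp only: mult_ac)
  also have "\<dots> = (koszul ((p j + p m) * p l + (p k + p n) * (p l + p m))
      * koszul ((p k + p n) * p l))
       * mat 1 $ j $ m * M $ (i, k) $ (l, n)"
    unfolding collapse_matrix_units2 by (simp only: mult_ac)
  finally show ?thesis
    by (cases "p j"; cases "p k"; cases "p l"; cases "p n") (auto simp: mat_1_nth koszul_def)
qed

lemma tensor12_nth: "tensor12 p a M $ (i, j, k) $ (l, m, n) =
  koszul ((p j + p m + p k + p n) * p l) * a $ i $ l * M $ (j, k) $ (m, n)"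
proof -
  have "tensor12 p a M $ (i, j, k) $ (l, m, n) = (\<Sum>i'\<in>UNIV. \<Sum>k'\<in>UNIV. \<Sum>j'\<in>UNIV. \<Sum>l'\<in>UNIV.
     (koszul ((p j' + p l') * p k') * M $ (i', j') $ (k', l')) *
      ((koszul ((p j + p m) * p l + (p k + p n) * (p l + p m)) * a $ i $ l)
         * (matrix_unit i' k' $ j $ m * matrix_unit j' l' $ k $ n)))"
    unfolding tensor12_def linear_ext2_entry tensor3_nth by (simp only: mult_ac)
  also have "\<dots> = (koszul ((p j + p m) * p l + (p k + p n) * (p l + p m))
      * koszul ((p k + p n) * p m))
       * a $ i $ l * M $ (j, k) $ (m, n)"
    unfolding collapse_matrix_units2 by (simp only: mult_ac)
  also have "koszul ((p j + p m) * p l + (p k + p n) * (p l + p m)) * koszul ((p k + p n) * p m)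
      = (koszul ((p j + p m + p k + p n) * p l) :: 'a)"
    by (cases "p j"; cases "p k"; cases "p l"; cases "p n"; cases "p m") (simp_all add: koszul_def)
  finally show ?thesis .
qed

lemma place23_nth: "place23 p M $ (i, j, k) $ (l, m, n) =
  (if i = l then koszul ((p j + p m + p k + p n) * p i) * M $ (j, k) $ (m, n) else 0)"
  using tensor12_nth[of p "mat 1" M i j k l m n] by (simp add: place23_def tensor12_def mat_1_nth)

lemma super_twist_nth: "super_twist p M $ (i, j) $ (k, l) =
  koszul ((p i + p k) * p l + (p j + p l) * p i) * M $ (j, i) $ (l, k)"
proof -
  have "super_twist p M $ (i, j) $ (k, l) = (\<Sum>i'\<in>UNIV. \<Sum>k'\<in>UNIV. \<Sum>j'\<in>UNIV. \<Sum>l'\<in>UNIV.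
     (koszul ((p j' + p l') * p k') * M $ (i', j') $ (k', l') * koszul ((p i'
         + p k') * (p j' + p l'))) *
      (koszul ((p j + p l) * p k) * (matrix_unit i' k' $ j $ l * matrix_unit j' l' $ i $ k)))"
    unfolding super_twist_def linear_ext2_entry scale_mat_def
    by (simp add: tensor2_nth mult_ac)
  also have "\<dots> = (koszul ((p i + p k) * p l) * koszul ((p j + p l) * (p i + p k))
      * koszul ((p j + p l) * p k))
       * M $ (j, i) $ (l, k)"
    unfolding collapse_matrix_units2 by (simp only: mult_ac)
  also have "koszul ((p i + p k) * p l) * koszul ((p j + p l) * (p i + p k))
      * koszul ((p j + p l) * p k)
      = (koszul ((p i + p k) * p l + (p j + p l) * p i) :: 'a)"
    by (cases "p i"; cases "p j"; cases "p k"; cases "p l") (simp_all add: koszul_def)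
  finally show ?thesis .
qed

lemma super_alt_nth:
  "super_alt p M $ (i, j, k) $ (l, m, n) = M $ (i, j, k) $ (l, m, n)
    + koszul ((p k + p n) * (p i + p j) + (p i + p j + p l + p m) * p n) * M $ (k, i, j) $ (n, l, m)
    + koszul ((p i + p l) * (p j + p k) + (p j + p k + p m + p n) * p l)
        * M $ (j, k, i) $ (m, n, l)"
proof -
  define S where "S = (\<lambda>j k l m n. koszul ((p j + p m) * p l + (p k + p n) * (p l + p m)) :: 'a)"
  define e where "e = S j k l m n"
  have "super_alt p M $ (i, j, k) $ (l, m, n) =
     (\<Sum>i'\<in>UNIV. \<Sum>l'\<in>UNIV. \<Sum>j'\<in>UNIV. \<Sum>m'\<in>UNIV. \<Sum>k'\<in>UNIV. \<Sum>n'\<in>UNIV.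
       (S j' k' l' m' n' * M $ (i', j', k') $ (l', m', n')) *
       (e * (matrix_unit i' l' $ i $ l * (matrix_unit j' m' $ j $ m * matrix_unit k' n' $ k $ n))
        + koszul ((p i' + p l') * (p j' + p m' + (p k' + p n')))
            * (e * (matrix_unit i' l' $ k $ n * (matrix_unit j' m' $ i $ l
                * matrix_unit k' n' $ j $ m)))
        + koszul ((p k' + p n') * (p i' + p l' + (p j' + p m')))
            * (e * (matrix_unit i' l' $ j $ m * (matrix_unit j' m' $ k $ n
                * matrix_unit k' n' $ i $ l)))))"
    unfolding super_alt_def linear_ext3_def S_def e_def Let_def scale_mat_def
    by (simp add: tensor3_nth mult_ac)
  also have "\<dots> =
     (\<Sum>i'\<in>UNIV. \<Sum>l'\<in>UNIV. \<Sum>j'\<in>UNIV. \<Sum>m'\<in>UNIV. \<Sum>k'\<in>UNIV. \<Sum>n'\<in>UNIV.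
       (S j' k' l' m' n' * M $ (i', j', k') $ (l', m', n') * e) *
         (matrix_unit i' l' $ i $ l * (matrix_unit j' m' $ j $ m * matrix_unit k' n' $ k $ n)))
   + (\<Sum>i'\<in>UNIV. \<Sum>l'\<in>UNIV. \<Sum>j'\<in>UNIV. \<Sum>m'\<in>UNIV. \<Sum>k'\<in>UNIV. \<Sum>n'\<in>UNIV.
       (S j' k' l' m' n' * M $ (i', j', k') $ (l', m', n') * koszul ((p i' + p l') * (p j'
           + p m' + (p k' + p n'))) * e) *
         (matrix_unit i' l' $ k $ n * (matrix_unit j' m' $ i $ l * matrix_unit k' n' $ j $ m)))
   + (\<Sum>i'\<in>UNIV. \<Sum>l'\<in>UNIV. \<Sum>j'\<in>UNIV. \<Sum>m'\<in>UNIV. \<Sum>k'\<in>UNIV. \<Sum>n'\<in>UNIV.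
       (S j' k' l' m' n' * M $ (i', j', k') $ (l', m', n') * koszul ((p k' + p n') * (p i'
           + p l' + (p j' + p m'))) * e) *
         (matrix_unit i' l' $ j $ m * (matrix_unit j' m' $ k $ n * matrix_unit k' n' $ i $ l)))"
    unfolding distrib_left sum.distrib by (simp only: mult_ac)
  also have "\<dots> = S j k l m n * M $ (i, j, k) $ (l, m, n) * e
    + S i j n l m * M $ (k, i, j) $ (n, l, m) * koszul ((p k + p n) * (p i + p l + (p j + p m))) * e
    + S k i m n l * M $ (j, k, i) $ (m, n, l) * koszul ((p i + p l) * (p j + p m + (p k + p n)))
        * e"
    unfolding collapse_matrix_units3 ..
  also have "\<dots> = (S j k l m n * e) * M $ (i, j, k) $ (l, m, n)
    + (S i j n l m * koszul ((p k + p n) * (p i + p l + (p j + p m))) * e)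
        * M $ (k, i, j) $ (n, l, m)
    + (S k i m n l * koszul ((p i + p l) * (p j + p m + (p k + p n))) * e)
        * M $ (j, k, i) $ (m, n, l)"
    by (simp only: mult_ac)
  also have "S j k l m n * e = 1"
    by (simp add: S_def e_def koszul_square)
  also have "S i j n l m * koszul ((p k + p n) * (p i + p l + (p j + p m))) * e
     = koszul ((p k + p n) * (p i + p j) + (p i + p j + p l + p m) * p n)"
    unfolding S_def e_def
    by (cases "p i"; cases "p j"; cases "p k"; cases "p l"; cases "p m"; cases "p n")
        (simp_all add: koszul_def)
  also have "S k i m n l * koszul ((p i + p l) * (p j + p m + (p k + p n))) * e
     = koszul ((p i + p l) * (p j + p k) + (p j + p k + p m + p n) * p l)"
    unfolding S_def e_def
    by (cases "p i"; cases "p j"; cases "p k"; cases "p l"; cases "p m"; cases "p n")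
        (simp_all add: koszul_def)
  finally show ?thesis by simp
qed

text \<open>The operators of weight zero: the weight of $v_i \otimes v_j$ determines the unordered pair
  of \<open>i\<close> and \<open>j\<close>, so such an operator has only diagonal entries and entries that exchange the two
  indices. For \<open>i = j\<close> both kinds coincide and \<open>A i i\<close> is the entry; throughout, \<open>B i i = 0\<close>,
  which makes the action on rows given by one formula for all indices.\<close>

definition swap_form :: "('n::finite \<Rightarrow> 'n \<Rightarrow> 'a::comm_ring_1) \<Rightarrow> ('n \<Rightarrow> 'n \<Rightarrow> 'a) \<Rightarrow>
    'a^('n\<times>'n)^('n\<times>'n)" where
  "swap_form A B = (\<chi> s t. case s of (i, j) \<Rightarrow> case t of (k, l) \<Rightarrow>
     if i = k \<and> j = l then A i j else if i = l \<and> j = k then B i j else 0)"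

lemma swap_form_nth: "swap_form A B $ (i, j) $ (k, l) =
   (if i = k \<and> j = l then A i j else if i = l \<and> j = k then B i j else 0)"
  by (simp add: swap_form_def)

lemma matrix_mult_two_entries:
  fixes M :: "'a::comm_ring_1^'m::finite^'m"
  assumes "\<And>w. M $ s $ w = (if w = u then a else 0) + (if w = v then b else 0)"
  shows "(M ** X) $ s $ t = a * X $ u $ t + b * X $ v $ t"
proof -
  have "(M ** X) $ s $ t = (\<Sum>w\<in>UNIV. (if w = u then a * X $ u $ t else 0)
      + (if w = v then b * X $ v $ t else 0))"
    unfolding matrix_matrix_mult_def by (auto simp: assms distrib_right intro!: sum.cong)
  then show ?thesis by (simp add: sum.distrib)
qed

lemma
  fixes A B :: "'n::finite \<Rightarrow> 'n \<Rightarrow> 'a::comm_ring_1"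
  assumes B: "\<And>i. B i i = 0"
  shows place12_swap_form_mult: "(place12 p (swap_form A B) ** X) $ (i, j, k) $ t =
      A i j * X $ (i, j, k) $ t + B i j * X $ (j, i, k) $ t"
    and place13_swap_form_mult: "(place13 p (swap_form A B) ** X) $ (i, j, k) $ t =
      A i k * X $ (i, j, k) $ t + koszul ((p i + p k) * p j) * B i k * X $ (k, j, i) $ t"
    and place23_swap_form_mult: "(place23 p (swap_form A B) ** X) $ (i, j, k) $ t =
      A j k * X $ (i, j, k) $ t + B j k * X $ (i, k, j) $ t"
proof -
  show "(place12 p (swap_form A B) ** X) $ (i, j, k) $ t =
      A i j * X $ (i, j, k) $ t + B i j * X $ (j, i, k) $ t"
  proof (rule matrix_mult_two_entries)
    fix w :: "'n \<times> 'n \<times> 'n"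
    obtain l m n where w: "w = (l, m, n)" by (cases w)
    show "place12 p (swap_form A B) $ (i, j, k) $ w =
         (if w = (i, j, k) then A i j else 0) + (if w = (j, i, k) then B i j else 0)"
      unfolding w place12_nth swap_form_nth
      by (cases "i = j"; cases "k = n"; cases "i = l"; cases "j = m"; simp add: B)
  qed
  define K :: "'n \<Rightarrow> 'a" where "K n = koszul ((p k + p n) * p j)" for n
  have K: "K k = 1" "K i = koszul ((p i + p k) * p j)"
    unfolding K_def bit_double by (simp_all only: add.commute mult_zero_left koszul_0)
  show "(place13 p (swap_form A B) ** X) $ (i, j, k) $ t =
      A i k * X $ (i, j, k) $ t + koszul ((p i + p k) * p j) * B i k * X $ (k, j, i) $ t"
    unfolding K(2)[symmetric]
  proof (rule matrix_mult_two_entries)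
    fix w :: "'n \<times> 'n \<times> 'n"
    obtain l m n where w: "w = (l, m, n)" by (cases w)
    show "place13 p (swap_form A B) $ (i, j, k) $ w =
         (if w = (i, j, k) then A i k else 0) + (if w = (k, j, i) then K i * B i k else 0)"
      unfolding w place13_nth swap_form_nth K_def[symmetric]
      using K(1) by (cases "i = k"; cases "j = m"; cases "i = l"; cases "k = n"; simp add: B)
  qed
  define K' :: "'n \<Rightarrow> 'n \<Rightarrow> 'a" where "K' m n = koszul ((p j + p m + p k + p n) * p i)" for m n
  have K': "K' j k = 1" "K' k j = 1"
    unfolding K'_def by (cases "p j"; cases "p k"; simp add: koszul_def)+
  show "(place23 p (swap_form A B) ** X) $ (i, j, k) $ t =
      A j k * X $ (i, j, k) $ t + B j k * X $ (i, k, j) $ t"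
  proof (rule matrix_mult_two_entries)
    fix w :: "'n \<times> 'n \<times> 'n"
    obtain l m n where w: "w = (l, m, n)" by (cases w)
    show "place23 p (swap_form A B) $ (i, j, k) $ w =
         (if w = (i, j, k) then A j k else 0) + (if w = (i, k, j) then B j k else 0)"
      unfolding w place23_nth swap_form_nth K'_def[symmetric]
      using K' by (cases "j = k"; cases "i = l"; cases "j = m"; cases "k = n"; simp add: B)
  qed
qed

lemma tensor3_projection_mult:
  "(tensor3 p (matrix_unit c c) (mat 1) (mat 1) ** X) $ (i, j, k) $ t
      = (if i = c then X $ (i, j, k) $ t else 0)"
  "(tensor3 p (mat 1) (matrix_unit c c) (mat 1) ** X) $ (i, j, k) $ t
      = (if j = c then X $ (i, j, k) $ t else 0)"
  "(tensor3 p (mat 1) (mat 1) (matrix_unit c c) ** X) $ (i, j, k) $ t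
      = (if k = c then X $ (i, j, k) $ t else 0)"
proof -
  have diag: "(M ** X) $ (i, j, k) $ t = (if Q then X $ (i, j, k) $ t else 0)"
    if "\<And>l m n. M $ (i, j, k) $ (l, m, n) = (if (l, m, n) = (i, j, k) \<and> Q then 1 else 0)" for M
        and Q
  proof -
    have "(M ** X) $ (i, j, k) $ t = (if Q then 1 else 0) * X $ (i, j, k) $ t
        + 0 * X $ (i, j, k) $ t"
    proof (rule matrix_mult_two_entries)
      fix w show "M $ (i, j, k) $ w
          = (if w = (i, j, k) then if Q then 1 else 0 else 0) + (if w = (i, j, k) then 0 else 0)"
        by (cases w) (simp add: that)
    qed
    then show ?thesis by simp
  qed
  show "(tensor3 p (matrix_unit c c) (mat 1) (mat 1) ** X) $ (i, j, k) $ t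
      = (if i = c then X $ (i, j, k) $ t else 0)"
    by (rule diag) (auto simp: tensor3_nth mat_1_nth matrix_unit_def koszul_def)
  show "(tensor3 p (mat 1) (matrix_unit c c) (mat 1) ** X) $ (i, j, k) $ t
      = (if j = c then X $ (i, j, k) $ t else 0)"
    by (rule diag) (auto simp: tensor3_nth mat_1_nth matrix_unit_def koszul_def)
  show "(tensor3 p (mat 1) (mat 1) (matrix_unit c c) ** X) $ (i, j, k) $ t
      = (if k = c then X $ (i, j, k) $ t else 0)"
    by (rule diag) (auto simp: tensor3_nth mat_1_nth matrix_unit_def koszul_def)
qed

lemma sum_matrix_mult_nth:
  fixes M :: "'c \<Rightarrow> 'a::comm_ring_1^'m::finite^'m"
  shows "((\<Sum>c\<in>C. M c) ** X) $ s $ t = (\<Sum>c\<in>C. (M c ** X) $ s $ t)"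
proof -
  have "((\<Sum>c\<in>C. M c) ** X) $ s $ t = (\<Sum>u\<in>UNIV. \<Sum>c\<in>C. M c $ s $ u * X $ u $ t)"
    by (simp add: matrix_matrix_mult_def sum_distrib_right)
  also have "\<dots> = (\<Sum>c\<in>C. (M c ** X) $ s $ t)"
    by (subst sum.swap) (simp add: matrix_matrix_mult_def)
  finally show ?thesis .
qed

lemma sum_projection:
  fixes A B :: "'n::finite \<Rightarrow> 'a::comm_ring_1"
  shows "(\<Sum>c\<in>UNIV. A c * (if k = c then y else 0) + B c * (if k = c then z else 0))
    = A k * y + B k * z"
  by (simp add: sum.distrib if_distrib[of "(*) _"] cong: if_cong)

text \<open>The projection picks out of the sum over the weights the one of the component that causes
  the shift, which is an index of the row.\<close>

lemma
  fixes A B :: "'n::finite \<Rightarrow> 'n \<Rightarrow> 'n \<Rightarrow> 'a::comm_ring_1"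
  assumes B: "\<And>c i. B c i i = 0"
  shows place12_shifted_mult:
    "((\<Sum>c\<in>UNIV. place12 p (swap_form (A c) (B c)) ** tensor3 p (mat 1) (mat 1) (matrix_unit c c))
        ** X) $ (i, j, k) $ t =
      A k i j * X $ (i, j, k) $ t + B k i j * X $ (j, i, k) $ t"
    and place13_shifted_mult:
    "((\<Sum>c\<in>UNIV. place13 p (swap_form (A c) (B c)) ** tensor3 p (mat 1) (matrix_unit c c)
        (mat 1)) ** X) $ (i, j, k) $ t =
      A j i k * X $ (i, j, k) $ t + koszul ((p i + p k) * p j) * B j i k * X $ (k, j, i) $ t"
    and place23_shifted_mult:
    "((\<Sum>c\<in>UNIV. place23 p (swap_form (A c) (B c)) ** tensor3 p (matrix_unit c c) (mat 1)
        (mat 1)) ** X) $ (i, j, k) $ t =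
      A i j k * X $ (i, j, k) $ t + B i j k * X $ (i, k, j) $ t"
  unfolding sum_matrix_mult_nth matrix_mul_assoc[symmetric]
    place12_swap_form_mult[OF B] place13_swap_form_mult[OF B] place23_swap_form_mult[OF B]
        tensor3_projection_mult
    sum_projection
  by (rule refl)+

section \<open>The quantum dynamical Yang-Baxter equation for operators of weight zero\<close>

text \<open>Scalar identities that imply the quantum equation. Here \<open>A\<close> and \<open>D\<close> are the coefficients at
  a fixed point, and \<open>As c\<close> and \<open>Ds c\<close> are the coefficients shifted by the weight \<open>c\<close>. The
  exchange entry \<open>B\<close> is \<open>- D\<close> multiplied by the sign of the super transposition; with this
  normalisation all signs disappear when the three indices are distinct, and the only remaining
  trace of the grading is the factor \<open>koszul (p i)\<close> in the law for the shift of \<open>D i j\<close> by \<open>i\<close>.\<close>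

locale dynamical_braid =
  fixes p :: "'n::finite \<Rightarrow> bit" and A D :: "'n \<Rightarrow> 'n \<Rightarrow> 'a::idom" and As Ds :: "'n \<Rightarrow> 'n \<Rightarrow> 'n \<Rightarrow> 'a"
  assumes D_diag: "D i i = 0" "Ds c i i = 0"
    and D_skew: "D j i = - D i j" "Ds c j i = - Ds c i j"
    and D_const: "c \<noteq> i \<Longrightarrow> c \<noteq> j \<Longrightarrow> Ds c i j = D i j"
    and D_step: "i \<noteq> j \<Longrightarrow> Ds i i j = D i j + koszul (p i) * D i j * Ds i i j"
    and D_quad: "i \<noteq> j \<Longrightarrow> j \<noteq> k \<Longrightarrow> i \<noteq> k \<Longrightarrow> D i j * D j k = D i k * (D i j + D j k)"
    and A_diag: "A i i = 1" "As c i i = 1"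
    and A_inv: "A i j * A j i = 1 - D i j ^ 2" "As c i j * As c j i = 1 - Ds c i j ^ 2"
    and A_cocycle: "i \<noteq> j \<Longrightarrow> j \<noteq> k \<Longrightarrow> i \<noteq> k \<Longrightarrow>
      As k i j * A i k * As i j k = A j k * As j i k * A i j"
begin

definition B where "B i j = - (koszul (p i * p j) * D i j)"
definition Bs where "Bs c i j = - (koszul (p i * p j) * Ds c i j)"

lemma B_diag: "B i i = 0" "Bs c i i = 0"
  by (simp_all add: B_def Bs_def D_diag)

text \<open>Row \<open>(i, j, k)\<close> of the two sides of the quantum equation, applied to a column \<open>f\<close>.\<close>

definition lhs where "lhs f i j k =
  As k i j * (A i k * (As i j k * f i j k + Bs i j k * f i k j)
      + koszul ((p i + p k) * p j) * B i k * (As k j i * f k j i + Bs k j i * f k i j))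
  + Bs k i j * (A j k * (As j i k * f j i k + Bs j i k * f j k i)
      + koszul ((p j + p k) * p i) * B j k * (As k i j * f k i j + Bs k i j * f k j i))"

definition rhs where "rhs f i j k =
  A j k * (As j i k * (A i j * f i j k + B i j * f j i k)
      + koszul ((p i + p k) * p j) * Bs j i k * (A k j * f k j i + B k j * f j k i))
  + B j k * (As k i j * (A i k * f i k j + B i k * f k i j)
      + koszul ((p i + p j) * p k) * Bs k i j * (A j k * f j k i + B j k * f k j i))"

lemma koszul_signs:
  "koszul ((q + s) * t) = (koszul (q * t) * koszul (s * t) :: 'a)"
  by (cases q; cases s; cases t) (simp_all add: koszul_def)

lemma koszul_comm: "koszul (q * s) = (koszul (s * q) :: 'a)"
  by (simp add: mult.commute)

text \<open>Comparison of the coefficients of the six permutations of \<open>(i, j, k)\<close>. The identity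
  permutation gives the cocycle law for \<open>A\<close>, the adjacent transpositions are trivial, and the two
  3-cycles and the full reversal follow from the quadratic relation, the reversal together with
  the law for \<open>A i j * A j i\<close>.\<close>

lemma distinct: assumes d: "i \<noteq> j" "j \<noteq> k" "i \<noteq> k" shows "lhs f i j k = rhs f i j k"
proof -
  define x :: 'a where "x = koszul (p i * p j)"
  define y :: 'a where "y = koszul (p i * p k)"
  define z :: 'a where "z = koszul (p j * p k)"
  have sq: "x * x = 1" "y * y = 1" "z * z = 1" by (simp_all add: x_def y_def z_def koszul_square)
  define a where "a = D i j"
  define b where "b = D j k"
  define c where "c = D i k"
  have q: "a * b = c * (a + b)" unfolding a_def b_def c_def by (rule D_quad) (use d in auto)
  have K: "koszul ((p i + p k) * p j) = x * z" "koszul ((p j + p k) * p i) = x * y"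
    "koszul ((p i + p j) * p k) = y * z"
    unfolding koszul_signs x_def y_def z_def by (simp_all only: mult.commute koszul_comm)
  have ko: "koszul (p j * p i) = x" "koszul (p k * p i) = y" "koszul (p k * p j) = z"
    by (simp_all only: x_def y_def z_def mult.commute)
  have Beq: "B i j = - (x * a)" "B j i = x * a" "B j k = - (z * b)" "B k j = z * b"
    "B i k = - (y * c)" "B k i = y * c"
    unfolding B_def D_skew[of j i] D_skew[of k j] D_skew[of k i] ko
    by (simp_all add: x_def y_def z_def a_def b_def c_def)
  have Bseq: "Bs k i j = B i j" "Bs k j i = B j i" "Bs i j k = B j k" "Bs i k j = B k j"
     "Bs j i k = B i k" "Bs j k i = B k i"
    using d by (simp_all add: B_def Bs_def D_const)
  have Ds: "Ds k i j = a" using d by (simp add: a_def D_const)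
  have e1: "As k i j * (A i k * As i j k) = A j k * (As j i k * A i j)"
    using A_cocycle[of i j k] d by (simp add: mult_ac)
  have e2: "As k i j * (A i k * B j k) = B j k * (As k i j * A i k)" by (simp add: mult_ac)
  have e3: "As k i j * (x * z * B i k * As k j i) + B i j * (x * y * B j k * B i j)
     = A j k * (x * z * B i k * A k j) + B j k * (y * z * B i j * B j k)"
  proof -
    have 1: "As k i j * As k j i = 1 - a ^ 2" using A_inv(2)[of k i j] Ds by simp
    have 2: "A j k * A k j = 1 - b ^ 2" using A_inv(1)[of j k] by (simp add: b_def)
    show ?thesis unfolding Beq using 1 2 q sq by algebra
  qed
  have e4: "As k i j * (x * z * B i k * B j i) + B i j * (x * y * B j k * As k i j)
      = B j k * (As k i j * B i k)"
    unfolding Beq using q sq by algebra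
  have e5: "B i j * (A j k * As j i k) = A j k * (As j i k * B i j)" by (simp add: mult_ac)
  have e6: "B i j * (A j k * B i k) = A j k * (x * z * B i k * B k j)
      + B j k * (y * z * B i j * A j k)"
    unfolding Beq using q sq by algebra
  have "lhs f i j k = As k i j * (A i k * As i j k) * f i j k + As k i j * (A i k * B j k) * f i k j
     + (As k i j * (x * z * B i k * As k j i) + B i j * (x * y * B j k * B i j)) * f k j i
     + (As k i j * (x * z * B i k * B j i) + B i j * (x * y * B j k * As k i j)) * f k i j
     + B i j * (A j k * As j i k) * f j i k + B i j * (A j k * B i k) * f j k i"
    unfolding lhs_def Bseq K by (simp add: algebra_simps)
  also have "\<dots> = rhs f i j k"
    unfolding e1 e2 e3 e4 e5 e6 unfolding rhs_def Bseq K by (simp add: algebra_simps)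
  finally show ?thesis .
qed

lemma two_equal_signs:
  "koszul ((q + q) * s) = (1::'a)" "koszul (q * q) = (koszul q::'a)"
  by (cases q; simp add: koszul_def)+

text \<open>When an index occurs twice, the shift by that index does not fix \<open>D\<close>, and the law \<open>D_step\<close>
  is exactly what makes the three coefficients agree.\<close>

lemma repeated_first:
  assumes d: "i \<noteq> j"
  shows "lhs f i i j = rhs f i i j" "lhs f i j i = rhs f i j i" "lhs f j i i = rhs f j i i"
proof -
  define x :: 'a where "x = koszul (p i * p j)"
  define e :: 'a where "e = koszul (p i)"
  define a where "a = D i j"
  define a' where "a' = Ds i i j"
  have sq: "x * x = 1" "e * e = 1" by (simp_all add: x_def e_def koszul_square)
  have st: "a' = a + e * a * a'" unfolding a_def a'_def e_def by (rule D_step[OF d])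
  have K: "koszul ((p i + p j) * p i) = e * x" "koszul ((p j + p i) * p i) = e * x"
    "koszul ((p i + p i) * p j) = (1::'a)" "koszul (p j * p i) = x"
    unfolding koszul_signs two_equal_signs x_def e_def koszul_square
        by (simp_all only: mult.commute koszul_comm)
  have Beq: "B i j = - (x * a)" "B j i = x * a" "Bs i i j = - (x * a')" "Bs i j i = x * a'"
    unfolding B_def Bs_def D_skew[of j i] K
        by (simp_all add: x_def a_def a'_def D_skew(2)[of i j i])
  have inv: "A i j * A j i = 1 - a ^ 2" "As i i j * As i j i = 1 - a' ^ 2"
    using A_inv(1)[of i j] A_inv(2)[of i i j] by (simp_all add: a_def a'_def)
  show "lhs f i i j = rhs f i i j"
    unfolding lhs_def rhs_def B_diag A_diag K Beq using inv st sq by algebra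
  show "lhs f i j i = rhs f i j i"
    unfolding lhs_def rhs_def B_diag A_diag K Beq two_equal_signs using inv st sq by algebra
  show "lhs f j i i = rhs f j i i"
    unfolding lhs_def rhs_def B_diag A_diag K Beq using inv st sq by algebra
qed

lemma lhs_eq_rhs: "lhs f i j k = rhs f i j k"
proof (cases "i = j")
  case True
  show ?thesis
  proof (cases "i = k")
    case True
    with \<open>i = j\<close> show ?thesis by (simp add: lhs_def rhs_def B_diag A_diag)
  next
    case False
    with \<open>i = j\<close> show ?thesis using repeated_first(1) by simp
  qed
next
  case False
  then show ?thesis
    using repeated_first(2)[of i j] repeated_first(3)[of k i] repeated_first(3)[of j i]
        distinct[of i j k]
    by (cases "j = k"; cases "i = k") auto
qed

end

lemma swap_form_mult_nth:
  fixes A B :: "'n::finite \<Rightarrow> 'n \<Rightarrow> 'a::comm_ring_1"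
  assumes B: "\<And>i. B i i = 0"
  shows "(swap_form A B ** X) $ (i, j) $ t = A i j * X $ (i, j) $ t + B i j * X $ (j, i) $ t"
proof (rule matrix_mult_two_entries)
  fix w :: "'n \<times> 'n"
  obtain k l where w: "w = (k, l)" by (cases w)
  show "swap_form A B $ (i, j) $ w = (if w = (i, j) then A i j else 0)
      + (if w = (j, i) then B i j else 0)"
    unfolding w swap_form_nth by (cases "i = j"; cases "i = k"; cases "j = l"; simp add: B)
qed

text \<open>The operator acts on each span of $v_i \otimes v_j$ and $v_j \otimes v_i$ by a matrix of
  determinant 1, whose inverse is the adjugate.\<close>

lemma swap_form_right_inverse:
  fixes A B :: "'n::finite \<Rightarrow> 'n \<Rightarrow> 'a::comm_ring_1"
  assumes B: "\<And>i. B i i = 0" and det: "\<And>i j. A i j * A j i - B i j * B j i = 1"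
  shows "swap_form A B ** swap_form (\<lambda>i j. A j i) (\<lambda>i j. - B i j) = mat 1"
proof -
  have B': "- B i i = 0" for i
    by (simp add: B)
  have "(swap_form A B ** (swap_form (\<lambda>i j. A j i) (\<lambda>i j. - B i j) ** mat 1)) $ (i, j) $ t
      = mat 1 $ (i, j) $ t" for i j t
  proof -
    have "(swap_form A B ** (swap_form (\<lambda>i j. A j i) (\<lambda>i j. - B i j) ** mat 1)) $ (i, j) $ t
      = (A i j * A j i - B i j * B j i) * mat 1 $ (i, j) $ t"
      unfolding swap_form_mult_nth[OF B] swap_form_mult_nth[of "\<lambda>i j. - B i j", OF B']
      by (simp add: algebra_simps)
    then show ?thesis by (simp add: det)
  qed
  then show ?thesis by (simp add: vec_eq_iff split_paired_All)
qed

lemma swap_form_invertible: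
  fixes A B :: "'n::finite \<Rightarrow> 'n \<Rightarrow> 'a::comm_ring_1"
  assumes "\<And>i. B i i = 0" and "\<And>i j. A i j * A j i - B i j * B j i = 1"
  shows "invertible (swap_form A B)"
  unfolding invertible_def
proof (intro exI conjI)
  show "swap_form A B ** swap_form (\<lambda>i j. A j i) (\<lambda>i j. - B i j) = mat 1"
    using assms by (rule swap_form_right_inverse)
  show "swap_form (\<lambda>i j. A j i) (\<lambda>i j. - B i j) ** swap_form A B = mat 1"
    using swap_form_right_inverse[of "\<lambda>i j. - B i j" "\<lambda>i j. A j i"] assms
    by (simp add: mult.commute)
qed

context dynamical_braid begin

lemma matrix_equation:
  "(\<Sum>c\<in>UNIV. place12 p (swap_form (As c) (Bs c)) ** tensor3 p (mat 1) (mat 1) (matrix_unit c c))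
     ** place13 p (swap_form A B)
     ** (\<Sum>c\<in>UNIV. place23 p (swap_form (As c) (Bs c)) ** tensor3 p (matrix_unit c c) (mat 1)
         (mat 1))
   = place23 p (swap_form A B)
     ** (\<Sum>c\<in>UNIV. place13 p (swap_form (As c) (Bs c)) ** tensor3 p (mat 1)
         (matrix_unit c c) (mat 1))
     ** place12 p (swap_form A B)" (is "?L12 ** ?L13 ** ?L23 = ?R23 ** ?R13 ** ?R12")
proof -
  have "(?L12 ** (?L13 ** (?L23 ** mat 1))) $ (i, j, k) $ t = (?R23 ** (?R13 ** (?R12 ** mat 1))) $
      (i, j, k) $ t" for i j k t
  proof -
    define f where "f i j k = (mat 1 :: 'a^('n\<times>'n\<times>'n)^('n\<times>'n\<times>'n)) $ (i, j, k) $ t" for i j k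
    have "(?L12 ** (?L13 ** (?L23 ** mat 1))) $ (i, j, k) $ t = lhs f i j k"
      unfolding place12_shifted_mult[OF B_diag(2)] place13_swap_form_mult[OF B_diag(1)]
          place23_shifted_mult[OF B_diag(2)]
        lhs_def f_def ..
    also have "\<dots> = rhs f i j k"
      by (rule lhs_eq_rhs)
    also have "\<dots> = (?R23 ** (?R13 ** (?R12 ** mat 1))) $ (i, j, k) $ t"
      unfolding place12_swap_form_mult[OF B_diag(1)] place13_shifted_mult[OF B_diag(2)]
          place23_swap_form_mult[OF B_diag(1)]
        rhs_def f_def ..
    finally show ?thesis .
  qed
  then have "?L12 ** (?L13 ** (?L23 ** mat 1)) = ?R23 ** (?R13 ** (?R12 ** mat 1))"
    by (simp only: vec_eq_iff split_paired_All) simp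
  then show ?thesis
    by (simp only: matrix_mul_rid matrix_mul_assoc)
qed

end

context dynamical_braid begin

lemma determinant: "A i j * A j i - B i j * B j i = 1"
proof -
  have "B i j * B j i = - (koszul (p i * p j) * koszul (p i * p j) * D i j ^ 2)"
    unfolding B_def D_skew(1)[of j i] by (simp add: mult.commute[of "p j"] power2_eq_square mult_ac)
  then show ?thesis by (simp add: koszul_square A_inv(1))
qed

end

section \<open>The classical dynamical Yang-Baxter equation for operators of weight zero\<close>

text \<open>The value at a point of a classical dynamical r-matrix of weight zero, with diagonal entries
  \<open>\<alpha>\<close> and exchange entries \<open>b\<close>; \<open>Dr c\<close> is its derivative in the direction of the weight \<open>c\<close>.\<close>

locale classical_swap_form =
  fixes p :: "'n::finite \<Rightarrow> bit" and \<alpha> b :: "'n \<Rightarrow> 'n \<Rightarrow> complex"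
    and Dr :: "'n \<Rightarrow> complex^('n\<times>'n)^('n\<times>'n)"
  assumes b_diag: "b i i = 0" and \<alpha>_diag: "\<alpha> i i = 0" and b_skew: "b j i = - b i j"
    and CDYBE: "super_alt p (\<Sum>c\<in>UNIV. tensor12 p (matrix_unit c c) (Dr c))
       + commutator (place12 p (swap_form \<alpha> b)) (place13 p (swap_form \<alpha> b))
       + commutator (place12 p (swap_form \<alpha> b)) (place23 p (swap_form \<alpha> b))
       + commutator (place13 p (swap_form \<alpha> b)) (place23 p (swap_form \<alpha> b)) = 0"
begin

definition T where "T c d i j k l = (if c = d then koszul ((p i + p k + p j + p l) * p c) * Dr c
    $ (i, j) $ (k, l) else 0)"

lemma differential_nth:
  "(\<Sum>e\<in>UNIV. tensor12 p (matrix_unit e e) (Dr e)) $ (c, i, j) $ (d, k, l) = T c d i j k l"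
proof -
  have "(\<Sum>e\<in>UNIV. tensor12 p (matrix_unit e e) (Dr e)) $ (c, i, j) $ (d, k, l)
    = (\<Sum>e\<in>UNIV. if e = c then T c d i j k l else 0)"
    unfolding sum_component tensor12_nth T_def by (intro sum.cong) (auto simp: matrix_unit_def)
  then show ?thesis by simp
qed

definition \<tau> :: "'n \<Rightarrow> 'n \<Rightarrow> 'n \<Rightarrow> complex" where "\<tau> i j k = koszul ((p i + p k) * p j)"

definition f :: "'n\<times>'n\<times>'n \<Rightarrow> 'n \<Rightarrow> 'n \<Rightarrow> 'n \<Rightarrow> complex" where
  "f t i j k = (if (i, j, k) = t then 1 else 0)"

text \<open>The entry of the classical equation in row \<open>(i, j, k)\<close> and column \<open>(l, m, n)\<close>: three
  derivatives from the alternation, then the three commutators.\<close>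

lemma entry:
  "T i l j k m n
    + koszul ((p k + p n) * (p i + p j) + (p i + p j + p l + p m) * p n) * T k n i j l m
    + koszul ((p i + p l) * (p j + p k) + (p j + p k + p m + p n) * p l) * T j m k i n l
    + (\<alpha> i j * (\<alpha> i k * f (l,m,n) i j k + \<tau> i j k * b i k * f (l,m,n) k j i)
        + b i j * (\<alpha> j k * f (l,m,n) j i k + \<tau> j i k * b j k * f (l,m,n) k i j)
      - (\<alpha> i k * (\<alpha> i j * f (l,m,n) i j k + b i j * f (l,m,n) j i k)
        + \<tau> i j k * b i k * (\<alpha> k j * f (l,m,n) k j i + b k j * f (l,m,n) j k i)))
    + (\<alpha> i j * (\<alpha> j k * f (l,m,n) i j k + b j k * f (l,m,n) i k j)
        + b i j * (\<alpha> i k * f (l,m,n) j i k + b i k * f (l,m,n) j k i)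
      - (\<alpha> j k * (\<alpha> i j * f (l,m,n) i j k + b i j * f (l,m,n) j i k)
        + b j k * (\<alpha> i k * f (l,m,n) i k j + b i k * f (l,m,n) k i j)))
    + (\<alpha> i k * (\<alpha> j k * f (l,m,n) i j k + b j k * f (l,m,n) i k j)
        + \<tau> i j k * b i k * (\<alpha> j i * f (l,m,n) k j i + b j i * f (l,m,n) k i j)
      - (\<alpha> j k * (\<alpha> i k * f (l,m,n) i j k + \<tau> i j k * b i k * f (l,m,n) k j i)
        + b j k * (\<alpha> i j * f (l,m,n) i k j + \<tau> i k j * b i j * f (l,m,n) j k i))) = 0"
proof -
  have P: "place12 p (swap_form \<alpha> b) = place12 p (swap_form \<alpha> b) ** mat 1"
    "place13 p (swap_form \<alpha> b) = place13 p (swap_form \<alpha> b) ** mat 1"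
    "place23 p (swap_form \<alpha> b) = place23 p (swap_form \<alpha> b) ** mat 1"
    by simp_all
  have rows: "place12 p (swap_form \<alpha> b) $ (i, j, k) $ t = \<alpha> i j * f t i j k + b i j * f t j i k"
    "place13 p (swap_form \<alpha> b) $ (i, j, k) $ t = \<alpha> i k * f t i j k + \<tau> i j k * b i k * f t k j i"
    "place23 p (swap_form \<alpha> b) $ (i, j, k) $ t = \<alpha> j k * f t i j k + b j k * f t i k j" for i j k t
    by (subst P(1), unfold place12_swap_form_mult[OF b_diag] mat_1_nth f_def \<tau>_def, rule refl)
       (subst P(2), unfold place13_swap_form_mult[OF b_diag] mat_1_nth f_def \<tau>_def, rule refl,
        subst P(3), unfold place23_swap_form_mult[OF b_diag] mat_1_nth f_def \<tau>_def, rule refl)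
  have "(super_alt p (\<Sum>c\<in>UNIV. tensor12 p (matrix_unit c c) (Dr c))
       + commutator (place12 p (swap_form \<alpha> b)) (place13 p (swap_form \<alpha> b))
       + commutator (place12 p (swap_form \<alpha> b)) (place23 p (swap_form \<alpha> b))
       + commutator (place13 p (swap_form \<alpha> b)) (place23 p (swap_form \<alpha> b))) $ (i, j, k) $ (l, m, n)
           = 0"
    by (simp add: CDYBE)
  then show ?thesis
    unfolding commutator_def vector_add_component vector_minus_component
        super_alt_nth differential_nth
      place12_swap_form_mult[OF b_diag] place13_swap_form_mult[OF b_diag]
          place23_swap_form_mult[OF b_diag]
      \<tau>_def[symmetric] rows
    .
qed

text \<open>The exchange entry divided by the sign of the super transposition.\<close>

definition d where "d i j = koszul (p i * p j) * b i j"

text \<open>The following four consequences are single entries of the classical equation. In the entry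
  that transposes the first two of three distinct indices, the commutators cancel each other.\<close>

lemma derivative_in_third_direction:
  assumes "i \<noteq> j" "j \<noteq> k" "i \<noteq> k"
  shows "Dr k $ (i, j) $ (j, i) = 0"
  using entry[of i j j k i k] assms
  by (cases "p i"; cases "p j"; cases "p k")
      (simp_all add: T_def f_def \<tau>_def koszul_def algebra_simps)

text \<open>With a repeated index, one product of two exchange entries survives; it produces a Riccati
  equation.\<close>

lemma derivative_in_first_direction:
  assumes "i \<noteq> j"
  shows "Dr i $ (i, j) $ (j, i) = - koszul (p i) * koszul (p i * p j) * d i j ^ 2"
  using entry[of i j j i i i] assms b_skew[of i j]
  by (cases "p i"; cases "p j") (simp_all add: T_def f_def \<tau>_def koszul_def d_def \<alpha>_diag b_diag
      power2_eq_square add_eq_0_iff)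

text \<open>A 3-cycle of the indices arises only from products of two exchange entries.\<close>

lemma quadratic_relation:
  assumes "i \<noteq> j" "j \<noteq> k" "i \<noteq> k"
  shows "d i j * d j k = d i k * (d i j + d j k)"
  using entry[of i j j k k i] assms b_skew[of i j] b_skew[of j k] b_skew[of i k]
  by (cases "p i"; cases "p j"; cases "p k") (simp_all add: T_def f_def \<tau>_def koszul_def d_def
      algebra_simps add_eq_0_iff)

text \<open>On the diagonal the commutators vanish.\<close>

lemma closed:
  assumes "i \<noteq> j" "j \<noteq> k" "i \<noteq> k"
  shows "Dr i $ (j, k) $ (j, k) + Dr j $ (k, i) $ (k, i) + Dr k $ (i, j) $ (i, j) = 0"
  using entry[of i i j k j k] assms
  by (cases "p i"; cases "p j"; cases "p k")
      (simp_all add: T_def f_def \<tau>_def koszul_def algebra_simps)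

end

section \<open>The quantization in coordinates\<close>

lemma fps_const_koszul: "fps_const (koszul q :: complex) = koszul q"
  by (simp add: koszul_def fps_const_neg[symmetric] del: fps_const_neg)

lemma partial_exp:
  assumes "holomorphic_several f P" "z \<in> P"
  shows "partial a (\<lambda>y. exp (f y)) z = partial a f z * exp (f z)"
proof -
  have "((\<lambda>\<tau>. f (z + \<tau> *s axis a 1)) has_field_derivative partial a f z) (at 0)"
    using partial_field_derivative[OF assms(1), of z 0 a] assms(2) by simp
  from DERIV_chain2[OF DERIV_exp this] show ?thesis
    unfolding partial_def[of a "\<lambda>y. exp (f y)"] by (simp add: DERIV_imp_deriv mult.commute)
qed

lemma partial_minus_cong:
  assumes "holomorphic_several g P" "open P" "z \<in> P" "\<And>y. y \<in> P \<Longrightarrow> f y = - g y"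
  shows "partial a f z = - partial a g z"
proof -
  have "partial a f z = partial a (\<lambda>y. - 1 * g y) z"
    by (rule partial_cong[OF assms(2,3)]) (simp add: assms(4))
  then show ?thesis by (simp only: partial_cmult[OF assms(1,3)]) simp
qed

text \<open>The functions that enter the quantization: \<open>d\<close> is the normalised exchange entry of the
  r-matrix, with the differential equations that the classical equation imposes on it, and \<open>\<eta>\<close> is
  a potential for the diagonal entries, corrected by \<open>d\<close>.\<close>

locale gauge_data =
  fixes P :: "(complex^'n::finite) set" and p :: "'n \<Rightarrow> bit"
    and d :: "'n \<Rightarrow> 'n \<Rightarrow> complex^'n \<Rightarrow> complex" and \<eta> :: "'n \<Rightarrow> complex^'n \<Rightarrow> complex"
  assumes P: "open P" and d_hol: "holomorphic_several (d i j) P"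
      and \<eta>_hol: "holomorphic_several (\<eta> i) P"
    and d_diag: "d i i = (\<lambda>_. 0)" and d_skew: "z \<in> P \<Longrightarrow> d j i z = - d i j z"
    and d_const: "c \<noteq> i \<Longrightarrow> c \<noteq> j \<Longrightarrow> z \<in> P \<Longrightarrow> partial c (d i j) z = 0"
    and d_Riccati: "i \<noteq> j \<Longrightarrow> z \<in> P \<Longrightarrow> partial i (d i j) z = - koszul (p i) * d i j z ^ 2"
    and d_quad: "i \<noteq> j \<Longrightarrow> j \<noteq> k \<Longrightarrow> i \<noteq> k \<Longrightarrow> z \<in> P \<Longrightarrow> d i j z * d j k z = d i k z * (d i j z + d j k z)"
begin

definition g where "g i z = exp (\<eta> i z)"
definition g' where "g' i z = exp (- \<eta> i z)"

definition D where "D i j z = fps_X * fps_const (d i j z)"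

text \<open>With $g_i = e^{\eta_i}$ this is
  $g_i(\lambda)\, g_j(\lambda - \gamma \omega_i) / (g_j(\lambda)\, g_i(\lambda - \gamma \omega_j))$,
  a multiplicative coboundary for the shifts. Its first order term is
  $\partial_j \eta_i - \partial_i \eta_j$, the exterior derivative of \<open>\<eta>\<close> up to sign.\<close>

definition \<phi> where "\<phi> i j z =
    fps_const (g i z) * fps_const (g' j z) * taylor i (g j) z * taylor j (g' i) z"

text \<open>The factor \<open>1 - D i j z\<close> makes the product of \<open>A i j\<close> and \<open>A j i\<close> equal to $1 - D_{ij}^2$,
  as the quantum equation requires; the contribution of \<open>- D\<close> at first order is compensated by the
  choice of \<open>\<eta>\<close>.\<close>

definition A where "A i j z = (1 - D i j z) * \<phi> i j z"

definition B where "B i j z = - (koszul (p i * p j) * D i j z)"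

lemma g_hol: "holomorphic_several (g i) P" "holomorphic_several (g' i) P"
  unfolding g_def[abs_def] g'_def[abs_def]
      by (intro holomorphic_several_exp holomorphic_several_uminus \<eta>_hol)+

lemma gg': "g i z * g' i z = 1"
  by (simp add: g_def g'_def exp_minus)

lemma D_hol: "holomorphic_series (D i j) P"
  unfolding D_def[abs_def] by (intro holomorphic_series_mult holomorphic_series_const
      holomorphic_series_fps_const d_hol)

lemma \<phi>_hol: "holomorphic_series (\<phi> i j) P"
  unfolding \<phi>_def[abs_def]
  by (intro holomorphic_series_mult holomorphic_series_taylor[OF _ P] holomorphic_series_fps_const
      g_hol)

lemma one_minus_D_hol: "holomorphic_series (\<lambda>z. 1 - D i j z) P"
  by (intro holomorphic_series_diff holomorphic_series_const D_hol)

lemma A_hol: "holomorphic_series (A i j) P"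
  unfolding A_def[abs_def] by (intro holomorphic_series_mult one_minus_D_hol \<phi>_hol)

lemma B_eq: "B i j z = - koszul (p i * p j) * D i j z"
  by (simp add: B_def)

lemma B_hol: "holomorphic_series (B i j) P"
  unfolding B_eq[abs_def] by (intro holomorphic_series_mult holomorphic_series_const D_hol)

context
  fixes z assumes z: "z \<in> P"
begin

lemma shift_D: "shift c (D i j) z = fps_X * taylor c (d i j) z"
  unfolding D_def[abs_def]
  by (subst shift_mult[OF holomorphic_series_const holomorphic_series_fps_const[OF d_hol] P z])
     (simp add: shift_const shift_fps_const)

lemma shift_B: "shift c (B i j) z = - (koszul (p i * p j) * shift c (D i j) z)"
  unfolding B_eq[abs_def]
  by (subst shift_mult[OF holomorphic_series_const D_hol P z]) (simp add: shift_const)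

lemma shift_one_minus_D: "shift c (\<lambda>y. 1 - D i j y) z = 1 - shift c (D i j) z"
  by (subst shift_diff[OF holomorphic_series_const D_hol P z]) (simp add: shift_const)

lemma shift_A: "shift c (A i j) z = (1 - shift c (D i j) z) * shift c (\<phi> i j) z"
  unfolding A_def[abs_def]
  by (subst shift_mult[OF one_minus_D_hol \<phi>_hol P z]) (simp only: shift_one_minus_D)

lemma shift_\<phi>: "shift c (\<phi> i j) z =
   taylor c (g i) z * taylor c (g' j) z * shift c (taylor i (g j)) z * shift c (taylor j (g' i)) z"
proof -
  note hol = holomorphic_series_fps_const[OF g_hol(1)[of i]]
      holomorphic_series_fps_const[OF g_hol(2)[of j]]
    holomorphic_series_taylor[OF g_hol(1)[of j] P, of i] holomorphic_series_taylor[OF g_hol(2)[of i]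
        P, of j]
  show ?thesis
    unfolding \<phi>_def[abs_def]
    by (simp only: shift_mult[OF holomorphic_series_mult[OF holomorphic_series_mult[OF hol(1,2)]
        hol(3)] hol(4) P z]
      shift_mult[OF holomorphic_series_mult[OF hol(1,2)] hol(3) P z] shift_mult[OF hol(1,2) P z]
          shift_fps_const)
qed

lemma taylor_gg':
  assumes "y \<in> P"
  shows "taylor c (g i) y * taylor c (g' i) y = 1"
proof -
  have "taylor c (g i) y * taylor c (g' i) y = taylor c (\<lambda>y. g i y * g' i y) y"
    using taylor_mult[OF g_hol P assms] by simp
  then show ?thesis by (simp add: gg' taylor_const)
qed

lemma shift_taylor_gg': "shift c (taylor a (g i)) z * shift c (taylor a (g' i)) z = 1"
proof -
  have "shift c (taylor a (g i)) z * shift c (taylor a (g' i)) z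
      = shift c (\<lambda>y. taylor a (g i) y * taylor a (g' i) y) z"
    using shift_mult[OF holomorphic_series_taylor[OF g_hol(1) P]
        holomorphic_series_taylor[OF g_hol(2) P] P z] by simp
  also have "\<dots> = shift c (\<lambda>_. 1) z"
    by (rule shift_cong[OF P z]) (rule taylor_gg')
  finally show ?thesis by (simp add: shift_const)
qed

lemma \<phi>_inverse:
  assumes "y \<in> P"
  shows "\<phi> i j y * \<phi> j i y = 1"
proof -
  have "\<phi> i j y * \<phi> j i y = fps_const (g i y * g' i y) * fps_const (g j y * g' j y)
     * (taylor i (g j) y * taylor i (g' j) y) * (taylor j (g i) y * taylor j (g' i) y)"
    unfolding \<phi>_def fps_const_mult[symmetric] by (simp only: mult_ac)
  then show ?thesis by (simp add: gg' taylor_gg'[OF assms])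
qed

lemma \<phi>_diag:
  assumes "y \<in> P"
  shows "\<phi> i i y = 1"
proof -
  have "\<phi> i i y = fps_const (g i y * g' i y) * (taylor i (g i) y * taylor i (g' i) y)"
    unfolding \<phi>_def fps_const_mult[symmetric] by (simp only: mult_ac)
  then show ?thesis by (simp add: gg' taylor_gg'[OF assms])
qed

lemma A_diag: "y \<in> P \<Longrightarrow> A i i y = 1"
  by (simp add: A_def D_def d_diag \<phi>_diag)

lemma D_skew: "y \<in> P \<Longrightarrow> D j i y = - D i j y"
  by (simp add: D_def d_skew[of y j i])

lemma A_inverse:
  assumes "y \<in> P"
  shows "A i j y * A j i y = 1 - D i j y * D i j y"
proof -
  have "A i j y * A j i y = (1 - D i j y) * (1 + D i j y) * (\<phi> i j y * \<phi> j i y)"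
    unfolding A_def D_skew[OF assms, of j i] by (simp add: mult_ac)
  then show ?thesis by (simp add: \<phi>_inverse[OF assms] algebra_simps)
qed

lemma shift_D_const:
  assumes "c \<noteq> i" "c \<noteq> j"
  shows "shift c (D i j) z = D i j z"
proof -
  have "taylor c (d i j) z = fps_const (d i j z)"
    by (rule taylor_of_constant_direction[OF d_hol P z]) (rule d_const[OF assms])
  then show ?thesis
    by (simp only: shift_D D_def)
qed

text \<open>Written out in the values of \<open>g\<close> at the points reached by at most two shifts, all factors on
  either side cancel except a common product \<open>W\<close>; the points reached by two shifts do not depend
  on their order.\<close>

lemma \<phi>_cocycle:
  "shift k (\<phi> i j) z * \<phi> i k z * shift i (\<phi> j k) z = \<phi> j k z * shift j (\<phi> i k) z * \<phi> i j z"
proof -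
  define s where "s c a i = shift c (taylor a (g i)) z" for c a i
  define s' where "s' c a i = shift c (taylor a (g' i)) z" for c a i
  define t where "t c i = taylor c (g i) z" for c i
  define t' where "t' c i = taylor c (g' i) z" for c i
  have sym: "s k i j = s i k j" "s j i k = s i j k" "s' j k i = s' k j i"
    unfolding s_def s'_def by (intro shift_taylor_commute[OF _ P z] g_hol)+
  have inv: "s c a i * s' c a i = 1" "t c i * t' c i = 1" for c a i
    unfolding s_def s'_def t_def t'_def by (rule shift_taylor_gg' taylor_gg'[OF z])+
  have one: "fps_const (g j z) * fps_const (g' j z) = 1"
    by (simp add: gg')
  define W where "W = fps_const (g i z) * fps_const (g' k z) * t' k j * s' k j i * t i j * s i j k"
  have "shift k (\<phi> i j) z * \<phi> i k z * shift i (\<phi> j k) z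
      = (t k i * t' k i) * (s i k j * s' i k j) * (t i k * t' i k) * W"
    unfolding shift_\<phi> unfolding \<phi>_def s_def[symmetric] s'_def[symmetric] t_def[symmetric]
        t'_def[symmetric] sym W_def
    by (simp only: mult_ac)
  moreover have "\<phi> j k z * shift j (\<phi> i k) z * \<phi> i j z
      = (fps_const (g j z) * fps_const (g' j z)) * (t j k * t' j k) * (t j i * t' j i) * W"
    unfolding shift_\<phi> unfolding \<phi>_def s_def[symmetric] s'_def[symmetric] t_def[symmetric]
        t'_def[symmetric] sym W_def
    by (simp only: mult_ac)
  ultimately show ?thesis
    by (simp only: inv one)
qed

lemma braid: "dynamical_braid p (\<lambda>i j. A i j z) (\<lambda>i j. D i j z)
   (\<lambda>c i j. shift c (A i j) z) (\<lambda>c i j. shift c (D i j) z)"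
proof
  fix i j k c :: 'n
  show "D i i z = 0" "shift c (D i i) z = 0"
    by (simp_all add: shift_D D_def d_diag taylor_const)
  show "D j i z = - D i j z"
    by (rule D_skew[OF z])
  show "shift c (D j i) z = - shift c (D i j) z"
  proof -
    have "shift c (D j i) z = shift c (\<lambda>y. 0 - D i j y) z"
      by (rule shift_cong[OF P z]) (simp add: D_skew[of _ j i])
    also have "\<dots> = 0 - shift c (D i j) z"
      by (subst shift_diff[OF holomorphic_series_const D_hol P z]) (simp add: shift_const)
    finally show ?thesis by simp
  qed
  show "shift c (D i j) z = D i j z" if "c \<noteq> i" "c \<noteq> j"
    using that by (rule shift_D_const)
  show "shift i (D i j) z = D i j z + koszul (p i) * D i j z * shift i (D i j) z" if "i \<noteq> j"
  proof -
    have "taylor i (d i j) z = fps_const (d i j z) + fps_const (koszul (p i) * d i j z)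
        * fps_X * taylor i (d i j) z"
      by (rule taylor_Riccati[OF d_hol P z]) (rule d_Riccati[OF that])
    then have "fps_X * taylor i (d i j) z = fps_X * (fps_const (d i j z)
        + fps_const (koszul (p i)) * fps_const (d i j z) * fps_X * taylor i (d i j) z)"
      by (simp only: fps_const_mult)
    also have "\<dots> = fps_X * fps_const (d i j z)
        + koszul (p i) * (fps_X * fps_const (d i j z)) * (fps_X * taylor i (d i j) z)"
      unfolding fps_const_koszul by (simp only: distrib_left mult_ac)
    finally show ?thesis
      unfolding shift_D D_def .
  qed
  show "D i j z * D j k z = D i k z * (D i j z + D j k z)" if "i \<noteq> j" "j \<noteq> k" "i \<noteq> k"
  proof -
    have "fps_const (d i j z) * fps_const (d j k z) = fps_const (d i k z) * (fps_const (d i j z)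
        + fps_const (d j k z))"
      using d_quad[OF that z] by simp
    then show ?thesis unfolding D_def by algebra
  qed
  show "A i i z = 1"
    by (rule A_diag[OF z])
  show "shift c (A i i) z = 1"
    using shift_cong[OF P z, of "A i i" "\<lambda>_. 1" c] by (simp add: A_diag shift_const)
  show "A i j z * A j i z = 1 - D i j z ^ 2"
    unfolding power2_eq_square by (rule A_inverse[OF z])
  show "shift c (A i j) z * shift c (A j i) z = 1 - shift c (D i j) z ^ 2"
  proof -
    have "shift c (A i j) z * shift c (A j i) z = shift c (\<lambda>y. A i j y * A j i y) z"
      by (rule shift_mult[OF A_hol A_hol P z, symmetric])
    also have "\<dots> = shift c (\<lambda>y. 1 - D i j y * D i j y) z"
      by (rule shift_cong[OF P z]) (rule A_inverse)
    also have "\<dots> = 1 - shift c (\<lambda>y. D i j y * D i j y) z"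
      by (subst shift_diff[OF holomorphic_series_const holomorphic_series_mult[OF D_hol D_hol] P z])
          (simp add: shift_const)
    also have "\<dots> = 1 - shift c (D i j) z ^ 2"
      unfolding power2_eq_square by (simp only: shift_mult[OF D_hol D_hol P z])
    finally show ?thesis .
  qed
  show "shift k (A i j) z * A i k z * shift i (A j k) z = A j k z * shift j (A i k) z * A i j z"
    if "i \<noteq> j" "j \<noteq> k" "i \<noteq> k"
  proof -
    have D: "shift k (D i j) z = D i j z" "shift i (D j k) z = D j k z" "shift j (D i k) z
        = D i k z"
      using that by (auto intro!: shift_D_const)
    then have "shift k (A i j) z * A i k z * shift i (A j k) z =
        (1 - D i j z) * (1 - D i k z) * (1 - D j k z) * (shift k (\<phi> i j) z * \<phi> i
            k z * shift i (\<phi> j k) z)"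
      unfolding shift_A A_def by (simp only: mult_ac)
    also have "\<dots> = A j k z * shift j (A i k) z * A i j z"
      unfolding \<phi>_cocycle shift_A A_def D by (simp only: mult_ac)
    finally show ?thesis .
  qed
qed

lemma A_order_0: "fps_nth (A i j z) 0 = 1"
  using gg'[of i z] gg'[of j z]
  by (simp add: A_def D_def \<phi>_def fps_nth_taylor[OF g_hol(1) P z] fps_nth_taylor[OF g_hol(2) P z])
      algebra

lemma A_order_1: "fps_nth (A i j z) 1 = partial j (\<eta> i) z - partial i (\<eta> j) z - d i j z"
proof -
  have p1: "partial i (g j) z = partial i (\<eta> j) z * g j z"
    unfolding g_def[abs_def] by (rule partial_exp[OF \<eta>_hol z])
  have "partial j (g' i) z = partial j (\<lambda>y. - \<eta> i y) z * g' i z"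
    unfolding g'_def[abs_def] by (rule partial_exp[OF holomorphic_several_uminus[OF \<eta>_hol] z])
  then have p2: "partial j (g' i) z = - partial j (\<eta> i) z * g' i z"
    using partial_minus_cong[OF \<eta>_hol P z, of "\<lambda>y. - \<eta> i y" i j] by simp
  have 1: "fps_nth (A i j z) 1 = (g i z * g' j z) * (g j z * (- partial j (g' i) z) -
      partial i (g j) z * g' i z)
      - d i j z * ((g i z * g' j z) * (g j z * g' i z))"
    by (simp add: A_def D_def \<phi>_def fps_mult_nth_1 mult.assoc
       fps_nth_taylor[OF g_hol(1) P z] fps_nth_taylor[OF g_hol(2) P z])
  show ?thesis
    unfolding 1 p1 p2 using gg'[of i z] gg'[of j z] by algebra
qed

end

end

section \<open>From functionals to coordinates\<close>

lemma dual_point_line: "dual_point \<omega> (z + \<tau> *s axis c 1) = (\<lambda>h. dual_point \<omega> z h + \<tau> * \<omega> c h)"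
  by (simp add: dual_point_def fun_eq_iff distrib_right sum.distrib axis_def if_distrib[of "\<lambda>x.
      _ * x * _"] cong: if_cong)

lemma dual_point_line_minus: "dual_point \<omega> (z - \<tau> *s axis c 1) = (\<lambda>h. dual_point \<omega> z h - \<tau> * \<omega> c h)"
  using dual_point_line[of \<omega> z "- \<tau>" c] by simp

lemma dual_deriv_nth: "dual_deriv (\<omega> c) f (dual_point \<omega> z) $ s $ t
    = partial c (\<lambda>y. f (dual_point \<omega> y) $ s $ t) z"
  by (simp add: dual_deriv_def partial_def dual_point_line)

text \<open>In the coordinates of the dual, the Taylor expansion of the argument shifted by a weight is
  the formal shift.\<close>

lemma shifted_step_series_nth:
  assumes "\<And>n y. R n (dual_point \<omega> y) $ s $ t = fps_nth (F y) n"
  shows "shifted_step_series R (dual_point \<omega> z) (\<omega> c) $ s $ t = shift c F z"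
  by (simp add: shifted_step_series_def shift_def taylor_def assms flip: dual_point_line_minus)

lemma commutator_diagonal:
  fixes M A :: "'a::comm_ring_1^'m::finite^'m"
  assumes "\<And>s t. M $ s $ t = (if s = t then w s else 0)"
  shows "commutator M A $ s $ t = (w s - w t) * A $ s $ t"
proof -
  have "(M ** A) $ s $ t = w s * A $ s $ t + 0 * A $ s $ t"
    by (rule matrix_mult_two_entries) (auto simp: assms)
  moreover have "(A ** M) $ s $ t = (\<Sum>u\<in>UNIV. if u = t then A $ s $ t * w t else 0)"
    unfolding matrix_matrix_mult_def by (simp add: assms if_distrib[of "(*) _"] cong: if_cong)
  ultimately show ?thesis
    by (simp add: commutator_def algebra_simps)
qed

context weight_basis_module begin

lemma matrix_act_nth: "matrix_wrt sV v (act h) $ i $ j = (if i = j then \<omega> j h else 0)"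
proof -
  have "act h (v j) = sV (\<omega> j h) (v j)"
    using weight[of j] by (simp add: weight_space_def)
  then have "matrix_wrt sV v (act h) $ i $ j = V.representation (range v) (sV (\<omega> j h) (v j)) (v i)"
    by (simp add: matrix_wrt_def)
  also have "\<dots> = \<omega> j h * V.representation (range v) (v j) (v i)"
    using eigenbasis by (subst V.representation_scale) auto
  also have "\<dots> = (if i = j then \<omega> j h else 0)"
    using eigenbasis by (subst V.representation_basis) (auto simp: inj_eq)
  finally show ?thesis .
qed

lemma matrix_dual_basis: "matrix_wrt sV v (act (x c)) = matrix_unit c c"
  by (simp add: vec_eq_iff matrix_act_nth matrix_unit_def dual_basis(4))

lemma dual_point_dual_basis: "dual_point \<omega> z (x i) = z $ i"
  by (simp add: dual_point_def dual_basis(4) if_distrib[of "(*) _"] cong: if_cong)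

lemma weight_commutator_nth:
  "commutator (tensor2 q (matrix_wrt sV v (act h)) (mat 1)
      + tensor2 q (mat 1) (matrix_wrt sV v (act h))) M $ (i, j) $ (k, l)
    = (\<omega> i h + \<omega> j h - \<omega> k h - \<omega> l h) * M $ (i, j) $ (k, l)"
proof -
  have "commutator (tensor2 q (matrix_wrt sV v (act h)) (mat 1)
      + tensor2 q (mat 1) (matrix_wrt sV v (act h))) M $ (i, j) $ (k, l)
    = ((\<lambda>(i, j). \<omega> i h + \<omega> j h) (i, j) - (\<lambda>(i, j). \<omega> i h + \<omega> j h) (k, l)) * M $ (i, j) $ (k, l)"
  proof (rule commutator_diagonal)
    fix s t
    show "(tensor2 q (matrix_wrt sV v (act h)) (mat 1)
        + tensor2 q (mat 1) (matrix_wrt sV v (act h))) $ s $ t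
       = (if s = t then (\<lambda>(i, j). \<omega> i h + \<omega> j h) s else 0)"
      by (cases s; cases t) (auto simp: tensor2_nth matrix_act_nth mat_1_nth koszul_def)
  qed
  then show ?thesis by simp
qed

text \<open>The weights are linearly independent, as evaluation at the dual basis shows, so the weights
  of two basis tensors agree only if their index pairs agree up to order.\<close>

lemma zero_weight_imp_nth_eq_0:
  assumes "zero_weight q (\<lambda>h. matrix_wrt sV v (act h)) M" "(k, l) \<noteq> (i, j)" "(k, l) \<noteq> (j, i)"
  shows "M $ (i, j) $ (k, l) = 0"
proof -
  have eq: "(\<omega> i (x a) + \<omega> j (x a) - \<omega> k (x a) - \<omega> l (x a)) * M $ (i, j) $ (k, l) = 0" for a
    using assms(1) weight_commutator_nth[of q "x a" M i j k l] by (simp add: zero_weight_def)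
  show ?thesis
    using eq[of i] eq[of j] assms(2,3) by (auto simp: dual_basis(4) split: if_splits)
qed

lemma zero_weight_swap_form: "zero_weight q (\<lambda>h. matrix_wrt sV v (act h)) (swap_form A B)"
  unfolding zero_weight_def
  by (auto simp: vec_eq_iff weight_commutator_nth swap_form_nth)

end


lemma open_polydisc_coordinates:
  assumes U: "open_polydisc \<omega> U" and x: "\<And>z i. dual_point \<omega> z (x i) = z $ i"
  shows "open {z. dual_point \<omega> z \<in> U}"
    and "\<exists>c. \<forall>z t. dual_point \<omega> z \<in> U \<longrightarrow> t \<in> {0..1::real} \<longrightarrow> dual_point \<omega> (c
        + of_real t *s (z - c)) \<in> U"
    and "\<xi> \<in> U \<Longrightarrow> \<exists>z. \<xi> = dual_point \<omega> z"
proof -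
  obtain c \<rho> where U_eq: "U = dual_point \<omega> ` {z. \<forall>i. z $ i \<in> ball (c i) (\<rho> i)}"
    using U unfolding open_polydisc_def by blast
  have inj: "dual_point \<omega> y = dual_point \<omega> z \<Longrightarrow> y = z" for y z
    using x by (metis vec_eq_iff)
  have mem: "dual_point \<omega> z \<in> U \<longleftrightarrow> (\<forall>i. z $ i \<in> ball (c i) (\<rho> i))" for z
    unfolding U_eq using inj by blast
  show "open {z. dual_point \<omega> z \<in> U}"
  proof -
    have "open (\<Inter>i\<in>UNIV. (\<lambda>z. z $ i) -` ball (c i) (\<rho> i))"
      by (intro open_INT ballI open_vimage_vec_nth) auto
    moreover have "(\<Inter>i\<in>UNIV. (\<lambda>z. z $ i) -` ball (c i) (\<rho> i)) = {z. dual_point \<omega> z \<in> U}"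
      by (auto simp: mem)
    ultimately show ?thesis
      by simp
  qed
  show "\<exists>c. \<forall>z t. dual_point \<omega> z \<in> U \<longrightarrow> t \<in> {0..1::real} \<longrightarrow> dual_point \<omega> (c
      + of_real t *s (z - c)) \<in> U"
  proof (intro exI[of _ "\<chi> i. c i"] allI impI)
    fix z and t :: real
    assume z: "dual_point \<omega> z \<in> U" and t: "t \<in> {0..1}"
    have "(c i + of_real t * (z $ i - c i)) \<in> ball (c i) (\<rho> i)" for i
    proof -
      have "z $ i \<in> ball (c i) (\<rho> i)" using z mem by blast
      then have "norm (z $ i - c i) < \<rho> i" by (simp add: dist_norm norm_minus_commute)
      moreover have "\<bar>t\<bar> * norm (z $ i - c i) \<le> 1 * norm (z $ i - c i)"
        using t by (intro mult_right_mono) auto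
      ultimately show ?thesis by (simp add: dist_norm norm_mult)
    qed
    moreover have "((\<chi> i. c i) + of_real t *s (z - (\<chi> i. c i))) $ i = c i
        + of_real t * (z $ i - c i)" for i
      by (simp add: algebra_simps)
    ultimately show "dual_point \<omega> ((\<chi> i. c i) + of_real t *s (z - (\<chi> i. c i))) \<in> U"
      unfolding mem by (simp only:) simp
  qed
  show "\<xi> \<in> U \<Longrightarrow> \<exists>z. \<xi> = dual_point \<omega> z"
    unfolding U_eq by blast
qed

section \<open>Quantization of super dynamical r-matrices\<close>

theorem theorem1:
  fixes sL :: "complex \<Rightarrow> 'h::ab_group_add \<Rightarrow> 'h" and gL :: "bit \<Rightarrow> 'h set" and br :: "'h \<Rightarrow> 'h \<Rightarrow> 'h"
    and sV :: "complex \<Rightarrow> 'v::ab_group_add \<Rightarrow> 'v" and gV :: "bit \<Rightarrow> 'v set" and act :: "'h \<Rightarrow> 'v \<Rightarrow> 'v"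
    and \<omega> :: "'n::finite \<Rightarrow> 'h \<Rightarrow> complex" and x :: "'n \<Rightarrow> 'h" and v :: "'n \<Rightarrow> 'v" and p :: "'n \<Rightarrow> bit"
    and H :: "'h \<Rightarrow> complex^'n^'n"
    and r :: "('h \<Rightarrow> complex) \<Rightarrow> complex^('n\<times>'n)^('n\<times>'n)"
    and U :: "('h \<Rightarrow> complex) set"
  assumes "weight_basis_module sL gL br sV gV act \<omega> x v p"
    and "H = (\<lambda>h. matrix_wrt sV v (act h))"
    and "super_dynamical_r_matrix p \<omega> x H r"
    and "open_polydisc \<omega> U"
    and "dual_holomorphic_on \<omega> r U"
  shows "\<exists>R :: nat \<Rightarrow> ('h \<Rightarrow> complex) \<Rightarrow> complex^('n\<times>'n)^('n\<times>'n).
    (\<forall>\<xi>\<in>U. R 0 \<xi> = mat 1 \<and> R 1 \<xi> = - r \<xi>) \<and>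
    super_dynamical_R_matrix_on p \<omega> H U R"
proof -
  interpret W: weight_basis_module sL gL br sV gV act \<omega> x v p
    by (fact assms(1))
  define P where "P = {z. dual_point \<omega> z \<in> U}"
  note polydisc = open_polydisc_coordinates[OF assms(4) W.dual_point_dual_basis]
  have P: "open P"
    unfolding P_def by (rule polydisc(1))
  obtain c where "\<forall>z t. dual_point \<omega> z \<in> U \<longrightarrow> t \<in> {0..1::real} \<longrightarrow> dual_point \<omega> (c
      + of_real t *s (z - c)) \<in> U"
    using polydisc(2) by (elim exE)
  then have star: "\<And>z t. z \<in> P \<Longrightarrow> t \<in> {0..1::real} \<Longrightarrow> c + of_real t *s (z - c) \<in> P"
    by (simp add: P_def)
  have U_image: "U = dual_point \<omega> ` P"
    using polydisc(3) by (auto simp: P_def)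
  define e where "e s t z = r (dual_point \<omega> z) $ s $ t" for s t z
  have e_hol: "holomorphic_several (e s t) P" for s t
    using assms(5)[unfolded dual_holomorphic_on_def, rule_format, of s t]
        unfolding e_def[abs_def] P_def .
  define \<alpha> where "\<alpha> i j z = e (i, j) (i, j) z" for i j z
  define b where "b i j z = (if i = j then 0 else e (i, j) (j, i) z)" for i j z
  have r_matrix: "super_alt p (dynamical_differential p \<omega> x H r (dual_point \<omega> z))
          + commutator (place12 p (r (dual_point \<omega> z))) (place13 p (r (dual_point \<omega> z)))
          + commutator (place12 p (r (dual_point \<omega> z))) (place23 p (r (dual_point \<omega> z)))
          + commutator (place13 p (r (dual_point \<omega> z))) (place23 p (r (dual_point \<omega> z))) = 0"
      "r (dual_point \<omega> z) + super_twist p (r (dual_point \<omega> z)) = 0"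
      "zero_weight p H (r (dual_point \<omega> z))" if z: "z \<in> P" for z
  proof -
    have "dual_holomorphic_on \<omega> r (dual_point \<omega> ` P)"
      using assms(5) U_image by simp
    then have "dual_point \<omega> z \<in> regular_points \<omega> r"
      unfolding regular_points_def
      by (intro CollectI exI[of _ z] exI[of _ P] conjI refl z P)
    then show "super_alt p (dynamical_differential p \<omega> x H r (dual_point \<omega> z))
          + commutator (place12 p (r (dual_point \<omega> z))) (place13 p (r (dual_point \<omega> z)))
          + commutator (place12 p (r (dual_point \<omega> z))) (place23 p (r (dual_point \<omega> z)))
          + commutator (place13 p (r (dual_point \<omega> z))) (place23 p (r (dual_point \<omega> z))) = 0"
      "r (dual_point \<omega> z) + super_twist p (r (dual_point \<omega> z)) = 0"
      "zero_weight p H (r (dual_point \<omega> z))"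
      using bspec[OF conjunct2[OF assms(3)[unfolded super_dynamical_r_matrix_def]]] by simp_all
  qed
  have r_swap_form: "r (dual_point \<omega> z) = swap_form (\<lambda>i j. \<alpha> i j z) (\<lambda>i j. b i j z)" if z: "z \<in> P"
      for z
  proof -
    have "r (dual_point \<omega> z) $ (i, j) $ (k, l)
        = swap_form (\<lambda>i j. \<alpha> i j z) (\<lambda>i j. b i j z) $ (i, j) $ (k, l)" for i j k l
      using W.zero_weight_imp_nth_eq_0[of p "r (dual_point \<omega> z)" k l i j] r_matrix(3)[OF z] assms(2)
      by (auto simp: swap_form_nth \<alpha>_def b_def e_def)
    then show ?thesis by (simp add: vec_eq_iff split_paired_All)
  qed
  have skew: "\<alpha> j i z = - \<alpha> i j z" "b j i z = - b i j z" if z: "z \<in> P" for i j z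
  proof -
    have *: "r (dual_point \<omega> z) $ (i, j) $ (k, l)
        + koszul ((p i + p k) * p l + (p j + p l) * p i) * r (dual_point \<omega> z) $ (j, i) $ (l, k)
            = 0" for k l
      using r_matrix(2)[OF z] by (simp add: vec_eq_iff super_twist_nth del: bit_not_zero_iff)
    have s: "koszul ((p i + p i) * p j + (p j + p j) * p i) = (1::complex)"
      "koszul ((p i + p j) * p i + (p j + p i) * p i) = (1::complex)"
      by (cases "p i"; cases "p j"; simp add: koszul_def)+
    show "\<alpha> j i z = - \<alpha> i j z"
      using *[of i j] unfolding s \<alpha>_def e_def by (simp add: add_eq_0_iff)
    show "b j i z = - b i j z"
      using *[of j i] unfolding s b_def e_def by (simp add: add_eq_0_iff)
  qed
  \<comment> \<open>The classical equations, in terms of the exchange entries without the sign of the super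
    transposition.\<close>
  define d where "d i j z = koszul (p i * p j) * b i j z" for i j z
  have classical: "classical_swap_form p (\<lambda>i j. \<alpha> i j z) (\<lambda>i j. b i j z)
      (\<lambda>c. dual_deriv (\<omega> c) r (dual_point \<omega> z))"
    if z: "z \<in> P" for z
  proof
    show "\<alpha> i i z = 0" for i
      using skew(1)[OF z, of i i] by simp
    show "b i i z = 0" for i
      by (simp add: b_def)
    show "b j i z = - b i j z" for i j
      by (rule skew[OF z])
  qed (use r_matrix(1)[OF z] in \<open>simp add: dynamical_differential_def assms(2)
      W.matrix_dual_basis r_swap_form[OF z]\<close>)
  have b_hol: "holomorphic_several (b i j) P" for i j
    unfolding b_def[abs_def] by (cases "i = j") (auto intro: e_hol)
  have d_hol: "holomorphic_several (d i j) P" for i j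
    unfolding d_def[abs_def] by (intro holomorphic_several_mult holomorphic_several_const b_hol)
  have d_skew: "d j i z = - d i j z" if "z \<in> P" for i j z
    using skew(2)[OF that, of j i] by (simp add: d_def mult.commute)
  have partial_d: "partial c (d i j) z =
      koszul (p i * p j) * dual_deriv (\<omega> c) r (dual_point \<omega> z) $ (i, j) $ (j, i)"
    if "z \<in> P" "i \<noteq> j" for c i j z
    unfolding d_def[abs_def] partial_cmult[OF b_hol that(1)] dual_deriv_nth
    using that(2) by (simp add: b_def[abs_def] e_def[abs_def])
  have d_diag: "d i i = (\<lambda>_. 0)" for i
    by (simp add: d_def b_def fun_eq_iff)
  have d_const: "partial c (d i j) z = 0" if "c \<noteq> i" "c \<noteq> j" "z \<in> P" for c i j z
  proof (cases "i = j")
    case True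
    then show ?thesis by (simp add: d_diag partial_def)
  next
    case False
    interpret classical_swap_form p "\<lambda>i j. \<alpha> i j z" "\<lambda>i j. b i j z"
      "\<lambda>c. dual_deriv (\<omega> c) r (dual_point \<omega> z)"
      by (rule classical[OF that(3)])
    show ?thesis
      using derivative_in_third_direction[of i j c] False that by (simp add: partial_d)
  qed
  have d_Riccati: "partial i (d i j) z = - koszul (p i) * d i j z ^ 2" if "i \<noteq> j" "z \<in> P" for i j z
  proof -
    interpret C: classical_swap_form p "\<lambda>i j. \<alpha> i j z" "\<lambda>i j. b i j z"
      "\<lambda>c. dual_deriv (\<omega> c) r (dual_point \<omega> z)"
      by (rule classical[OF that(2)])
    have "C.d i j = d i j z" by (simp add: C.d_def d_def)
    then have "partial i (d i j) z = - koszul (p i) * (koszul (p i * p j) * koszul (p i * p j))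
        * d i j z ^ 2"
      using C.derivative_in_first_direction[OF that(1)] by (simp add: partial_d[OF that(2,1)])
    then show ?thesis by (simp add: koszul_square)
  qed
  have d_quad: "d i j z * d j k z = d i k z * (d i j z + d j k z)"
    if "i \<noteq> j" "j \<noteq> k" "i \<noteq> k" "z \<in> P" for i j k z
  proof -
    interpret C: classical_swap_form p "\<lambda>i j. \<alpha> i j z" "\<lambda>i j. b i j z"
      "\<lambda>c. dual_deriv (\<omega> c) r (dual_point \<omega> z)"
      by (rule classical[OF that(4)])
    have "C.d = (\<lambda>i j. d i j z)" by (simp add: C.d_def d_def fun_eq_iff)
    then show ?thesis using C.quadratic_relation[OF that(1-3)] by simp
  qed
  \<comment> \<open>The form \<open>\<alpha>\<close> is closed, and so is \<open>d\<close>, because \<open>d i j\<close> varies with the coordinates \<open>i\<close> and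
    \<open>j\<close> only. The difference is what the gauge factor has to produce at first order, next to the
    term \<open>- d\<close> from the factor \<open>1 - D\<close>.\<close>
  define F where "F i j z = \<alpha> i j z - d i j z" for i j z
  have F_hol: "holomorphic_several (F i j) P" for i j
    unfolding F_def[abs_def] \<alpha>_def by (intro holomorphic_several_diff d_hol e_hol)
  have F_skew: "F j i z = - F i j z" if "z \<in> P" for i j z
    by (simp add: F_def skew(1)[OF that, of j i] d_skew[OF that, of j i])
  have partial_F_skew: "partial c (F j i) z = - partial c (F i j) z" if "z \<in> P" for c i j z
    by (rule partial_minus_cong[OF F_hol P that]) (rule F_skew)
  have partial_F_diag: "partial c (F i i) z = 0" if "z \<in> P" for c i z
    using partial_F_skew[OF that, of c i i] by simp
  have partial_F: "partial c (F i j) z = dual_deriv (\<omega> c) r (dual_point \<omega> z) $ (i, j) $ (i, j)"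
    if "c \<noteq> i" "c \<noteq> j" "z \<in> P" for c i j z
  proof -
    have "((\<lambda>\<tau>. F i j (z + \<tau> *s axis c 1)) has_field_derivative
        partial c (\<alpha> i j) z - partial c (d i j) z) (at 0)"
      unfolding F_def \<alpha>_def
      using partial_field_derivative[OF e_hol, of z 0 c "(i, j)" "(i, j)"]
          partial_field_derivative[OF d_hol, of z 0 c i j] that(3)
      by (intro DERIV_diff) (simp_all add: \<alpha>_def[abs_def])
    then have "partial c (F i j) z = partial c (\<alpha> i j) z"
      using d_const[OF that] by (simp add: partial_def[of c "F i j"] DERIV_imp_deriv)
    then show ?thesis by (simp add: dual_deriv_nth \<alpha>_def[abs_def] e_def[abs_def])
  qed
  have F_closed: "partial i (F j k) z + partial j (F k i) z + partial k (F i j) z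
      = 0" if z: "z \<in> P" for i j k z
  proof (cases "i = j \<or> j = k \<or> i = k")
    case True
    then show ?thesis
      using partial_F_skew[OF z, of i i k] partial_F_skew[OF z, of j j i]
          partial_F_skew[OF z, of k k j]
      by (auto simp: partial_F_diag[OF z])
  next
    case False
    interpret classical_swap_form p "\<lambda>i j. \<alpha> i j z" "\<lambda>i j. b i j z"
      "\<lambda>c. dual_deriv (\<omega> c) r (dual_point \<omega> z)"
      by (rule classical[OF z])
    show ?thesis
      using closed[of i j k] False partial_F[OF _ _ z, of i j k] partial_F[OF _ _ z, of j k i]
          partial_F[OF _ _ z, of k i j]
      by auto
  qed
  obtain \<eta> where \<eta>_hol: "\<And>i. holomorphic_several (\<eta> i) P"
    and \<eta>: "\<And>i j z. z \<in> P \<Longrightarrow> partial i (\<eta> j) z - partial j (\<eta> i) z = F i j z"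
  proof -
    show thesis if "\<And>\<eta>. (\<And>i. holomorphic_several (\<eta> i) P) \<Longrightarrow>
        (\<And>i j z. z \<in> P \<Longrightarrow> partial i (\<eta> j) z - partial j (\<eta> i) z = F i j z) \<Longrightarrow> thesis" for thesis
      by (rule Poincare_two_form[of P c F]) (fact P star F_hol F_skew F_closed that)+
  qed
  interpret G: gauge_data P p d \<eta>
    by (rule gauge_data.intro) (fact P d_hol \<eta>_hol d_diag d_skew d_const d_Riccati d_quad)+
  \<comment> \<open>The coordinates of \<open>\<xi>\<close> are its values at the dual basis.\<close>
  define R where "R n \<xi> =
    swap_form (\<lambda>i j. fps_nth (G.A i j (\<chi> a. \<xi> (x a))) n)
      (\<lambda>i j. fps_nth (G.B i j (\<chi> a. \<xi> (x a))) n)" for n \<xi>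
  have R: "R n (dual_point \<omega> z) = swap_form (\<lambda>i j. fps_nth (G.A i j z) n)
      (\<lambda>i j. fps_nth (G.B i j z) n)" for n z
    by (simp add: R_def W.dual_point_dual_basis)
  define S where "S s t z = swap_form (\<lambda>i j. G.A i j z) (\<lambda>i j. G.B i j z) $ s $ t" for s t z
  have RS: "R n (dual_point \<omega> z) $ s $ t = fps_nth (S s t z) n" for n z s t
    by (cases s; cases t) (simp add: R S_def swap_form_nth)
  have S_hol: "holomorphic_series (S s t) P" for s t
  proof -
    obtain i j k l where st: "s = (i, j)" "t = (k, l)" by (cases s; cases t)
    consider "i = k \<and> j = l" | "\<not> (i = k \<and> j = l)" "i = l \<and> j = k"
      | "\<not> (i = k \<and> j = l)" "\<not> (i = l \<and> j = k)" by blast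
    then show ?thesis
      unfolding S_def[abs_def] st swap_form_nth
      by cases (simp_all only: if_True if_False simp_thms G.A_hol G.B_hol holomorphic_series_const)
  qed
  have step: "step_series R (dual_point \<omega> z) = swap_form (\<lambda>i j. G.A i j z) (\<lambda>i j. G.B i j z)" for z
  proof -
    have "step_series R (dual_point \<omega> z) $ s $ t = S s t z" for s t
      unfolding step_series_def vec_lambda_beta RS by (rule fps_ext) (simp only: fps_nth_Abs_fps)
    then show ?thesis
      by (simp only: vec_eq_iff S_def) simp
  qed
  have shifted: "shifted_step_series R (dual_point \<omega> z) (\<omega> c)
      = swap_form (\<lambda>i j. shift c (G.A i j) z) (\<lambda>i j. shift c (G.B i j) z)" for z c
  proof -
    have "shifted_step_series R (dual_point \<omega> z) (\<omega> c) $ (i, j) $ (k, l)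
        = swap_form (\<lambda>i j. shift c (G.A i j) z) (\<lambda>i j. shift c (G.B i j) z) $ (i, j) $ (k, l)"
            for i j k l
    proof -
      consider "i = k \<and> j = l" | "\<not> (i = k \<and> j = l)" "i = l \<and> j = k"
        | "\<not> (i = k \<and> j = l)" "\<not> (i = l \<and> j = k)" by blast
      then show ?thesis
        unfolding shifted_step_series_nth[of R \<omega> "(i, j)" "(k, l)", OF RS]
            S_def[abs_def] swap_form_nth
        by cases (simp_all only: if_True if_False simp_thms shift_const)
    qed
    then show ?thesis by (simp only: vec_eq_iff split_paired_All) simp
  qed
  have "R 0 \<xi> = mat 1 \<and> R 1 \<xi> = - r \<xi>" if "\<xi> \<in> U" for \<xi>
  proof -
    obtain z where z: "z \<in> P" and \<xi>: "\<xi> = dual_point \<omega> z"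
      using \<open>\<xi> \<in> U\<close> U_image by blast
    have "R 0 \<xi> $ (i, j) $ (k, l) = mat 1 $ (i, j) $ (k, l)" for i j k l
      by (simp add: \<xi> R swap_form_nth mat_1_nth G.A_order_0[OF z] G.B_eq G.D_def)
    moreover have "R 1 \<xi> $ (i, j) $ (k, l) = - r \<xi> $ (i, j) $ (k, l)" for i j k l
    proof -
      have "fps_nth (G.A i j z) 1 = - \<alpha> i j z" for i j
        using \<eta>[OF z, of i j] by (simp only: G.A_order_1[OF z] F_def) (simp add: algebra_simps)
      moreover have "fps_nth (G.B i j z) 1 = - b i j z" for i j
      proof -
        have "fps_nth (G.B i j z) 1 = - (koszul (p i * p j) * koszul (p i * p j)) * b i j z"
          unfolding G.B_eq G.D_def fps_const_koszul[symmetric] by (simp add: d_def fps_mult_nth_1)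
        then show ?thesis by (simp add: koszul_square)
      qed
      ultimately show ?thesis
        by (simp only: \<xi> R r_swap_form[OF z] swap_form_nth vector_uminus_component) simp
    qed
    ultimately show ?thesis by (simp add: vec_eq_iff split_paired_All)
  qed
  moreover have "super_dynamical_R_matrix_on p \<omega> H U R"
    unfolding super_dynamical_R_matrix_on_def
  proof (intro conjI allI ballI)
    show "dual_holomorphic_on \<omega> (R n) U" for n
      unfolding dual_holomorphic_on_def RS P_def[symmetric]
      by (intro allI S_hol[unfolded holomorphic_series_def, rule_format])
  next
    fix \<xi> assume "\<xi> \<in> U"
    then obtain z where z: "z \<in> P" and \<xi>: "\<xi> = dual_point \<omega> z"
      using U_image by blast
    interpret Q: dynamical_braid p "\<lambda>i j. G.A i j z" "\<lambda>i j. G.D i j z"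
       "\<lambda>c i j. shift c (G.A i j) z" "\<lambda>c i j. shift c (G.D i j) z"
      by (rule G.braid[OF z])
    have B: "(\<lambda>i j. G.B i j z) = Q.B" "(\<lambda>i j. shift c (G.B i j) z) = Q.Bs c" for c
      by (simp_all add: fun_eq_iff G.B_def Q.B_def G.shift_B[OF z] Q.Bs_def)
    show "invertible (step_series R \<xi>)"
      unfolding \<xi> step B by (rule swap_form_invertible) (rule Q.B_diag Q.determinant)+
    show "QDYBE p \<omega> R \<xi>"
      unfolding QDYBE_def Let_def \<xi> step shifted B by (rule Q.matrix_equation)
    show "zero_weight p H (R n \<xi>)" for n
      unfolding R_def assms(2) by (rule W.zero_weight_swap_form)
  qed
  ultimately show ?thesis by blast
qed

end
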